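(* Let $\{X(t),t\ge0\}$ be a centered Gaussian process with almost surely continuous and bounded sample paths whose standard deviation function $\sigma(t)=\sqrt{\mathrm{Var}(X(t))}$ attains its maximum over $[0,\infty)$ at the unique point $t_0>0$, with $\sigma(t_0)=1$, and suppose that: (A1) there are constants $a>0,\beta>0$ with $\sigma(t)=1-a|t-t_0|^{\beta}+o(|t-t_0|^{\beta})$ as $t\to t_0$; (A2) there are constants $d>0$, $\alpha\in(0,2]$ with $\mathrm{Cov}\big(X(s)/\sigma(s),X(t)/\sigma(t)\big)=1-d|t-s|^{\alpha}+o(|t-s|^{\alpha})$ as $s\to t_0,t\to t_0$; (A3) there are constants $G>0$, $H>t_0$ and $r\in(0,2]$ such that $\mathbb{E}\big((X(t)-X(s))^2\big)\le G|t-s|^{r}$ for all $s,t\in[0,H]$ with $|s-t|<1$; (A4) $\limsup_{t\to\infty}\sigma(t)<1$. Let $\gamma\ge0$ and let $\mathcal{T}$ be a non-negative random variable independent of $X$ with $\lim_{u\to\infty}\log\mathbb{P}(\mathcal{T}>u)/u^{p}=-L$ for some $L>0$, $p>0$. Set $\psi_{\mathcal{T}}(u)=\mathbb{P}\big(\sup_{t\in[0,\mathcal{T}/u^{\gamma}]}X(t)>u\big)$. (i) If $\gamma p<2$, then $\lim_{u\to\infty}\log\psi_{\mathcal{T}}(u)/u^2=-1/2$. (ii) If $\gamma p=2$, $A_0>0$, and on every compact subset of $(0,\infty)$ the function $\widehat\sigma$ is differentiable with $|\widehat\sigma'|$ uniformly bounded, then $\lim_{u\to\infty}\log\psi_{\mathcal{T}}(u)/u^2=-\widetilde\sigma_{L,\gamma}(A_0)$.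 (iii) If $\gamma p>2$ and $\sigma(0)>0$, then $\lim_{u\to\infty}\log\psi_{\mathcal{T}}(u)/u^2=-\frac{1}{2\sigma^2(0)}$. (iv) If $\gamma p>2$ and $\sigma(t)=Dt^{\eta}(1+o(1))$ as $t\downarrow0$ for some constants $D>0$, $\eta>0$, then $$\lim_{u\to\infty}\frac{\log\psi_{\mathcal{T}}(u)}{u^{2p(\eta\gamma+1)/(2\eta+p)}}=-A_1,\qquad A_1=\tfrac12D^{-\frac{2p}{2\eta+p}}(Lp/\eta)^{\frac{2\eta}{2\eta+p}}+L^{\frac{2\eta}{2\eta+p}}\big(\eta/(pD^2)\big)^{\frac{p}{2\eta+p}}.$$
   Context: Notation: $\widehat\sigma(s)=\sup_{t\in[0,s]}\sigma(t)$ and $\widetilde\sigma_{L,\gamma}(s)=\frac{1}{2\widehat\sigma^2(s)}+Ls^{2/\gamma}$ for $s\ge0$; $A_0$ is the infimum of the set of minimizers of $\widetilde\sigma_{L,\gamma}(t)$ over $t\in[0,t_0]$, i.e. $A_0=\inf\{A: A\in\arg\inf_{t\le t_0}\widetilde\sigma_{L,\gamma}(t)\}$. *)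

theory Defs
  imports "HOL-Probability.Probability"
begin

definition centered_gaussian_process ::
  "'a measure \<Rightarrow> (real \<Rightarrow> 'a \<Rightarrow> real) \<Rightarrow> bool" where
  "centered_gaussian_process M X \<longleftrightarrow>
     prob_space M \<and>
     (\<forall>t\<ge>0. X t \<in> borel_measurable M) \<and>
     (\<forall>I c. finite I \<and> I \<subseteq> {0..} \<longrightarrow>
        (let Y = (\<lambda>\<omega>. \<Sum>t\<in>I. c t * X t \<omega>) in
          (AE \<omega> in M. Y \<omega> = 0) \<or> (\<exists>s>0. distributed M lborel Y (normal_density 0 s))))"

definition sdev :: "'a measure \<Rightarrow> (real \<Rightarrow> 'a \<Rightarrow> real) \<Rightarrow> real \<Rightarrow> real" where
  "sdev M X t = sqrt (\<integral>\<omega>. (X t \<omega> - (\<integral>\<omega>'. X t \<omega>' \<partial>M))\<^sup>2 \<partial>M)"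

definition covar :: "'a measure \<Rightarrow> ('a \<Rightarrow> real) \<Rightarrow> ('a \<Rightarrow> real) \<Rightarrow> real" where
  "covar M Y Z = (\<integral>\<omega>. (Y \<omega> - (\<integral>\<omega>'. Y \<omega>' \<partial>M)) * (Z \<omega> - (\<integral>\<omega>'. Z \<omega>' \<partial>M)) \<partial>M)"

definition sigma_hat :: "(real \<Rightarrow> real) \<Rightarrow> real \<Rightarrow> real" where
  "sigma_hat \<sigma> s = (SUP t\<in>{0..s}. \<sigma> t)"

text \<open>sigma-tilde_{L,gamma}(s) = 1/(2 sigma-hat(s)^2) + L s^(2/gamma), valued in the extended
  reals so that 1/0 = +\<infinity> as in the paper.\<close>
definition sigma_tilde :: "(real \<Rightarrow> real) \<Rightarrow> real \<Rightarrow> real \<Rightarrow> real \<Rightarrow> ereal" where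
  "sigma_tilde \<sigma> L \<gamma> s =
     (if sigma_hat \<sigma> s = 0 then \<infinity>
      else ereal (1 / (2 * (sigma_hat \<sigma> s)\<^sup>2) + L * s powr (2 / \<gamma>)))"

definition A0 :: "(real \<Rightarrow> real) \<Rightarrow> real \<Rightarrow> real \<Rightarrow> real \<Rightarrow> real" where
  "A0 \<sigma> L \<gamma> t0 = Inf {A \<in> {0..t0}. sigma_tilde \<sigma> L \<gamma> A = (INF t\<in>{0..t0}. sigma_tilde \<sigma> L \<gamma> t)}"

definition psiT :: "'a measure \<Rightarrow> (real \<Rightarrow> 'a \<Rightarrow> real) \<Rightarrow> ('a \<Rightarrow> real) \<Rightarrow> real \<Rightarrow> real \<Rightarrow> real" where
  "psiT M X T \<gamma> u =
     measure (completion M) {\<omega> \<in> space M. (SUP t\<in>{0..T \<omega> / u powr \<gamma>}. X t \<omega>) > u}"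

end

theory Submission
  imports Defs "HOL-Real_Asymp.Real_Asymp"
begin

text \<open>
  Up to a null set the overshoot event is \<open>\<Union>\<^sub>q {T \<ge> q u\<^bsup>\<gamma>\<^esup>} \<inter> {X(q) > u}\<close> over rational \<open>q\<close>. A single time \<open>t\<close>
  gives the lower bound \<open>P(T \<ge> t u\<^bsup>\<gamma>\<^esup>) P(X(t) > u)\<close>; a finite grid of times \<open>s\<^sub>k\<close> gives the upper bound
  \<open>\<Sum>\<^sub>k P(T \<ge> s\<^sub>k u\<^bsup>\<gamma>\<^esup>) P(sup\<^bsub>[0,s\<^sub>k\<^sub>+\<^sub>1]\<^esub> X > u)\<close>. In all four regimes the two exponents agree as the mesh tends to
  zero, provided that \<open>P(sup\<^bsub>[0,s]\<^esub> X > u) \<le> exp (- (u - m)\<^sup>2 / (2 c\<^sup>2))\<close> whenever \<open>\<sigma> \<le> c\<close> on \<open>[0,s]\<close>, with one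
  constant \<open>m\<close> for all \<open>s \<le> \<infinity>\<close> (Borell--TIS, with the sharp constant).

  For that, let \<open>F\<close> be a softmax of finitely many coordinates and write \<open>X\<close> in law as a sum of \<open>n\<close> independent
  copies of \<open>X / \<surd>n\<close>. Averaging \<open>F\<close> over the remaining copies, one copy changes the value by a convex combination of
  its coordinates (variance at most \<open>c\<^sup>2 / n\<close>) up to \<open>O(1/n)\<close>, so it contributes a factor
  \<open>exp (\<lambda>\<^sup>2 c\<^sup>2 / (2n) + O(n\<^bsup>-3/2\<^esup>))\<close> to \<open>E exp (\<lambda>(F - E F))\<close>. The lower deviation bound then
  controls \<open>E max X\<close> by a quantile of the almost surely finite supremum. The identity in law follows from the
  one-dimensional uniqueness theorem for characteristic functions, one coordinate at a time.
\<close>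

text \<open>The constant \<open>1 / (2 c^2)\<close> has to be exact, because the limits equate it
  with the exponent of a single Gaussian tail. Two features of the copy-by-copy argument make this
  possible. The conditional mean of each increment is kept as an exact factor, so these factors
  telescope to \<open>E F\<close>, and the curvature of the softmax (of order \<open>b\<close>)
  enters only errors of order \<open>n^(-3/2)\<close>, whose sum over n copies vanishes. Only then
  is \<open>b\<close> sent to infinity. Uniformity of \<open>m\<close> is essential because
  \<open>c\<close> varies over the grid and, for \<open>gamma p > 2\<close> with
  \<open>sigma(t) ~ D t^eta\<close>, the grid itself shrinks like \<open>u^(-theta)\<close>. Hence
  \<open>m\<close> is chosen before the index set and before \<open>c\<close>, from the variance
  bound 1 alone. In that last regime the horizon cost \<open>u^((gamma - theta) p)\<close> and the
  Gaussian cost \<open>u^(2 + 2 eta theta)\<close> balance, which fixes theta and the normalisation.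
  Condition (A3) enters through mean-square continuity, which makes sigma continuous on
  \<open>[0, t0]\<close>.\<close>

section \<open>Finite-dimensional laws and characteristic functions\<close>

text \<open>Normalising the weights turns both sides into probability laws on the line with equal
  characteristic functions, so uniqueness applies. The weight lets the remaining coordinates be
  carried along while one coordinate is treated.\<close>

lemma weighted_measure_eq_of_char:
  fixes M1 :: "'a measure" and M2 :: "'b measure" and g1 Y1 g2 Y2
  assumes M1: "prob_space M1" and M2: "prob_space M2"
    and [measurable]: "g1 \<in> borel_measurable M1" "Y1 \<in> borel_measurable M1"
      "g2 \<in> borel_measurable M2" "Y2 \<in> borel_measurable M2"
    and g1: "\<And>x. 0 \<le> g1 x" "\<And>x. g1 x \<le> (C::real)"
    and g2: "\<And>x. 0 \<le> g2 x" "\<And>x. g2 x \<le> C"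
    and eq: "\<And>b. (\<integral>x. g1 x *\<^sub>R iexp (b * Y1 x) \<partial>M1) = (\<integral>x. g2 x *\<^sub>R iexp (b * Y2 x) \<partial>M2)"
    and [measurable]: "B \<in> sets borel"
  shows "(\<integral>x. g1 x * indicator B (Y1 x) \<partial>M1) = (\<integral>x. g2 x * indicator B (Y2 x) \<partial>M2)"
proof -
  interpret M1: prob_space M1 by fact
  interpret M2: prob_space M2 by fact
  have i1: "integrable M1 g1"
    by (rule M1.integrable_const_bound[where B=C]) (use g1 in auto)
  have i2: "integrable M2 g2"
    by (rule M2.integrable_const_bound[where B=C]) (use g2 in auto)
  define m where "m = (\<integral>x. g1 x \<partial>M1)"
  \<comment> \<open>At \<open>b = 0\<close> the hypothesis equates the total masses.\<close>
  have m_eq: "m = (\<integral>x. g2 x \<partial>M2)"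
  proof -
    have "complex_of_real (\<integral>x. g1 x \<partial>M1) = complex_of_real (\<integral>x. g2 x \<partial>M2)"
      using eq[of 0] by (simp add: scaleR_conv_of_real)
    then show ?thesis unfolding m_def using of_real_eq_iff by blast
  qed
  have m0: "m \<ge> 0" unfolding m_def using g1 by (simp add: integral_nonneg_AE)
  show ?thesis
  \<comment> \<open>Mass zero cannot be normalised, but then both weights vanish almost
    everywhere.\<close>
  proof (cases "m = 0")
    case True
    have "AE x in M1. g1 x = 0"
      using True integral_nonneg_eq_0_iff_AE[OF i1] g1 unfolding m_def by auto
    then have a: "(\<integral>x. g1 x * indicator B (Y1 x) \<partial>M1) = 0"
      by (intro integral_eq_zero_AE) auto
    have "AE x in M2. g2 x = 0"
      using True m_eq integral_nonneg_eq_0_iff_AE[OF i2] g2 by auto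
    then have "(\<integral>x. g2 x * indicator B (Y2 x) \<partial>M2) = 0"
      by (intro integral_eq_zero_AE) auto
    with a show ?thesis by simp
  next
    case False
    then have m: "m > 0" using m0 by simp
    define N1 where "N1 = distr (density M1 (\<lambda>x. ennreal (g1 x / m))) borel Y1"
    define N2 where "N2 = distr (density M2 (\<lambda>x. ennreal (g2 x / m))) borel Y2"
    have p1: "prob_space (density M1 (\<lambda>x. ennreal (g1 x / m)))"
    proof (rule prob_spaceI)
      have "(\<integral>\<^sup>+x. ennreal (g1 x / m) \<partial>M1) = ennreal (\<integral>x. g1 x / m \<partial>M1)"
        by (rule nn_integral_eq_integral) (use i1 g1 m in auto)
      then show "emeasure (density M1 (\<lambda>x. ennreal (g1 x / m))) (space (density M1 (\<lambda>x. ennreal (g1 x / m)))) = 1"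
        using m by (simp add: emeasure_density m_def cong: nn_integral_cong)
    qed
    have p2: "prob_space (density M2 (\<lambda>x. ennreal (g2 x / m)))"
    proof (rule prob_spaceI)
      have "(\<integral>\<^sup>+x. ennreal (g2 x / m) \<partial>M2) = ennreal (\<integral>x. g2 x / m \<partial>M2)"
        by (rule nn_integral_eq_integral) (use i2 g2 m in auto)
      then show "emeasure (density M2 (\<lambda>x. ennreal (g2 x / m))) (space (density M2 (\<lambda>x. ennreal (g2 x / m)))) = 1"
        using m m_eq by (simp add: emeasure_density cong: nn_integral_cong)
    qed
    have "real_distribution N1" "real_distribution N2"
      unfolding N1_def N2_def
      by (intro prob_space.real_distribution_distr p1 p2; simp)+
    moreover have "char N1 = char N2"
    proof
      fix b
      have "char N1 b = (\<integral>x. (g1 x / m) *\<^sub>R iexp (b * Y1 x) \<partial>M1)"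
        unfolding N1_def char_def using g1 m
        by (subst integral_distr, simp, simp) (subst integral_density, auto)
      also have "\<dots> = (\<integral>x. (1 / m) *\<^sub>R (g1 x *\<^sub>R iexp (b * Y1 x)) \<partial>M1)"
        by (simp add: divide_inverse mult.commute)
      also have "\<dots> = (\<integral>x. (1 / m) *\<^sub>R (g2 x *\<^sub>R iexp (b * Y2 x)) \<partial>M2)"
        by (simp only: integral_scaleR_right eq)
      also have "\<dots> = (\<integral>x. (g2 x / m) *\<^sub>R iexp (b * Y2 x) \<partial>M2)"
        by (simp add: divide_inverse mult.commute)
      also have "\<dots> = char N2 b"
        unfolding N2_def char_def using g2 m
        by (subst integral_distr, simp, simp) (subst integral_density, auto)
      finally show "char N1 b = char N2 b" .
    qed
    ultimately have N: "N1 = N2" by (rule Levy_uniqueness)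
    have "(\<integral>x. g1 x / m * indicator B (Y1 x) \<partial>M1) = (\<integral>y. indicator B y \<partial>N1)"
      unfolding N1_def using g1 m
      by (subst integral_distr, simp, simp) (subst integral_density, auto)
    also have "\<dots> = (\<integral>x. g2 x / m * indicator B (Y2 x) \<partial>M2)"
      unfolding N N2_def using g2 m
      by (subst integral_distr, simp, simp) (subst integral_density, auto)
    finally show ?thesis using m by simp
  qed
qed

text \<open>Turns the factor \<open>iexp (b * Y)\<close> into an indicator while a phase
  \<open>iexp a\<close> remains. That phase is complex, so it is split into the nonnegative weights
  \<open>1 + cos a\<close> and \<open>1 + sin a\<close>, to which the previous lemma applies; the
  hypothesis at \<open>q = -1, 0, 1\<close> supplies their transforms.\<close>

lemma iexp_weighted_eq_of_char:
  fixes M1 :: "'a measure" and M2 :: "'b measure" and h1 Y1 h2 Y2 a1 a2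
  assumes M1: "prob_space M1" and M2: "prob_space M2"
    and [measurable]: "h1 \<in> borel_measurable M1" "Y1 \<in> borel_measurable M1" "a1 \<in> borel_measurable M1"
      "h2 \<in> borel_measurable M2" "Y2 \<in> borel_measurable M2" "a2 \<in> borel_measurable M2"
    and h1: "\<And>x. 0 \<le> h1 x" "\<And>x. h1 x \<le> (1::real)"
    and h2: "\<And>x. 0 \<le> h2 x" "\<And>x. h2 x \<le> 1"
    and eq: "\<And>q b. (\<integral>x. h1 x *\<^sub>R iexp (q * a1 x + b * Y1 x) \<partial>M1) = (\<integral>x. h2 x *\<^sub>R iexp (q * a2 x + b * Y2 x) \<partial>M2)"
    and B[measurable]: "B \<in> sets borel"
  shows "(\<integral>x. (h1 x * indicator B (Y1 x)) *\<^sub>R iexp (a1 x) \<partial>M1) = (\<integral>x. (h2 x * indicator B (Y2 x)) *\<^sub>R iexp (a2 x) \<partial>M2)"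
proof -
  interpret M1: prob_space M1 by fact
  interpret M2: prob_space M2 by fact
  have i1[simp]: "integrable M1 (\<lambda>x. h1 x *\<^sub>R iexp (a * a1 x + b * Y1 x))" for a b
    by (rule M1.integrable_const_bound[where B=1]) (use h1 in auto)
  have i2[simp]: "integrable M2 (\<lambda>x. h2 x *\<^sub>R iexp (a * a2 x + b * Y2 x))" for a b
    by (rule M2.integrable_const_bound[where B=1]) (use h2 in auto)
  have cos_ex: "(h * (1 + cos t)) *\<^sub>R iexp (b * y) =
      h *\<^sub>R iexp (0 * t + b * y) + (1/2) *\<^sub>R (h *\<^sub>R iexp (1 * t + b * y)) + (1/2) *\<^sub>R (h *\<^sub>R iexp ((-1) * t + b * y))"
    for h t b y :: real
    by (simp add: complex_eq_iff Re_exp Im_exp cos_add sin_add algebra_simps cos_diff sin_diff)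
  have sin_ex: "(h * (1 + sin t)) *\<^sub>R iexp (b * y) =
      h *\<^sub>R iexp (0 * t + b * y) + (-\<i>/2) * (h *\<^sub>R iexp (1 * t + b * y)) + (\<i>/2) * (h *\<^sub>R iexp ((-1) * t + b * y))"
    for h t b y :: real
    by (simp add: complex_eq_iff Re_exp Im_exp cos_add sin_add algebra_simps cos_diff sin_diff)
      (simp add: field_simps)
  have bnd: "0 \<le> h * (1 + c)" "h * (1 + c) \<le> 2" if "0 \<le> h" "h \<le> 1" "-1 \<le> c" "c \<le> 1" for h c :: real
    using that mult_mono[of h 1 "1 + c" 2] by auto
  have c: "(\<integral>x. (h1 x * (1 + cos (a1 x))) * indicator B (Y1 x) \<partial>M1) = (\<integral>x. (h2 x * (1 + cos (a2 x))) * indicator B (Y2 x) \<partial>M2)"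
  proof (rule weighted_measure_eq_of_char[where C=2, OF M1 M2])
    show "(\<integral>x. (h1 x * (1 + cos (a1 x))) *\<^sub>R iexp (b * Y1 x) \<partial>M1) = (\<integral>x. (h2 x * (1 + cos (a2 x))) *\<^sub>R iexp (b * Y2 x) \<partial>M2)" for b
      unfolding cos_ex
      by (simp only: Bochner_Integration.integral_add i1 i2 integrable_scaleR_right integral_scaleR_right Bochner_Integration.integrable_add eq simp_thms)
  qed (use h1 h2 in \<open>auto intro!: bnd\<close>)
  have s: "(\<integral>x. (h1 x * (1 + sin (a1 x))) * indicator B (Y1 x) \<partial>M1) = (\<integral>x. (h2 x * (1 + sin (a2 x))) * indicator B (Y2 x) \<partial>M2)"
  proof (rule weighted_measure_eq_of_char[where C=2, OF M1 M2])
    show "(\<integral>x. (h1 x * (1 + sin (a1 x))) *\<^sub>R iexp (b * Y1 x) \<partial>M1) = (\<integral>x. (h2 x * (1 + sin (a2 x))) *\<^sub>R iexp (b * Y2 x) \<partial>M2)" for b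
      unfolding sin_ex
      by (simp only: Bochner_Integration.integral_add i1 i2 integrable_mult_right integral_mult_right_zero Bochner_Integration.integrable_add eq simp_thms)
  qed (use h1 h2 in \<open>auto intro!: bnd\<close>)
  have z: "(\<integral>x. h1 x * indicator B (Y1 x) \<partial>M1) = (\<integral>x. h2 x * indicator B (Y2 x) \<partial>M2)"
    by (rule weighted_measure_eq_of_char[where C=1, OF M1 M2]) (use h1 h2 eq[of 0] in auto)
  \<comment> \<open>Reassembles \<open>iexp t\<close> as
    \<open>(1 + cos t) + i (1 + sin t) - (1 + i)\<close>, hence the third integral, with the bare
    weight.\<close>
  have ex: "(h * i) *\<^sub>R iexp t = of_real ((h * (1 + cos t)) * i) + \<i> * of_real ((h * (1 + sin t)) * i) - (1 + \<i>) * of_real (h * i)"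
    for h i t :: real
    by (simp add: complex_eq_iff Re_exp Im_exp algebra_simps)
  have ibc1: "integrable M1 (\<lambda>x. (h1 x * (1 + cos (a1 x))) * indicator B (Y1 x))"
    by (rule M1.integrable_const_bound[where B=2]) (use h1 in \<open>auto simp: indicator_def bnd intro!: bnd\<close>)
  have ibs1: "integrable M1 (\<lambda>x. (h1 x * (1 + sin (a1 x))) * indicator B (Y1 x))"
    by (rule M1.integrable_const_bound[where B=2]) (use h1 in \<open>auto simp: indicator_def bnd intro!: bnd\<close>)
  have ibz1: "integrable M1 (\<lambda>x. h1 x * indicator B (Y1 x))"
    by (rule M1.integrable_const_bound[where B=1]) (use h1 in \<open>auto simp: indicator_def\<close>)
  have ibc2: "integrable M2 (\<lambda>x. (h2 x * (1 + cos (a2 x))) * indicator B (Y2 x))"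
    by (rule M2.integrable_const_bound[where B=2]) (use h2 in \<open>auto simp: indicator_def bnd intro!: bnd\<close>)
  have ibs2: "integrable M2 (\<lambda>x. (h2 x * (1 + sin (a2 x))) * indicator B (Y2 x))"
    by (rule M2.integrable_const_bound[where B=2]) (use h2 in \<open>auto simp: indicator_def bnd intro!: bnd\<close>)
  have ibz2: "integrable M2 (\<lambda>x. h2 x * indicator B (Y2 x))"
    by (rule M2.integrable_const_bound[where B=1]) (use h2 in \<open>auto simp: indicator_def\<close>)
  show ?thesis
    unfolding ex
    by (simp only: Bochner_Integration.integral_add Bochner_Integration.integral_diff integrable_mult_right integral_mult_right_zero
       Bochner_Integration.integrable_add Bochner_Integration.integrable_diff
       integrable_of_real integral_of_real ibc1 ibs1 ibz1 ibc2 ibs2 ibz2 c s z simp_thms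
       complex_of_real_integrable_eq)
qed

text \<open>Interpolates between equal characteristic functions (\<open>K\<close> empty) and equal
  probabilities of rectangles (\<open>K = I\<close>), adding one indicator per step. The phase keeps
  all coordinates, including those in \<open>K\<close>, so that \<open>c\<close> stays arbitrary in
  the induction.\<close>

lemma indicator_prod_char_eq:
  fixes M1 :: "'a measure" and M2 :: "'b measure" and V :: "'i \<Rightarrow> 'a \<Rightarrow> real" and W :: "'i \<Rightarrow> 'b \<Rightarrow> real"
  assumes M1: "prob_space M1" and M2: "prob_space M2" and I: "finite I"
    and mV: "\<And>i. i \<in> I \<Longrightarrow> V i \<in> borel_measurable M1"
    and mW: "\<And>i. i \<in> I \<Longrightarrow> W i \<in> borel_measurable M2"
    and eq: "\<And>c. (\<integral>x. iexp (\<Sum>i\<in>I. c i * V i x) \<partial>M1) = (\<integral>x. iexp (\<Sum>i\<in>I. c i * W i x) \<partial>M2)"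
    and K: "K \<subseteq> I" and B: "\<And>i. i \<in> K \<Longrightarrow> B i \<in> sets borel"
  shows "(\<integral>x. (\<Prod>k\<in>K. indicator (B k) (V k x)) *\<^sub>R iexp (\<Sum>i\<in>I. c i * V i x) \<partial>M1)
     = (\<integral>x. (\<Prod>k\<in>K. indicator (B k) (W k x)) *\<^sub>R iexp (\<Sum>i\<in>I. c i * W i x) \<partial>M2)"
proof -
  have "finite K" using K I finite_subset by blast
  then show ?thesis using K B
  proof (induction K arbitrary: c rule: finite_induct)
    case empty
    then show ?case using eq by simp
  next
    case (insert k K)
    have [measurable]: "B k \<in> sets borel" "V k \<in> borel_measurable M1" "W k \<in> borel_measurable M2"
      using insert.prems mV mW by auto
    have m1[measurable]: "(\<lambda>x. \<Sum>i\<in>I. c i * V i x) \<in> borel_measurable M1" "(\<lambda>x. \<Sum>i\<in>I. c i * W i x) \<in> borel_measurable M2" for c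
      using mV mW by (auto intro!: borel_measurable_sum borel_measurable_times)
    have ind: "(\<lambda>x. indicator (B j) (V j x) :: real) \<in> borel_measurable M1" "(\<lambda>x. indicator (B j) (W j x) :: real) \<in> borel_measurable M2" if "j \<in> K" for j
    proof -
      have [measurable]: "B j \<in> sets borel" "V j \<in> borel_measurable M1" "W j \<in> borel_measurable M2"
        using that insert.prems mV mW by auto
      show "(\<lambda>x. indicator (B j) (V j x) :: real) \<in> borel_measurable M1" "(\<lambda>x. indicator (B j) (W j x) :: real) \<in> borel_measurable M2"
        by measurable
    qed
    have "(\<integral>x. ((\<Prod>k\<in>K. indicator (B k) (V k x)) * indicator (B k) (V k x)) *\<^sub>R iexp (\<Sum>i\<in>I. c i * V i x) \<partial>M1)
       = (\<integral>x. ((\<Prod>k\<in>K. indicator (B k) (W k x)) * indicator (B k) (W k x)) *\<^sub>R iexp (\<Sum>i\<in>I. c i * W i x) \<partial>M2)"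
    proof (rule iexp_weighted_eq_of_char[OF M1 M2])
      fix a b :: real
      \<comment> \<open>The phase extended by \<open>b * Z k\<close> is again a linear combination
        over \<open>I\<close>, so the induction hypothesis covers it with changed
        coefficients.\<close>
      have s: "a * (\<Sum>i\<in>I. c i * Z i) + b * Z k = (\<Sum>i\<in>I. (a * c i + (if i = k then b else 0)) * Z i)" for Z :: "'i \<Rightarrow> real"
      proof -
        have "(\<Sum>i\<in>I. (if i = k then b else 0) * Z i) = b * Z k"
          using I insert.prems(1) by (simp add: if_distrib[where f="\<lambda>x. x * _"] cong: if_cong)
        then show ?thesis by (simp only: distrib_right sum.distrib sum_distrib_left mult.assoc)
      qed
      show "(\<integral>x. (\<Prod>k\<in>K. indicator (B k) (V k x)) *\<^sub>R iexp (a * (\<Sum>i\<in>I. c i * V i x) + b * V k x) \<partial>M1)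
         = (\<integral>x. (\<Prod>k\<in>K. indicator (B k) (W k x)) *\<^sub>R iexp (a * (\<Sum>i\<in>I. c i * W i x) + b * W k x) \<partial>M2)"
        unfolding s[of "\<lambda>i. V i x" for x] s[of "\<lambda>i. W i x" for x]
        by (rule insert.IH) (use insert.prems in auto)
      show "(\<lambda>x. \<Prod>k\<in>K. indicator (B k) (V k x) :: real) \<in> borel_measurable M1"
        "(\<lambda>x. \<Prod>k\<in>K. indicator (B k) (W k x) :: real) \<in> borel_measurable M2"
        using ind by (auto intro!: borel_measurable_prod)
    qed (auto intro!: prod_nonneg prod_le_1 simp: indicator_def)
    then show ?case using insert.hyps by (simp add: mult.commute)
  qed
qed

text \<open>Taking \<open>K = I\<close> with zero phase gives equal mass on rectangles, which form
  an intersection-stable generator.\<close>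

theorem distr_PiM_eq_of_char:
  fixes M1 :: "'a measure" and M2 :: "'b measure" and V :: "'i \<Rightarrow> 'a \<Rightarrow> real" and W :: "'i \<Rightarrow> 'b \<Rightarrow> real"
  assumes M1: "prob_space M1" and M2: "prob_space M2" and I: "finite I"
    and mV[measurable]: "\<And>i. i \<in> I \<Longrightarrow> V i \<in> borel_measurable M1"
    and mW[measurable]: "\<And>i. i \<in> I \<Longrightarrow> W i \<in> borel_measurable M2"
    and eq: "\<And>c. (\<integral>x. iexp (\<Sum>i\<in>I. c i * V i x) \<partial>M1) = (\<integral>x. iexp (\<Sum>i\<in>I. c i * W i x) \<partial>M2)"
  shows "distr M1 (PiM I (\<lambda>_. borel)) (\<lambda>x. \<lambda>i\<in>I. V i x) = distr M2 (PiM I (\<lambda>_. borel)) (\<lambda>x. \<lambda>i\<in>I. W i x)" (is "?P = ?Q")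
proof -
  interpret M1: prob_space M1 by fact
  interpret M2: prob_space M2 by fact
  have mV': "(\<lambda>x. \<lambda>i\<in>I. V i x) \<in> measurable M1 (PiM I (\<lambda>_. borel))"
    by (rule measurable_restrict) (rule mV)
  have mW': "(\<lambda>x. \<lambda>i\<in>I. W i x) \<in> measurable M2 (PiM I (\<lambda>_. borel))"
    by (rule measurable_restrict) (rule mW)
  interpret P: prob_space ?P by (rule M1.prob_space_distr[OF mV'])
  show ?thesis
  proof (rule measure_eqI_PiM_finite[OF I, where A="\<lambda>_. space (PiM I (\<lambda>_. borel :: real measure))"])
    fix A :: "'i \<Rightarrow> real set" assume A: "\<And>i. i \<in> I \<Longrightarrow> A i \<in> sets borel"
    have sA: "Pi\<^sub>E I A \<in> sets (PiM I (\<lambda>_. borel :: real measure))"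
      using A I by (intro sets_PiM_I_finite) auto
    have "complex_of_real (measure M1 ((\<lambda>x. \<lambda>i\<in>I. V i x) -` Pi\<^sub>E I A \<inter> space M1))
       = complex_of_real (measure M2 ((\<lambda>x. \<lambda>i\<in>I. W i x) -` Pi\<^sub>E I A \<inter> space M2))"
    proof -
      have p: "(\<Prod>k\<in>I. indicator (A k) (Z k)) = (indicator (Pi\<^sub>E I A) (\<lambda>i\<in>I. Z i) :: real)" for Z
        using I by (auto simp: indicator_def prod.If_cases PiE_def Pi_def)
      have 1: "(\<integral>x. complex_of_real (indicator ((\<lambda>x. \<lambda>i\<in>I. V i x) -` Pi\<^sub>E I A) x) \<partial>M1)
         = (\<integral>x. complex_of_real (indicator ((\<lambda>x. \<lambda>i\<in>I. W i x) -` Pi\<^sub>E I A) x) \<partial>M2)"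
        using indicator_prod_char_eq[OF M1 M2 I mV mW eq subset_refl, where c="\<lambda>_. 0" and B=A] A unfolding p
        by (simp add: scaleR_conv_of_real indicator_def)
      then show ?thesis
        unfolding integral_of_real by (simp add: integral_indicator Int_commute)
    qed
    then show "emeasure ?P (Pi\<^sub>E I A) = emeasure ?Q (Pi\<^sub>E I A)"
      using sA mV' mW' by (simp add: emeasure_distr M1.emeasure_eq_measure M2.emeasure_eq_measure)
  next
    show "range (\<lambda>_::nat. space (PiM I (\<lambda>_. borel :: real measure))) \<subseteq> prod_algebra I (\<lambda>_. borel)"
      unfolding space_PiM using I by (auto intro!: prod_algebraI_finite)
  qed (auto simp: P.emeasure_eq_measure)
qed

section \<open>Centered normal variables\<close>

text \<open>Serves Cauchy-Schwarz; \<open>A = 0\<close> is allowed since a second moment may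
  vanish.\<close>

lemma quadratic_nonneg_discriminant:
  fixes A B C :: real
  assumes "\<And>t. 0 \<le> A * t\<^sup>2 + 2 * B * t + C"
  shows "B\<^sup>2 \<le> A * C"
proof (cases "A = 0")
  case True
  have "B = 0"
  proof (rule ccontr)
    assume "B \<noteq> 0"
    \<comment> \<open>This \<open>t\<close> makes the linear function equal to -1.\<close>
    then show False using assms[of "- (C + 1) / (2 * B)"] True by (simp add: field_simps)
  qed
  then show ?thesis using True by simp
next
  case False
  have "A > 0"
  proof (rule ccontr)
    assume "\<not> A > 0"
    then have A: "A < 0" using False by simp
    have "filterlim (\<lambda>t::real. A * t\<^sup>2 + 2 * B * t + C) at_bot at_top"
      using A by real_asymp
    then have "eventually (\<lambda>t. A * t\<^sup>2 + 2 * B * t + C \<le> -1) at_top"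
      by (simp add: filterlim_at_bot)
    then obtain t where "A * t\<^sup>2 + 2 * B * t + C \<le> -1"
      by (meson eventually_happens trivial_limit_at_top_linorder)
    then show False using assms[of t] by simp
  qed
  then show ?thesis using assms[of "- B / A"] by (simp add: field_simps power2_eq_square)
qed

text \<open>Reverse triangle inequality in \<open>L2\<close>: it turns the mean-square bound (A3)
  into continuity of the standard deviation.\<close>

lemma (in prob_space) L2_triangle:
  fixes Y Z :: "'a \<Rightarrow> real"
  assumes [measurable]: "Y \<in> borel_measurable M" "Z \<in> borel_measurable M"
    and Y: "integrable M (\<lambda>x. (Y x)\<^sup>2)" and Z: "integrable M (\<lambda>x. (Z x)\<^sup>2)"
  shows "\<bar>sqrt (\<integral>x. (Y x)\<^sup>2 \<partial>M) - sqrt (\<integral>x. (Z x)\<^sup>2 \<partial>M)\<bar> \<le> sqrt (\<integral>x. (Y x - Z x)\<^sup>2 \<partial>M)"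
proof -
  define A B C where "A = (\<integral>x. (Y x)\<^sup>2 \<partial>M)" and "B = (\<integral>x. Y x * Z x \<partial>M)" and "C = (\<integral>x. (Z x)\<^sup>2 \<partial>M)"
  have YZ: "integrable M (\<lambda>x. Y x * Z x)"
  proof (rule Bochner_Integration.integrable_bound)
    show "integrable M (\<lambda>x. (Y x)\<^sup>2 + (Z x)\<^sup>2)" using Y Z by simp
    have "\<bar>y * z\<bar> \<le> y\<^sup>2 + z\<^sup>2" for y z :: real
      using sum_squares_bound[of "\<bar>y\<bar>" "\<bar>z\<bar>"] mult_nonneg_nonneg[of "\<bar>y\<bar>" "\<bar>z\<bar>"]
      unfolding abs_mult power2_abs by linarith
    then show "AE x in M. norm (Y x * Z x) \<le> norm ((Y x)\<^sup>2 + (Z x)\<^sup>2)" by simp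
  qed simp
  have ABC: "A \<ge> 0" "C \<ge> 0" unfolding A_def C_def by simp_all
  have "0 \<le> A * t\<^sup>2 + 2 * B * t + C" for t
  proof -
    have "0 \<le> (\<integral>x. (t * Y x + Z x)\<^sup>2 \<partial>M)" by simp
    also have "\<dots> = (\<integral>x. t\<^sup>2 * (Y x)\<^sup>2 + (2 * t) * (Y x * Z x) + (Z x)\<^sup>2 \<partial>M)"
      by (simp add: power2_sum power_mult_distrib mult_ac add_ac)
    also have "\<dots> = t\<^sup>2 * A + (2 * t) * B + C"
      unfolding A_def B_def C_def using Y Z YZ by simp
    finally show ?thesis by (simp add: mult_ac)
  qed
  then have "B\<^sup>2 \<le> A * C" by (rule quadratic_nonneg_discriminant)
  then have "\<bar>B\<bar> \<le> sqrt A * sqrt C"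
    by (metis real_sqrt_abs real_sqrt_le_iff real_sqrt_mult)
  then have B: "B \<le> sqrt A * sqrt C" by simp
  have "(\<integral>x. (Y x - Z x)\<^sup>2 \<partial>M) = (\<integral>x. (Y x)\<^sup>2 - 2 * (Y x * Z x) + (Z x)\<^sup>2 \<partial>M)"
    by (simp add: power2_diff algebra_simps)
  also have "\<dots> = A - 2 * B + C"
    unfolding A_def B_def C_def using Y Z YZ by simp
  finally have "(sqrt A - sqrt C)\<^sup>2 \<le> (\<integral>x. (Y x - Z x)\<^sup>2 \<partial>M)"
    using B ABC by (simp add: power2_diff)
  then show ?thesis unfolding A_def C_def
    using real_sqrt_le_mono by fastforce
qed

text \<open>The point mass at zero is a separate alternative because it has no density; linear
  combinations of the process may degenerate, and the standard deviation at time 0 may be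
  zero.\<close>

definition centered_normal :: "'a measure \<Rightarrow> ('a \<Rightarrow> real) \<Rightarrow> bool" where
  "centered_normal M Y \<longleftrightarrow> Y \<in> borel_measurable M \<and>
     ((AE \<omega> in M. Y \<omega> = 0) \<or> (\<exists>s>0. distributed M lborel Y (normal_density 0 s)))"

text \<open>Completing the square: the tilt only moves the mean to \<open>l * s^2\<close>, which
  gives exponential moments at once.\<close>

lemma normal_density_times_exp:
  assumes "0 < s"
  shows "normal_density 0 s x * exp (l * x) = exp (l\<^sup>2 * s\<^sup>2 / 2) * normal_density (l * s\<^sup>2) s x"
proof -
  have "- (x - 0)\<^sup>2 / (2 * s\<^sup>2) + l * x = l\<^sup>2 * s\<^sup>2 / 2 + - (x - l * s\<^sup>2)\<^sup>2 / (2 * s\<^sup>2)"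
    using assms by (simp add: field_simps power2_eq_square)
  then have "exp (- (x - 0)\<^sup>2 / (2 * s\<^sup>2)) * exp (l * x) = exp (l\<^sup>2 * s\<^sup>2 / 2) * exp (- (x - l * s\<^sup>2)\<^sup>2 / (2 * s\<^sup>2))"
    by (simp add: exp_add[symmetric])
  then show ?thesis unfolding normal_density_def by (simp add: field_simps)
qed

context prob_space
begin

lemma centered_normal_integrable_exp:
  assumes "centered_normal M Y"
  shows "integrable M (\<lambda>x. exp (l * Y x))"
proof -
  have [measurable]: "Y \<in> borel_measurable M" using assms by (simp add: centered_normal_def)
  consider "AE x in M. Y x = 0" | s where "s > 0" "distributed M lborel Y (normal_density 0 s)"
    using assms by (auto simp: centered_normal_def)
  then show ?thesis
  proof cases
    case 1
    then have "AE x in M. exp (l * Y x) = 1" by auto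
    then have "integrable M (\<lambda>x. exp (l * Y x)) = integrable M (\<lambda>x. 1::real)"
      by (intro integrable_cong_AE) auto
    then show ?thesis by simp
  next
    case 2
    have "integrable lborel (\<lambda>x. normal_density 0 s x * exp (l * x))"
      using 2 by (simp add: normal_density_times_exp)
    then show ?thesis using distributed_integrable[OF 2(2), of "\<lambda>x. exp (l * x)"] by simp
  qed
qed

lemma centered_normal_moments:
  assumes "centered_normal M Y"
  shows "integrable M Y" "integrable M (\<lambda>x. (Y x)\<^sup>2)" "expectation Y = 0"
    "(\<integral>x. iexp (Y x) \<partial>M) = exp (- (\<integral>x. (Y x)\<^sup>2 \<partial>M) / 2)"
proof -
  have [measurable]: "Y \<in> borel_measurable M" using assms by (simp add: centered_normal_def)
  consider "AE x in M. Y x = 0" | s where "s > 0" "distributed M lborel Y (normal_density 0 s)"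
    using assms by (auto simp: centered_normal_def)
  note cases = this
  show i1: "integrable M Y"
    using cases
  proof cases
    case 1
    then have "integrable M Y = integrable M (\<lambda>x. 0::real)" by (intro integrable_cong_AE) auto
    then show ?thesis by simp
  next
    case 2
    then show ?thesis using distributed_integrable[OF 2(2), of "\<lambda>x. x"] integrable_normal_moment_nz_1[of s 0] by simp
  qed
  show i2: "integrable M (\<lambda>x. (Y x)\<^sup>2)"
    using cases
  proof cases
    case 1
    then have "integrable M (\<lambda>x. (Y x)\<^sup>2) = integrable M (\<lambda>x. 0::real)" by (intro integrable_cong_AE) auto
    then show ?thesis by simp
  next
    case 2
    then show ?thesis using distributed_integrable[OF 2(2), of "\<lambda>x. x\<^sup>2"] integrable_normal_moment[of s 0 2] by simp
  qed
  show e: "expectation Y = 0"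
    using cases
  proof cases
    case 1
    then show ?thesis by (intro integral_eq_zero_AE) auto
  next
    case 2
    then show ?thesis using normal_distributed_expectation by blast
  qed
  show "(\<integral>x. iexp (Y x) \<partial>M) = exp (- (\<integral>x. (Y x)\<^sup>2 \<partial>M) / 2)"
    using cases
  proof cases
    case 1
    then have "(\<integral>x. iexp (Y x) \<partial>M) = (\<integral>x. 1 \<partial>M)" by (intro integral_cong_AE) auto
    moreover have "(\<integral>x. (Y x)\<^sup>2 \<partial>M) = 0" using 1 by (intro integral_eq_zero_AE) auto
    ultimately show ?thesis by (simp add: prob_space)
  next
    case 2
    have v: "(\<integral>x. (Y x)\<^sup>2 \<partial>M) = s\<^sup>2"
      using normal_distributed_variance[OF 2] e by simp
    have D: "distributed M lborel (\<lambda>x. Y x / s) std_normal_density"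
      using normal_standard_normal_convert[of s Y 0] 2 by simp
    have "(\<integral>x. iexp (Y x) \<partial>M) = (\<integral>x. iexp (s * (Y x / s)) \<partial>M)" using 2 by simp
    also have "\<dots> = (\<integral>y. iexp (s * y) \<partial>distr M lborel (\<lambda>x. Y x / s))"
      by (subst integral_distr) auto
    also have "\<dots> = char std_normal_distribution s"
      using distributed_distr_eq_density[OF D] by (simp add: char_def)
    finally show ?thesis using v by (simp add: char_std_normal_distribution)
  qed
qed

text \<open>The density on \<open>(u, u + 1]\<close> is at least its value at the right end. The
  shift from \<open>u\<close> to \<open>u + 1\<close> is invisible at the scale \<open>u^2\<close>,
  so no sharper tail estimate is called for.\<close>

lemma centered_normal_tail_ge:
  assumes "centered_normal M Y" and s: "s = sqrt (\<integral>x. (Y x)\<^sup>2 \<partial>M)" "s > 0" and u: "u \<ge> 0"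
  shows "normal_density 0 s (u + 1) \<le> prob {x \<in> space M. Y x > u}"
proof -
  have [measurable]: "Y \<in> borel_measurable M" using assms by (simp add: centered_normal_def)
  have "\<not> (AE x in M. Y x = 0)"
  proof
    assume "AE x in M. Y x = 0"
    then have "(\<integral>x. (Y x)\<^sup>2 \<partial>M) = 0" by (intro integral_eq_zero_AE) auto
    then show False using s by simp
  qed
  then obtain s' where s': "s' > 0" "distributed M lborel Y (normal_density 0 s')"
    using assms(1) by (auto simp: centered_normal_def)
  have "(\<integral>x. (Y x)\<^sup>2 \<partial>M) = s'\<^sup>2"
    using normal_distributed_variance[OF s'] centered_normal_moments(3)[OF assms(1)] by simp
  then have [simp]: "s' = s" using s s' by simp
  have "ennreal (normal_density 0 s (u + 1)) = (\<integral>\<^sup>+x. ennreal (normal_density 0 s (u + 1)) * indicator {u<..u+1} x \<partial>lborel)"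
    by (simp add: nn_integral_cmult_indicator)
  also have "\<dots> \<le> (\<integral>\<^sup>+x. ennreal (normal_density 0 s x) * indicator {u<..} x \<partial>lborel)"
  proof (rule nn_integral_mono)
    fix x :: real
    show "ennreal (normal_density 0 s (u + 1)) * indicator {u<..u+1} x \<le> ennreal (normal_density 0 s x) * indicator {u<..} x"
    proof (cases "x \<in> {u<..u+1}")
      case True
      then have "x\<^sup>2 \<le> (u+1)\<^sup>2" using u by (intro power_mono) auto
      then have "normal_density 0 s (u + 1) \<le> normal_density 0 s x"
        unfolding normal_density_def using s by (simp add: divide_right_mono)
      then show ?thesis using True by (simp add: ennreal_leI)
    qed simp
  qed
  also have "\<dots> = emeasure M (Y -` {u<..} \<inter> space M)"
    using distributed_emeasure[OF s'(2), of "{u<..}"] by simp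
  also have "Y -` {u<..} \<inter> space M = {x \<in> space M. Y x > u}" by auto
  finally show ?thesis by (simp add: emeasure_eq_measure)
qed

end

lemma centered_gaussian_process_sum:
  assumes "centered_gaussian_process M X" "finite I" "I \<subseteq> {0..}"
  shows "centered_normal M (\<lambda>\<omega>. \<Sum>t\<in>I. c t * X t \<omega>)"
  using assms unfolding centered_gaussian_process_def centered_normal_def Let_def
  by (auto intro!: borel_measurable_sum borel_measurable_times simp: subset_eq)

lemma centered_gaussian_process_single:
  assumes "centered_gaussian_process M X" "0 \<le> t"
  shows "centered_normal M (X t)"
  using centered_gaussian_process_sum[OF assms(1), of "{t}" "\<lambda>_. 1"] assms by simp

lemma sdev_eq:
  assumes "centered_gaussian_process M X" "0 \<le> t"
  shows "sdev M X t = sqrt (\<integral>\<omega>. (X t \<omega>)\<^sup>2 \<partial>M)"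
proof -
  interpret prob_space M using assms by (simp add: centered_gaussian_process_def)
  show ?thesis unfolding sdev_def
    using centered_normal_moments(3)[OF centered_gaussian_process_single[OF assms]] by simp
qed

lemma sdev_diff_le:
  assumes gp: "centered_gaussian_process M X" and "0 \<le> s" "0 \<le> t"
  shows "\<bar>sdev M X t - sdev M X s\<bar> \<le> sqrt (\<integral>\<omega>. (X t \<omega> - X s \<omega>)\<^sup>2 \<partial>M)"
proof -
  interpret prob_space M using assms by (simp add: centered_gaussian_process_def)
  note n = centered_gaussian_process_single[OF gp]
  show ?thesis unfolding sdev_eq[OF gp \<open>0 \<le> s\<close>] sdev_eq[OF gp \<open>0 \<le> t\<close>]
    by (rule L2_triangle) (use n[OF \<open>0 \<le> s\<close>] n[OF \<open>0 \<le> t\<close>] centered_normal_moments(2) in \<open>auto simp: centered_normal_def\<close>)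
qed

section \<open>The softmax function\<close>

text \<open>Averaged with a probability weight under which \<open>z\<close> has mean zero, the
  linear term drops and a bound by \<open>exp (max z^2)\<close> is left.\<close>

lemma exp_le_add_exp_square: "exp z \<le> z + exp (z\<^sup>2)" for z :: real
proof -
  have sq: "1 + z\<^sup>2 \<le> exp (z\<^sup>2)" by simp
  consider "z > 1" | "0 \<le> z" "z \<le> 1" | "-1 \<le> z" "z < 0" | "z < -1" by linarith
  then show ?thesis
  proof cases
    case 1
    then have "z \<le> z\<^sup>2" by (simp add: power2_eq_square)
    then have "exp z \<le> exp (z\<^sup>2)" by simp
    then show ?thesis using 1 by linarith
  next
    case 2
    then show ?thesis using exp_bound[of z] sq by linarith
  next
    case 3
    \<comment> \<open>This yields \<open>exp z <= 1 + z + z^2\<close>: the product of the Taylor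
      polynomial of \<open>exp (- z)\<close> and \<open>1 + z + z^2\<close> exceeds 1 by terms that
      are nonnegative for negative \<open>z\<close>.\<close>
    have "1 \<le> exp (- z) * (1 + z + z\<^sup>2)"
    proof -
      have "1 - z + z\<^sup>2 / 2 \<le> exp (- z)" using exp_lower_Taylor_quadratic[of "-z"] 3 by simp
      moreover have p: "0 \<le> 1 + z + z\<^sup>2" using 3 by simp
      ultimately have "(1 - z + z\<^sup>2 / 2) * (1 + z + z\<^sup>2) \<le> exp (- z) * (1 + z + z\<^sup>2)"
        by (rule mult_right_mono)
      moreover have "(1 - z + z\<^sup>2 / 2) * (1 + z + z\<^sup>2) = 1 + z\<^sup>2 / 2 + z\<^sup>2 * (- z) / 2 + (z\<^sup>2)\<^sup>2 / 2"
        by (simp add: field_simps power2_eq_square)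
      moreover have "0 \<le> z\<^sup>2 * (- z)" using 3 by (intro mult_nonneg_nonneg) auto
      moreover have "0 \<le> z\<^sup>2" "0 \<le> (z\<^sup>2)\<^sup>2" by simp_all
      ultimately show ?thesis by linarith
    qed
    then have "exp z \<le> 1 + z + z\<^sup>2" by (simp add: exp_minus field_simps)
    then show ?thesis using sq by linarith
  next
    case 4
    then have "exp z \<le> 1" by simp
    moreover have "- z \<le> z\<^sup>2" using 4 mult_left_mono[of 1 "-z" "-z"] by (simp add: power2_eq_square)
    ultimately show ?thesis using sq by linarith
  qed
qed

text \<open>Log-sum-exp at inverse temperature \<open>b\<close>; it differs from the maximum by at
  most \<open>ln (card I) / b\<close>.\<close>

definition softmax :: "'i set \<Rightarrow> real \<Rightarrow> ('i \<Rightarrow> real) \<Rightarrow> real" where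
  "softmax I b x = ln (\<Sum>i\<in>I. exp (b * x i)) / b"

text \<open>The gradient of \<open>softmax\<close>: the Gibbs probability vector at inverse
  temperature \<open>b\<close>.\<close>

definition softmax_weight :: "'i set \<Rightarrow> real \<Rightarrow> ('i \<Rightarrow> real) \<Rightarrow> 'i \<Rightarrow> real" where
  "softmax_weight I b x i = exp (b * x i) / (\<Sum>j\<in>I. exp (b * x j))"

context
  fixes I :: "'i set" and b :: real
  assumes I: "finite I" "I \<noteq> {}" and b: "b > 0"
begin

lemma softmax_sum_pos: "0 < (\<Sum>j\<in>I. exp (b * x j))"
  using I by (intro sum_pos) auto

lemma softmax_weight_nonneg: "0 \<le> softmax_weight I b x i"
  unfolding softmax_weight_def by (intro divide_nonneg_pos softmax_sum_pos) auto

lemma softmax_weight_sum: "(\<Sum>i\<in>I. softmax_weight I b x i) = 1"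
  unfolding softmax_weight_def using softmax_sum_pos[of x] by (simp add: sum_divide_distrib[symmetric])

lemma softmax_weight_le_1: "i \<in> I \<Longrightarrow> softmax_weight I b x i \<le> 1"
  using softmax_weight_sum[of x] member_le_sum[of i I "softmax_weight I b x"] softmax_weight_nonneg I by force

text \<open>Increments become a normalised log-moment generating function of \<open>y\<close> under
  the Gibbs weights: Jensen bounds it from below, a sub-Gaussian estimate from above.\<close>

lemma softmax_add:
  "softmax I b (\<lambda>i. x i + y i) - softmax I b x = ln (\<Sum>i\<in>I. softmax_weight I b x i * exp (b * y i)) / b"
proof -
  have "(\<Sum>i\<in>I. softmax_weight I b x i * exp (b * y i)) = (\<Sum>i\<in>I. exp (b * (x i + y i))) / (\<Sum>j\<in>I. exp (b * x j))"
    unfolding softmax_weight_def by (simp add: sum_divide_distrib exp_add distrib_left)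
  then show ?thesis unfolding softmax_def
    using softmax_sum_pos[of x] softmax_sum_pos[of "\<lambda>i. x i + y i"] by (simp add: ln_div diff_divide_distrib)
qed

lemma softmax_add_ge:
  "(\<Sum>i\<in>I. softmax_weight I b x i * y i) \<le> softmax I b (\<lambda>i. x i + y i) - softmax I b x"
proof -
  let ?w = "softmax_weight I b x"
  define m where "m = (\<Sum>i\<in>I. ?w i * y i)"
  \<comment> \<open>Jensen by hand: the weighted average of the tangent to the exponential at
    \<open>b * m\<close> is exactly \<open>exp (b * m)\<close>.\<close>
  have "exp (b * m) = (\<Sum>i\<in>I. ?w i * (exp (b * m) * (1 + (b * y i - b * m))))"
  proof -
    have "(\<Sum>i\<in>I. ?w i * (exp (b * m) * (1 + (b * y i - b * m)))) =
       exp (b * m) * ((\<Sum>i\<in>I. ?w i) * (1 - b * m) + b * (\<Sum>i\<in>I. ?w i * y i))"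
      by (simp add: sum_distrib_left sum_distrib_right sum.distrib[symmetric] algebra_simps)
    then show ?thesis by (simp add: softmax_weight_sum m_def[symmetric])
  qed
  also have "\<dots> \<le> (\<Sum>i\<in>I. ?w i * exp (b * y i))"
  proof (intro sum_mono mult_left_mono softmax_weight_nonneg)
    fix i
    have "exp (b * m) * (1 + (b * y i - b * m)) \<le> exp (b * m) * exp (b * y i - b * m)"
      by (intro mult_left_mono exp_ge_add_one_self) auto
    also have "\<dots> = exp (b * y i)" by (simp add: exp_add[symmetric])
    finally show "exp (b * m) * (1 + (b * y i - b * m)) \<le> exp (b * y i)" .
  qed
  finally have le: "exp (b * m) \<le> (\<Sum>i\<in>I. ?w i * exp (b * y i))" .
  then have "b * m \<le> ln (\<Sum>i\<in>I. ?w i * exp (b * y i))"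
    by (simp add: ln_ge_iff order_less_le_trans[OF exp_gt_zero])
  then show ?thesis unfolding softmax_add m_def[symmetric] using b by (simp add: field_simps)
qed

lemma weighted_abs_le: "\<bar>\<Sum>i\<in>I. softmax_weight I b x i * y i\<bar> \<le> (\<Sum>i\<in>I. \<bar>y i\<bar>)"
proof -
  have "\<bar>\<Sum>i\<in>I. softmax_weight I b x i * y i\<bar> \<le> (\<Sum>i\<in>I. \<bar>softmax_weight I b x i * y i\<bar>)" by (rule sum_abs)
  also have "\<dots> \<le> (\<Sum>i\<in>I. 1 * \<bar>y i\<bar>)"
    unfolding abs_mult by (intro sum_mono mult_right_mono) (use softmax_weight_nonneg softmax_weight_le_1 in auto)
  finally show ?thesis by simp
qed

lemma softmax_lipschitz:
  "\<bar>softmax I b (\<lambda>i. x i + y i) - softmax I b x\<bar> \<le> (\<Sum>i\<in>I. \<bar>y i\<bar>)"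
proof -
  have 1: "- (\<Sum>i\<in>I. \<bar>y i\<bar>) \<le> softmax I b (\<lambda>i. x i + y i) - softmax I b x" for x y
    using softmax_add_ge[of x y] weighted_abs_le[of x y] by linarith
  \<comment> \<open>The upper bound is the lower bound for the step \<open>- y\<close> back from
    \<open>x + y\<close>.\<close>
  show ?thesis using 1[of y x] 1[of "\<lambda>i. - y i" "\<lambda>i. x i + y i"] by auto
qed

text \<open>The deviations \<open>z\<close> from the weighted mean average to zero, so
  \<open>exp_le_add_exp_square\<close> leaves only the exponential of their largest square; the 4
  comes from \<open>|y i - m| <= 2 * ?S\<close>. The constant may grow with \<open>b\<close>, which
  stays fixed while the number of copies tends to infinity.\<close>

lemma softmax_add_le:
  "softmax I b (\<lambda>i. x i + y i) - softmax I b x \<le> (\<Sum>i\<in>I. softmax_weight I b x i * y i) + 4 * b * (\<Sum>i\<in>I. \<bar>y i\<bar>)\<^sup>2"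
proof -
  let ?w = "softmax_weight I b x" and ?S = "\<Sum>i\<in>I. \<bar>y i\<bar>"
  define m where "m = (\<Sum>i\<in>I. ?w i * y i)"
  define z where "z i = b * (y i - m)" for i
  have zS: "(z i)\<^sup>2 \<le> 4 * b\<^sup>2 * ?S\<^sup>2" if "i \<in> I" for i
  proof -
    have "\<bar>y i\<bar> \<le> ?S" using that I by (intro member_le_sum) auto
    then have "\<bar>y i - m\<bar> \<le> 2 * ?S" using weighted_abs_le[of x y] unfolding m_def by linarith
    then have "\<bar>y i - m\<bar>\<^sup>2 \<le> (2 * ?S)\<^sup>2" by (intro power_mono) auto
    then show ?thesis unfolding z_def using b by (simp add: power_mult_distrib)
  qed
  have "(\<Sum>i\<in>I. ?w i * exp (z i)) \<le> (\<Sum>i\<in>I. ?w i * (z i + exp (4 * b\<^sup>2 * ?S\<^sup>2)))"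
  proof (intro sum_mono mult_left_mono softmax_weight_nonneg)
    fix i assume "i \<in> I"
    then have "exp ((z i)\<^sup>2) \<le> exp (4 * b\<^sup>2 * ?S\<^sup>2)" using zS by simp
    then show "exp (z i) \<le> z i + exp (4 * b\<^sup>2 * ?S\<^sup>2)" using exp_le_add_exp_square[of "z i"] by linarith
  qed
  also have "\<dots> = b * ((\<Sum>i\<in>I. ?w i * y i) - (\<Sum>i\<in>I. ?w i) * m) + (\<Sum>i\<in>I. ?w i) * exp (4 * b\<^sup>2 * ?S\<^sup>2)"
    unfolding z_def
    by (simp add: sum_distrib_left sum_distrib_right sum.distrib[symmetric] sum_subtractf[symmetric] algebra_simps)
  also have "\<dots> = exp (4 * b\<^sup>2 * ?S\<^sup>2)" by (simp add: softmax_weight_sum m_def)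
  finally have le: "(\<Sum>i\<in>I. ?w i * exp (z i)) \<le> exp (4 * b\<^sup>2 * ?S\<^sup>2)" .
  have pos: "0 < (\<Sum>i\<in>I. ?w i * exp (b * y i))"
    unfolding softmax_weight_def using I softmax_sum_pos by (intro sum_pos mult_pos_pos divide_pos_pos) auto
  have "(\<Sum>i\<in>I. ?w i * exp (b * y i)) = exp (b * m) * (\<Sum>i\<in>I. ?w i * exp (z i))"
    unfolding z_def by (simp add: sum_distrib_left algebra_simps exp_add[symmetric] exp_diff)
  also have "\<dots> \<le> exp (b * m) * exp (4 * b\<^sup>2 * ?S\<^sup>2)" using le by simp
  also have "\<dots> = exp (b * m + 4 * b\<^sup>2 * ?S\<^sup>2)" by (simp add: exp_add)
  finally have "ln (\<Sum>i\<in>I. ?w i * exp (b * y i)) \<le> b * m + 4 * b\<^sup>2 * ?S\<^sup>2"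
    using pos by (metis ln_exp ln_le_cancel_iff exp_gt_zero)
  then have "ln (\<Sum>i\<in>I. ?w i * exp (b * y i)) / b \<le> (b * m + 4 * b\<^sup>2 * ?S\<^sup>2) / b"
    using b by (intro divide_right_mono) auto
  also have "\<dots> = m + 4 * b * ?S\<^sup>2" using b by (simp add: field_simps power2_eq_square)
  finally show ?thesis unfolding softmax_add m_def[symmetric] .
qed

lemma softmax_ge: "i \<in> I \<Longrightarrow> x i \<le> softmax I b x"
proof -
  assume "i \<in> I"
  then have "exp (b * x i) \<le> (\<Sum>i\<in>I. exp (b * x i))" using I by (intro member_le_sum) auto
  then have "b * x i \<le> ln (\<Sum>i\<in>I. exp (b * x i))" by (metis ln_exp ln_le_cancel_iff exp_gt_zero softmax_sum_pos)
  then show ?thesis unfolding softmax_def using b by (simp add: field_simps)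
qed

lemma softmax_le: "(\<And>i. i \<in> I \<Longrightarrow> x i \<le> c) \<Longrightarrow> softmax I b x \<le> c + ln (card I) / b"
proof -
  assume c: "\<And>i. i \<in> I \<Longrightarrow> x i \<le> c"
  have "(\<Sum>i\<in>I. exp (b * x i)) \<le> (\<Sum>i\<in>I. exp (b * c))" using c b by (intro sum_mono) auto
  also have "\<dots> = exp (b * c + ln (card I))" using I by (simp add: exp_add card_gt_0_iff)
  finally have "ln (\<Sum>i\<in>I. exp (b * x i)) \<le> b * c + ln (card I)" by (metis ln_exp ln_le_cancel_iff exp_gt_zero softmax_sum_pos)
  then show ?thesis unfolding softmax_def using b by (simp add: field_simps)
qed

end

section \<open>Gaussian concentration\<close>

text \<open>The coefficient 1/2 of the square must be exact, as it becomes the constant in the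
  Gaussian exponent; the cubic remainder may be crude.\<close>

lemma exp_le_quadratic_remainder: "exp z \<le> 1 + z + z\<^sup>2 / 2 + \<bar>z\<bar> ^ 3 * exp \<bar>z\<bar>" for z :: real
proof -
  obtain t where t: "\<bar>t\<bar> \<le> \<bar>z\<bar>" "exp z = (\<Sum>m<3. z ^ m / fact m) + exp t / fact 3 * z ^ 3"
    using Maclaurin_exp_le by blast
  have "exp t / fact 3 * z ^ 3 \<le> \<bar>exp t / fact 3 * z ^ 3\<bar>" by (rule abs_ge_self)
  also have "\<dots> = (exp t / fact 3) * \<bar>z\<bar> ^ 3" by (simp add: abs_mult power_abs)
  also have "\<dots> \<le> exp \<bar>z\<bar> * \<bar>z\<bar> ^ 3"
  proof (rule mult_right_mono)
    have "exp t / fact 3 \<le> exp t" by (simp add: fact_numeral)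
    also have "\<dots> \<le> exp \<bar>z\<bar>" using t by simp
    finally show "exp t / fact 3 \<le> exp \<bar>z\<bar>" .
  qed simp
  finally show ?thesis using t(2) by (simp add: numeral_3_eq_3 eval_nat_numeral mult.commute)
qed

text \<open>A single term of the exponential series; it absorbs powers of \<open>S\<close> into
  exponentials.\<close>

lemma power_le_fact_exp: "0 \<le> x \<Longrightarrow> x ^ n \<le> fact n * exp x" for x :: real
proof -
  assume x: "0 \<le> x"
  have s: "(\<lambda>k. x ^ k /\<^sub>R fact k) sums exp x" by (rule exp_converges)
  have "sum (\<lambda>k. x ^ k /\<^sub>R fact k) {n} \<le> exp x"
    unfolding sums_unique[OF s] by (rule sum_le_suminf) (use s x in \<open>auto simp: sums_iff\<close>)
  then show ?thesis by (simp add: field_simps)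
qed

section \<open>The moment generating function of one small increment\<close>

locale gaussian_vector = prob_space M for M :: "'a measure" +
  fixes I :: "'i set" and X :: "'i \<Rightarrow> 'a \<Rightarrow> real" and s :: real
  assumes finI: "finite I" and neI: "I \<noteq> {}"
    and comb: "\<And>c. centered_normal M (\<lambda>\<omega>. \<Sum>i\<in>I. c i * X i \<omega>)"
    and s0: "0 \<le> s" and var: "\<And>i. i \<in> I \<Longrightarrow> (\<integral>\<omega>. (X i \<omega>)\<^sup>2 \<partial>M) \<le> s\<^sup>2"
begin

lemma comp_normal: "i \<in> I \<Longrightarrow> centered_normal M (X i)"
proof -
  assume i: "i \<in> I"
  have "(\<Sum>j\<in>I. (if j = i then 1 else 0) * X j \<omega>) = X i \<omega>" for \<omega>
    using i finI by (simp add: if_distrib[where f="\<lambda>x. x * _"] cong: if_cong)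
  then show ?thesis using comb[of "\<lambda>j. if j = i then 1 else 0"] by simp
qed

lemma X_meas[measurable]: "i \<in> I \<Longrightarrow> X i \<in> borel_measurable M"
  using comp_normal by (simp add: centered_normal_def)

text \<open>The common majorant through which integrability is proved below.\<close>

definition S :: "'a \<Rightarrow> real" where "S \<omega> = (\<Sum>i\<in>I. \<bar>X i \<omega>\<bar>)"

lemma S_meas[measurable]: "S \<in> borel_measurable M"
  unfolding S_def by measurable

lemma S_nonneg[simp]: "0 \<le> S \<omega>"
  unfolding S_def by (simp add: sum_nonneg)

text \<open>The coordinates may be dependent, so the sum is bounded by \<open>card I\<close> times
  its largest term, whose exponential is dominated by a sum of one-dimensional exponential
  moments.\<close>

lemma integrable_exp_S: "integrable M (\<lambda>\<omega>. exp (l * S \<omega>))"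
proof -
  define n where "n = real (card I)"
  define l' where "l' = \<bar>l\<bar> * n"
  have n0: "n \<ge> 0" unfolding n_def by simp
  show ?thesis
  proof (rule Bochner_Integration.integrable_bound)
    show "integrable M (\<lambda>\<omega>. \<Sum>i\<in>I. exp (l' * X i \<omega>) + exp (- l' * X i \<omega>))"
      by (intro Bochner_Integration.integrable_sum Bochner_Integration.integrable_add centered_normal_integrable_exp comp_normal)
    show "AE \<omega> in M. norm (exp (l * S \<omega>)) \<le> norm (\<Sum>i\<in>I. exp (l' * X i \<omega>) + exp (- l' * X i \<omega>))"
    proof (rule AE_I2)
      fix \<omega>
      obtain j where j: "j \<in> I" "\<And>i. i \<in> I \<Longrightarrow> \<bar>X i \<omega>\<bar> \<le> \<bar>X j \<omega>\<bar>"
      proof -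
        have "Max ((\<lambda>i. \<bar>X i \<omega>\<bar>) ` I) \<in> (\<lambda>i. \<bar>X i \<omega>\<bar>) ` I" using finI neI by (intro Max_in) auto
        then obtain j where "j \<in> I" "\<bar>X j \<omega>\<bar> = Max ((\<lambda>i. \<bar>X i \<omega>\<bar>) ` I)" by auto
        then show ?thesis using that[of j] finI by auto
      qed
      have "S \<omega> \<le> n * \<bar>X j \<omega>\<bar>"
        unfolding S_def n_def using j sum_bounded_above[of I "\<lambda>i. \<bar>X i \<omega>\<bar>" "\<bar>X j \<omega>\<bar>"] by simp
      then have "\<bar>l\<bar> * S \<omega> \<le> l' * \<bar>X j \<omega>\<bar>" unfolding l'_def by (simp add: mult_left_mono mult.assoc)
      moreover have "l * S \<omega> \<le> \<bar>l\<bar> * S \<omega>" by (simp add: mult_right_mono)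
      ultimately have "exp (l * S \<omega>) \<le> exp (l' * \<bar>X j \<omega>\<bar>)" by simp
      also have "\<dots> \<le> exp (l' * X j \<omega>) + exp (- l' * X j \<omega>)" by (simp add: abs_if)
      also have "\<dots> \<le> (\<Sum>i\<in>I. exp (l' * X i \<omega>) + exp (- l' * X i \<omega>))"
        using j(1) finI by (intro member_le_sum) (auto intro: add_nonneg_nonneg)
      finally show "norm (exp (l * S \<omega>)) \<le> norm (\<Sum>i\<in>I. exp (l' * X i \<omega>) + exp (- l' * X i \<omega>))"
        by simp
    qed
  qed simp
qed

lemma integrable_of_exp_bound:
  fixes f :: "'a \<Rightarrow> real"
  assumes "f \<in> borel_measurable M" "\<And>\<omega>. \<bar>f \<omega>\<bar> \<le> C * exp (l * S \<omega>)"
  shows "integrable M f"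
proof (rule Bochner_Integration.integrable_bound)
  show "integrable M (\<lambda>\<omega>. C * exp (l * S \<omega>))" using integrable_exp_S by simp
  have "\<bar>f \<omega>\<bar> \<le> \<bar>C * exp (l * S \<omega>)\<bar>" for \<omega> using assms(2)[of \<omega>] by linarith
  then show "AE \<omega> in M. norm (f \<omega>) \<le> norm (C * exp (l * S \<omega>))" by auto
qed fact

lemma S_le_exp: "S \<omega> \<le> exp (S \<omega>)" "(S \<omega>)\<^sup>2 \<le> 2 * exp (S \<omega>)"
  using power_le_fact_exp[of "S \<omega>" 1] power_le_fact_exp[of "S \<omega>" 2] by (auto simp: fact_numeral)

lemma integrable_S: "integrable M S" "integrable M (\<lambda>\<omega>. (S \<omega>)\<^sup>2)"
proof -
  show "integrable M S" by (rule integrable_of_exp_bound[where C=1 and l=1]) (use S_le_exp in auto)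
  show "integrable M (\<lambda>\<omega>. (S \<omega>)\<^sup>2)" by (rule integrable_of_exp_bound[where C=2 and l=1]) (use S_le_exp in auto)
qed

text \<open>Jensen for the square. Here the largest variance, and not the sum of the variances,
  becomes the relevant constant.\<close>

lemma variance_convex_comb:
  assumes w: "\<And>i. i \<in> I \<Longrightarrow> 0 \<le> w i" "(\<Sum>i\<in>I. w i) = 1"
  shows "(\<integral>\<omega>. (\<Sum>i\<in>I. w i * X i \<omega>)\<^sup>2 \<partial>M) \<le> s\<^sup>2"
proof -
  have i2: "integrable M (\<lambda>\<omega>. (X i \<omega>)\<^sup>2)" if "i \<in> I" for i
    using centered_normal_moments(2)[OF comp_normal[OF that]] .
  have le: "(\<Sum>i\<in>I. w i * x i)\<^sup>2 \<le> (\<Sum>i\<in>I. w i * (x i)\<^sup>2)" for x :: "'i \<Rightarrow> real"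
  proof -
    define m where "m = (\<Sum>i\<in>I. w i * x i)"
    have "0 \<le> (\<Sum>i\<in>I. w i * (x i - m)\<^sup>2)" using w by (intro sum_nonneg mult_nonneg_nonneg) auto
    also have "\<dots> = (\<Sum>i\<in>I. w i * (x i)\<^sup>2) - 2 * m * (\<Sum>i\<in>I. w i * x i) + (\<Sum>i\<in>I. w i) * m\<^sup>2"
      by (simp add: sum_distrib_left sum_distrib_right sum.distrib[symmetric] sum_subtractf[symmetric] algebra_simps power2_eq_square)
    finally show ?thesis using w by (simp add: m_def[symmetric] power2_eq_square)
  qed
  have "(\<integral>\<omega>. (\<Sum>i\<in>I. w i * X i \<omega>)\<^sup>2 \<partial>M) \<le> (\<integral>\<omega>. (\<Sum>i\<in>I. w i * (X i \<omega>)\<^sup>2) \<partial>M)"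
    by (intro integral_mono le Bochner_Integration.integrable_sum integrable_mult_right i2 centered_normal_moments(2)[OF comb])
  also have "\<dots> = (\<Sum>i\<in>I. w i * (\<integral>\<omega>. (X i \<omega>)\<^sup>2 \<partial>M))"
    using i2 by (simp add: Bochner_Integration.integral_sum)
  also have "\<dots> \<le> (\<Sum>i\<in>I. w i * s\<^sup>2)" using w var by (intro sum_mono mult_left_mono) auto
  finally show ?thesis using w by (simp add: sum_distrib_right[symmetric])
qed

text \<open>\<open>D\<close> is the increment caused by one of \<open>n\<close> copies, with
  \<open>r = 1 / sqrt n\<close> and a convex combination of coordinates as linear part. The mean of
  \<open>D\<close> stays as a factor so that the steps telescope, and \<open>K\<close> is chosen
  before \<open>r\<close>, \<open>D\<close> and \<open>w\<close> because the bound is multiplied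
  \<open>n\<close> times.\<close>

lemma one_step_mgf:
  assumes C: "0 \<le> C"
  shows "\<exists>K. \<forall>r D w. 0 \<le> r \<and> r \<le> 1 \<and> D \<in> borel_measurable M \<and> (\<forall>\<omega>. \<bar>D \<omega>\<bar> \<le> r * S \<omega>) \<and>
     (\<forall>i\<in>I. 0 \<le> w i) \<and> (\<Sum>i\<in>I. w i) = 1 \<and> (\<forall>\<omega>. \<bar>D \<omega> - r * (\<Sum>i\<in>I. w i * X i \<omega>)\<bar> \<le> C * r\<^sup>2 * (S \<omega>)\<^sup>2) \<longrightarrow>
     expectation (\<lambda>\<omega>. exp (l * D \<omega>)) \<le> exp (l * expectation D) * exp (l\<^sup>2 * s\<^sup>2 / 2 * r\<^sup>2 + K * r ^ 3)"
proof -
  define m1 m2 where "m1 = expectation S" and "m2 = expectation (\<lambda>\<omega>. (S \<omega>)\<^sup>2)"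
  have m: "0 \<le> m1" "0 \<le> m2" unfolding m1_def m2_def by simp_all
  \<comment> \<open>\<open>W1\<close> will dominate the error in replacing \<open>D^2\<close> by
    \<open>(r * Z)^2\<close>, and \<open>W2\<close> the cubic Taylor remainder up to a power of
    \<open>l\<close>, both after division by \<open>r^3\<close>; neither mentions \<open>r\<close>,
    \<open>D\<close> or \<open>w\<close>.\<close>
  define W1 where "W1 \<omega> = C * ((2 + m2) * (2 + m1)) * exp (2 * S \<omega>)" for \<omega>
  define W2 where "W2 \<omega> = 6 * exp ((1 + \<bar>l\<bar>) * m1) * exp ((1 + \<bar>l\<bar>) * S \<omega>)" for \<omega>
  have iW: "integrable M W1" "integrable M W2"
    unfolding W1_def W2_def using integrable_exp_S by simp_all
  define K where "K = expectation (\<lambda>\<omega>. l\<^sup>2 / 2 * W1 \<omega> + \<bar>l\<bar> ^ 3 * W2 \<omega>)"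
  show ?thesis
  proof (intro exI[of _ K] allI impI, elim conjE)
    fix r :: real and D0 w
    assume r: "0 \<le> r" "r \<le> 1" and D0m[measurable]: "D0 \<in> borel_measurable M"
      and D0: "\<forall>\<omega>. \<bar>D0 \<omega>\<bar> \<le> r * S \<omega>" and w: "\<forall>i\<in>I. 0 \<le> w i" "(\<Sum>i\<in>I. w i) = 1"
      and D0Z: "\<forall>\<omega>. \<bar>D0 \<omega> - r * (\<Sum>i\<in>I. w i * X i \<omega>)\<bar> \<le> C * r\<^sup>2 * (S \<omega>)\<^sup>2"
    define Z where "Z \<omega> = (\<Sum>i\<in>I. w i * X i \<omega>)" for \<omega>
    have Zm[measurable]: "Z \<in> borel_measurable M" unfolding Z_def by measurable
    have iZ: "integrable M Z" "expectation Z = 0" "integrable M (\<lambda>\<omega>. (Z \<omega>)\<^sup>2)"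
      unfolding Z_def using centered_normal_moments[OF comb[of w]] by auto
    have vZ: "expectation (\<lambda>\<omega>. (Z \<omega>)\<^sup>2) \<le> s\<^sup>2"
      unfolding Z_def by (rule variance_convex_comb) (use w in auto)
    have ZS: "\<bar>Z \<omega>\<bar> \<le> S \<omega>" for \<omega>
    proof -
      have "w i \<le> 1" if "i \<in> I" for i using member_le_sum[of i I w] that w finI by auto
      then have "\<bar>w i * X i \<omega>\<bar> \<le> \<bar>X i \<omega>\<bar>" if "i \<in> I" for i
        unfolding abs_mult using w that by (intro mult_left_le_one_le) auto
      then have "(\<Sum>i\<in>I. \<bar>w i * X i \<omega>\<bar>) \<le> S \<omega>" unfolding S_def by (intro sum_mono)
      then show ?thesis unfolding Z_def using sum_abs[of "\<lambda>i. w i * X i \<omega>" I] by linarith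
    qed
    have iD0: "integrable M D0"
    proof (rule Bochner_Integration.integrable_bound)
      show "integrable M (\<lambda>\<omega>. r * S \<omega>)" using integrable_S by simp
      show "AE \<omega> in M. norm (D0 \<omega>) \<le> norm (r * S \<omega>)" using D0 r by (auto simp: abs_mult)
    qed simp
    define e where "e = expectation D0"
    \<comment> \<open>Centering removes the linear term of the expansion; the factor
      \<open>exp (l * e)\<close> is restored at the end.\<close>
    define D where "D \<omega> = D0 \<omega> - e" for \<omega>
    have Dm[measurable]: "D \<in> borel_measurable M" unfolding D_def by measurable
    have iD: "integrable M D" "expectation D = 0"
      unfolding D_def e_def using iD0 by (auto simp: prob_space)
    have e1: "\<bar>e\<bar> \<le> r * m1"
    proof -
      have "\<bar>e\<bar> \<le> expectation (\<lambda>\<omega>. \<bar>D0 \<omega>\<bar>)" unfolding e_def by (rule integral_abs_bound)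
      also have "\<dots> \<le> expectation (\<lambda>\<omega>. r * S \<omega>)"
        using D0 iD0 integrable_S by (intro integral_mono) auto
      finally show ?thesis by (simp add: m1_def)
    qed
    \<comment> \<open>The mean is of second order in \<open>r\<close>, because the linear part
      \<open>Z\<close> has mean zero.\<close>
    have e2: "\<bar>e\<bar> \<le> C * r\<^sup>2 * m2"
    proof -
      have "e = expectation (\<lambda>\<omega>. D0 \<omega> - r * Z \<omega>)" unfolding e_def using iD0 iZ by simp
      then have "\<bar>e\<bar> \<le> expectation (\<lambda>\<omega>. \<bar>D0 \<omega> - r * Z \<omega>\<bar>)" using integral_abs_bound by simp
      also have "\<dots> \<le> expectation (\<lambda>\<omega>. C * r\<^sup>2 * (S \<omega>)\<^sup>2)"
        using D0Z iD0 iZ integrable_S unfolding Z_def by (intro integral_mono) auto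
      finally show ?thesis by (simp add: m2_def)
    qed
    have D1: "\<bar>D \<omega>\<bar> \<le> r * (S \<omega> + m1)" for \<omega>
      using D0[rule_format, of \<omega>] e1 unfolding D_def distrib_left by linarith
    have D2: "\<bar>D \<omega> - r * Z \<omega>\<bar> \<le> C * r\<^sup>2 * ((S \<omega>)\<^sup>2 + m2)" for \<omega>
      using D0Z[rule_format, of \<omega>] e2 unfolding D_def distrib_left Z_def by linarith
    \<comment> \<open>Difference of squares: one factor is of order \<open>r^2\<close>, the other of
      order \<open>r\<close>.\<close>
    have Dsq: "(D \<omega>)\<^sup>2 \<le> r\<^sup>2 * (Z \<omega>)\<^sup>2 + r ^ 3 * W1 \<omega>" for \<omega>
    proof -
      have "(D \<omega>)\<^sup>2 - r\<^sup>2 * (Z \<omega>)\<^sup>2 = (D \<omega> - r * Z \<omega>) * (D \<omega> + r * Z \<omega>)"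
        by (simp add: power2_eq_square algebra_simps)
      also have "\<dots> \<le> \<bar>D \<omega> - r * Z \<omega>\<bar> * \<bar>D \<omega> + r * Z \<omega>\<bar>"
        by (metis abs_ge_self abs_mult)
      also have "\<dots> \<le> (C * r\<^sup>2 * ((S \<omega>)\<^sup>2 + m2)) * (r * (2 * S \<omega> + m1))"
      proof (rule mult_mono[OF D2])
        have "\<bar>r * Z \<omega>\<bar> \<le> r * S \<omega>" using ZS[of \<omega>] r by (simp add: abs_mult mult_left_mono)
        then show "\<bar>D \<omega> + r * Z \<omega>\<bar> \<le> r * (2 * S \<omega> + m1)"
          using D1[of \<omega>] by (simp add: algebra_simps)
      qed (use C r m in \<open>auto intro!: mult_nonneg_nonneg add_nonneg_nonneg\<close>)
      also have "\<dots> = (C * r ^ 3) * (((S \<omega>)\<^sup>2 + m2) * (2 * S \<omega> + m1))"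
        by (simp add: power2_eq_square power3_eq_cube)
      also have "\<dots> \<le> (C * r ^ 3) * (((2 + m2) * exp (S \<omega>)) * ((2 + m1) * exp (S \<omega>)))"
      proof (intro mult_left_mono mult_mono)
        have e: "1 \<le> exp (S \<omega>)" by simp
        have "m2 * 1 \<le> m2 * exp (S \<omega>)" "m1 * 1 \<le> m1 * exp (S \<omega>)" using m e by (intro mult_left_mono; simp)+
        then show "(S \<omega>)\<^sup>2 + m2 \<le> (2 + m2) * exp (S \<omega>)" "2 * S \<omega> + m1 \<le> (2 + m1) * exp (S \<omega>)"
          using S_le_exp[of \<omega>] unfolding distrib_right by linarith+
      qed (use C r m in \<open>auto intro!: mult_nonneg_nonneg add_nonneg_nonneg\<close>)
      also have "\<dots> = r ^ 3 * W1 \<omega>" unfolding W1_def by (simp add: mult_exp_exp)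
      finally show ?thesis by simp
    qed
    have Dcu: "\<bar>l * D \<omega>\<bar> ^ 3 * exp \<bar>l * D \<omega>\<bar> \<le> \<bar>l\<bar> ^ 3 * (r ^ 3 * W2 \<omega>)" for \<omega>
    proof -
      have a: "\<bar>l * D \<omega>\<bar> \<le> \<bar>l\<bar> * (r * (S \<omega> + m1))" unfolding abs_mult using D1 by (intro mult_left_mono) auto
      have b: "\<bar>l\<bar> * (r * (S \<omega> + m1)) \<le> \<bar>l\<bar> * (S \<omega> + m1)"
        using r m by (intro mult_left_mono mult_left_le_one_le) auto
      have "\<bar>l * D \<omega>\<bar> ^ 3 * exp \<bar>l * D \<omega>\<bar> \<le> (\<bar>l\<bar> * (r * (S \<omega> + m1))) ^ 3 * exp (\<bar>l\<bar> * (S \<omega> + m1))"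
        using a b by (intro mult_mono power_mono) auto
      also have "\<dots> = \<bar>l\<bar> ^ 3 * (r ^ 3 * ((S \<omega> + m1) ^ 3 * exp (\<bar>l\<bar> * (S \<omega> + m1))))"
        by (simp add: power_mult_distrib)
      also have "\<dots> \<le> \<bar>l\<bar> ^ 3 * (r ^ 3 * ((6 * exp (S \<omega> + m1)) * exp (\<bar>l\<bar> * (S \<omega> + m1))))"
        using r m power_le_fact_exp[of "S \<omega> + m1" 3]
        by (intro mult_left_mono mult_right_mono) (auto simp: fact_numeral)
      also have "\<dots> = \<bar>l\<bar> ^ 3 * (r ^ 3 * W2 \<omega>)"
        unfolding W2_def by (simp add: mult_exp_exp algebra_simps)
      finally show ?thesis .
    qed
    have iexpD0: "integrable M (\<lambda>\<omega>. exp (l * D0 \<omega>))"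
    proof (rule integrable_of_exp_bound[where C=1 and l="\<bar>l\<bar>"])
      fix \<omega>
      have "l * D0 \<omega> \<le> \<bar>l\<bar> * \<bar>D0 \<omega>\<bar>" by (metis abs_ge_self abs_mult)
      also have "\<dots> \<le> \<bar>l\<bar> * (1 * S \<omega>)"
        using D0 r mult_right_mono[of r 1 "S \<omega>"] by (intro mult_left_mono) (auto intro: order_trans)
      finally show "\<bar>exp (l * D0 \<omega>)\<bar> \<le> 1 * exp (\<bar>l\<bar> * S \<omega>)" by simp
    qed simp
    have expD: "exp (l * D \<omega>) = exp (- l * e) * exp (l * D0 \<omega>)" for \<omega>
      unfolding D_def by (simp add: mult_exp_exp algebra_simps)
    have "expectation (\<lambda>\<omega>. exp (l * D \<omega>)) \<le>
       expectation (\<lambda>\<omega>. 1 + l * D \<omega> + l\<^sup>2 / 2 * r\<^sup>2 * (Z \<omega>)\<^sup>2 + r ^ 3 * (l\<^sup>2 / 2 * W1 \<omega> + \<bar>l\<bar> ^ 3 * W2 \<omega>))"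
    proof (rule integral_mono)
      show "integrable M (\<lambda>\<omega>. exp (l * D \<omega>))" unfolding expD using iexpD0 by simp
      show "integrable M (\<lambda>\<omega>. 1 + l * D \<omega> + l\<^sup>2 / 2 * r\<^sup>2 * (Z \<omega>)\<^sup>2 + r ^ 3 * (l\<^sup>2 / 2 * W1 \<omega> + \<bar>l\<bar> ^ 3 * W2 \<omega>))"
        using iD iZ iW by simp
      fix \<omega>
      have "l\<^sup>2 / 2 * (D \<omega>)\<^sup>2 \<le> l\<^sup>2 / 2 * (r\<^sup>2 * (Z \<omega>)\<^sup>2 + r ^ 3 * W1 \<omega>)"
        by (rule mult_left_mono[OF Dsq]) simp
      then show "exp (l * D \<omega>) \<le> 1 + l * D \<omega> + l\<^sup>2 / 2 * r\<^sup>2 * (Z \<omega>)\<^sup>2 + r ^ 3 * (l\<^sup>2 / 2 * W1 \<omega> + \<bar>l\<bar> ^ 3 * W2 \<omega>)"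
        using exp_le_quadratic_remainder[of "l * D \<omega>"] Dcu[of \<omega>]
        by (simp add: algebra_simps)
    qed
    also have "\<dots> = 1 + l\<^sup>2 / 2 * r\<^sup>2 * expectation (\<lambda>\<omega>. (Z \<omega>)\<^sup>2) + r ^ 3 * K"
      unfolding K_def using iD iZ iW by (simp add: prob_space)
    also have "\<dots> \<le> 1 + l\<^sup>2 / 2 * r\<^sup>2 * s\<^sup>2 + r ^ 3 * K"
      using vZ r by (intro add_mono mult_left_mono) auto
    also have "\<dots> \<le> exp (l\<^sup>2 * s\<^sup>2 / 2 * r\<^sup>2 + K * r ^ 3)"
      using exp_ge_add_one_self[of "l\<^sup>2 * s\<^sup>2 / 2 * r\<^sup>2 + K * r ^ 3"] by (simp add: algebra_simps)
    finally have *: "exp (- l * e) * expectation (\<lambda>\<omega>. exp (l * D0 \<omega>)) \<le> exp (l\<^sup>2 * s\<^sup>2 / 2 * r\<^sup>2 + K * r ^ 3)"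
      unfolding expD by simp
    have "expectation (\<lambda>\<omega>. exp (l * D0 \<omega>)) = exp (l * e) * (exp (- l * e) * expectation (\<lambda>\<omega>. exp (l * D0 \<omega>)))"
      by (simp add: mult.assoc[symmetric] mult_exp_exp)
    also have "\<dots> \<le> exp (l * e) * exp (l\<^sup>2 * s\<^sup>2 / 2 * r\<^sup>2 + K * r ^ 3)"
      using * by (intro mult_left_mono) auto
    finally show "expectation (\<lambda>\<omega>. exp (l * D0 \<omega>)) \<le> exp (l * expectation D0) * exp (l\<^sup>2 * s\<^sup>2 / 2 * r\<^sup>2 + K * r ^ 3)"
      unfolding e_def .
  qed
qed

end

section \<open>Splitting a Gaussian vector into independent rescaled copies\<close>

context gaussian_vector
begin

text \<open>The characteristic exponent is quadratic, so \<open>a\<close> and \<open>b\<close> add.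
  The two factors of the product space carry the independent copies; with \<open>a = k / n\<close>
  and \<open>b = 1 / n\<close> this peels one copy off a block of \<open>k + 1\<close>.\<close>

lemma rescaled_sum_law:
  assumes a: "0 \<le> a" and b: "0 \<le> b"
  shows "distr (M \<Otimes>\<^sub>M M) (PiM I (\<lambda>_. borel)) (\<lambda>z. \<lambda>i\<in>I. sqrt a * X i (snd z) + sqrt b * X i (fst z))
    = distr M (PiM I (\<lambda>_. borel)) (\<lambda>\<omega>. \<lambda>i\<in>I. sqrt (a + b) * X i \<omega>)"
proof (rule distr_PiM_eq_of_char)
  interpret PP: pair_prob_space M M ..
  show "prob_space (M \<Otimes>\<^sub>M M)" by unfold_locales
  show "prob_space M" by unfold_locales
  show "finite I" by (rule finI)
  show "(\<lambda>z. sqrt a * X i (snd z) + sqrt b * X i (fst z)) \<in> borel_measurable (M \<Otimes>\<^sub>M M)" if "i \<in> I" for i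
    using that by measurable
  show "(\<lambda>\<omega>. sqrt (a + b) * X i \<omega>) \<in> borel_measurable M" if "i \<in> I" for i
    using that by measurable
  fix c :: "'i \<Rightarrow> real"
  define Y where "Y \<omega> = (\<Sum>i\<in>I. c i * X i \<omega>)" for \<omega>
  have Ym[measurable]: "Y \<in> borel_measurable M" unfolding Y_def by measurable
  define v where "v = expectation (\<lambda>\<omega>. (Y \<omega>)\<^sup>2)"
  have ch: "(\<integral>\<omega>. iexp (q * Y \<omega>) \<partial>M) = complex_of_real (exp (- (q\<^sup>2 * v) / 2))" for q
  proof -
    have eq: "q * Y \<omega> = (\<Sum>i\<in>I. (q * c i) * X i \<omega>)" for \<omega>
      unfolding Y_def by (simp add: sum_distrib_left mult.assoc)
    have "(\<integral>\<omega>. iexp (q * Y \<omega>) \<partial>M) = complex_of_real (exp (- (\<integral>\<omega>. (q * Y \<omega>)\<^sup>2 \<partial>M) / 2))"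
      unfolding eq by (rule centered_normal_moments(4)[OF comb])
    also have "(\<integral>\<omega>. (q * Y \<omega>)\<^sup>2 \<partial>M) = q\<^sup>2 * v" unfolding v_def by (simp add: power_mult_distrib)
    finally show ?thesis .
  qed
  have e1: "(\<Sum>i\<in>I. c i * (sqrt a * X i (snd z) + sqrt b * X i (fst z))) = sqrt b * Y (fst z) + sqrt a * Y (snd z)" for z
    unfolding Y_def by (simp add: sum_distrib_left sum.distrib[symmetric] algebra_simps)
  have e2: "(\<Sum>i\<in>I. c i * (sqrt (a + b) * X i \<omega>)) = sqrt (a + b) * Y \<omega>" for \<omega>
    unfolding Y_def by (simp add: sum_distrib_left mult_ac)
  have int: "integrable (M \<Otimes>\<^sub>M M) (\<lambda>z. iexp (sqrt b * Y (fst z) + sqrt a * Y (snd z)))"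
    by (rule PP.P.integrable_const_bound[where B=1]) auto
  have "(\<integral>z. iexp (sqrt b * Y (fst z) + sqrt a * Y (snd z)) \<partial>(M \<Otimes>\<^sub>M M))
     = (\<integral>\<omega>. \<integral>\<omega>'. iexp (sqrt b * Y \<omega>) * iexp (sqrt a * Y \<omega>') \<partial>M \<partial>M)"
    using PP.integral_fst'[OF int] by (simp add: mult_exp_exp algebra_simps)
  also have "\<dots> = complex_of_real (exp (- ((sqrt b)\<^sup>2 * v) / 2)) * complex_of_real (exp (- ((sqrt a)\<^sup>2 * v) / 2))"
    by (simp only: integral_mult_right_zero integral_mult_left_zero ch)
  also have "\<dots> = complex_of_real (exp (- ((sqrt (a + b))\<^sup>2 * v) / 2))"
    using a b unfolding of_real_mult[symmetric] by (simp add: mult_exp_exp field_simps)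
  also have "\<dots> = (\<integral>\<omega>. iexp (sqrt (a + b) * Y \<omega>) \<partial>M)" by (rule ch[symmetric])
  finally show "(\<integral>z. iexp (\<Sum>i\<in>I. c i * (sqrt a * X i (snd z) + sqrt b * X i (fst z))) \<partial>(M \<Otimes>\<^sub>M M))
     = (\<integral>\<omega>. iexp (\<Sum>i\<in>I. c i * (sqrt (a + b) * X i \<omega>)) \<partial>M)"
    unfolding e1 e2 .
qed

text \<open>Functions integrable against every rescaled and shifted Gaussian vector. The condition
  on \<open>restrict\<close> reconciles total functions with the extensional ones on which the
  product measure lives.\<close>

definition exp_growth :: "(('i \<Rightarrow> real) \<Rightarrow> real) \<Rightarrow> bool" where
  "exp_growth f \<longleftrightarrow> f \<in> borel_measurable (PiM I (\<lambda>_. borel)) \<and> (\<forall>x. f (restrict x I) = f x) \<and>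
     (\<exists>C l. 0 \<le> C \<and> 0 \<le> l \<and> (\<forall>x. \<bar>f x\<bar> \<le> C * exp (l * (\<Sum>i\<in>I. \<bar>x i\<bar>))))"

lemma exp_growth_comp_measurable:
  assumes "exp_growth f" "\<And>i. i \<in> I \<Longrightarrow> V i \<in> borel_measurable N"
  shows "(\<lambda>\<omega>. f (\<lambda>i. V i \<omega>)) \<in> borel_measurable N"
proof -
  have "(\<lambda>\<omega>. \<lambda>i\<in>I. V i \<omega>) \<in> measurable N (PiM I (\<lambda>_. borel))"
    using assms(2) by (rule measurable_restrict)
  then have "(\<lambda>\<omega>. f (\<lambda>i\<in>I. V i \<omega>)) \<in> borel_measurable N"
    by (rule measurable_compose) (use assms(1) in \<open>simp add: exp_growth_def\<close>)
  then show ?thesis using assms(1) unfolding exp_growth_def by simp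
qed

lemma exp_growth_shift:
  assumes f: "exp_growth f"
  shows "exp_growth (\<lambda>y. f (\<lambda>i. x i + y i))"
proof -
  obtain C l where C: "0 \<le> C" "0 \<le> l" "\<And>x. \<bar>f x\<bar> \<le> C * exp (l * (\<Sum>i\<in>I. \<bar>x i\<bar>))"
    using f unfolding exp_growth_def by blast
  have "(\<lambda>y. f (\<lambda>i. x i + y i)) \<in> borel_measurable (PiM I (\<lambda>_. borel))"
    by (rule exp_growth_comp_measurable[OF f]) measurable
  moreover have "f (\<lambda>i. x i + restrict y I i) = f (\<lambda>i. x i + y i)" for y
  proof -
    have "f (\<lambda>i. x i + restrict y I i) = f (restrict (\<lambda>i. x i + restrict y I i) I)"
      using f unfolding exp_growth_def by simp
    also have "restrict (\<lambda>i. x i + restrict y I i) I = restrict (\<lambda>i. x i + y i) I" by auto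
    also have "f \<dots> = f (\<lambda>i. x i + y i)" using f unfolding exp_growth_def by simp
    finally show ?thesis .
  qed
  moreover have "\<bar>f (\<lambda>i. x i + y i)\<bar> \<le> (C * exp (l * (\<Sum>i\<in>I. \<bar>x i\<bar>))) * exp (l * (\<Sum>i\<in>I. \<bar>y i\<bar>))" for y
  proof -
    have "(\<Sum>i\<in>I. \<bar>x i + y i\<bar>) \<le> (\<Sum>i\<in>I. \<bar>x i\<bar>) + (\<Sum>i\<in>I. \<bar>y i\<bar>)"
      unfolding sum.distrib[symmetric] by (intro sum_mono abs_triangle_ineq)
    then have "l * (\<Sum>i\<in>I. \<bar>x i + y i\<bar>) \<le> l * (\<Sum>i\<in>I. \<bar>x i\<bar>) + l * (\<Sum>i\<in>I. \<bar>y i\<bar>)"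
      using C by (simp add: distrib_left[symmetric] mult_left_mono)
    then have "C * exp (l * (\<Sum>i\<in>I. \<bar>x i + y i\<bar>)) \<le> C * exp (l * (\<Sum>i\<in>I. \<bar>x i\<bar>) + l * (\<Sum>i\<in>I. \<bar>y i\<bar>))"
      using C by (intro mult_left_mono) auto
    then show ?thesis using C(3)[of "\<lambda>i. x i + y i"] by (simp add: exp_add mult.assoc)
  qed
  ultimately show ?thesis unfolding exp_growth_def using C
    by (intro conjI allI exI[of _ "C * exp (l * (\<Sum>i\<in>I. \<bar>x i\<bar>))"] exI[of _ l]) auto
qed

lemma exp_growth_integrable:
  assumes f: "exp_growth f"
  shows "integrable M (\<lambda>\<omega>. f (\<lambda>i. q * X i \<omega>))"
proof -
  obtain C l where C: "0 \<le> C" "0 \<le> l" "\<And>x. \<bar>f x\<bar> \<le> C * exp (l * (\<Sum>i\<in>I. \<bar>x i\<bar>))"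
    using f unfolding exp_growth_def by blast
  show ?thesis
  proof (rule integrable_of_exp_bound)
    show "(\<lambda>\<omega>. f (\<lambda>i. q * X i \<omega>)) \<in> borel_measurable M"
      by (rule exp_growth_comp_measurable[OF f]) measurable
    show "\<bar>f (\<lambda>i. q * X i \<omega>)\<bar> \<le> C * exp ((l * \<bar>q\<bar>) * S \<omega>)" for \<omega>
      using C(3)[of "\<lambda>i. q * X i \<omega>"] unfolding S_def by (simp add: abs_mult sum_distrib_left mult.assoc)
  qed
qed

text \<open>With \<open>P a f x = E f (x + sqrt a * X)\<close> this is
  \<open>P b (P a f) = P (a + b) f\<close> at the origin; other base points are reached by
  \<open>exp_growth_shift\<close>.\<close>

lemma semigroup:
  assumes f: "exp_growth f" and a: "0 \<le> a" and b: "0 \<le> b"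
  shows "integrable M (\<lambda>\<omega>. \<integral>\<omega>'. f (\<lambda>i. sqrt a * X i \<omega>' + sqrt b * X i \<omega>) \<partial>M)"
    and "(\<integral>\<omega>. \<integral>\<omega>'. f (\<lambda>i. sqrt a * X i \<omega>' + sqrt b * X i \<omega>) \<partial>M \<partial>M) = (\<integral>\<omega>. f (\<lambda>i. sqrt (a + b) * X i \<omega>) \<partial>M)" (is "?L = ?R")
proof -
  interpret PP: pair_prob_space M M ..
  have fm[measurable]: "f \<in> borel_measurable (PiM I (\<lambda>_. borel))" and fr: "f (restrict x I) = f x" for x
    using f unfolding exp_growth_def by auto
  have m1: "(\<lambda>z. \<lambda>i\<in>I. sqrt a * X i (snd z) + sqrt b * X i (fst z)) \<in> measurable (M \<Otimes>\<^sub>M M) (PiM I (\<lambda>_. borel))"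
    by (rule measurable_restrict) measurable
  have m2: "(\<lambda>\<omega>. \<lambda>i\<in>I. sqrt (a + b) * X i \<omega>) \<in> measurable M (PiM I (\<lambda>_. borel))"
    by (rule measurable_restrict) measurable
  have "integrable (distr M (PiM I (\<lambda>_. borel)) (\<lambda>\<omega>. \<lambda>i\<in>I. sqrt (a + b) * X i \<omega>)) f"
    using exp_growth_integrable[OF f, of "sqrt (a + b)"] by (subst integrable_distr_eq[OF m2]) (auto simp: fr)
  then have int: "integrable (M \<Otimes>\<^sub>M M) (\<lambda>z. f (\<lambda>i. sqrt a * X i (snd z) + sqrt b * X i (fst z)))"
    unfolding rescaled_sum_law[OF a b, symmetric] by (subst (asm) integrable_distr_eq[OF m1]) (auto simp: fr)
  show "integrable M (\<lambda>\<omega>. \<integral>\<omega>'. f (\<lambda>i. sqrt a * X i \<omega>' + sqrt b * X i \<omega>) \<partial>M)"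
    using PP.integrable_fst'[OF int] by simp
  have "?L = (\<integral>z. f (\<lambda>i. sqrt a * X i (snd z) + sqrt b * X i (fst z)) \<partial>(M \<Otimes>\<^sub>M M))"
    using PP.integral_fst'[OF int] by simp
  also have "\<dots> = (\<integral>x. f x \<partial>distr (M \<Otimes>\<^sub>M M) (PiM I (\<lambda>_. borel)) (\<lambda>z. \<lambda>i\<in>I. sqrt a * X i (snd z) + sqrt b * X i (fst z)))"
    by (subst integral_distr[OF m1]) (auto simp: fr)
  also have "\<dots> = ?R"
    unfolding rescaled_sum_law[OF a b] by (subst integral_distr[OF m2]) (auto simp: fr)
  finally show "?L = ?R" .
qed

lemma softmax_exp_growth:
  assumes b: "0 < b"
  shows "exp_growth (softmax I b)" "exp_growth (\<lambda>x. exp (l * softmax I b x))"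
    "i \<in> I \<Longrightarrow> exp_growth (\<lambda>x. softmax_weight I b x i)"
proof -
  define c where "c = \<bar>softmax I b (\<lambda>_. 0)\<bar>"
  have r: "softmax I b (restrict x I) = softmax I b x" for x
    unfolding softmax_def by (simp cong: sum.cong)
  have m[measurable]: "softmax I b \<in> borel_measurable (PiM I (\<lambda>_. borel))"
    unfolding softmax_def by measurable
  have bound: "\<bar>softmax I b x\<bar> \<le> c + (\<Sum>i\<in>I. \<bar>x i\<bar>)" for x
    using softmax_lipschitz[OF finI neI b, of "\<lambda>_. 0" x] unfolding c_def by simp
  have c: "0 \<le> c" unfolding c_def by simp
  have "\<bar>softmax I b x\<bar> \<le> (c + 1) * exp (1 * (\<Sum>i\<in>I. \<bar>x i\<bar>))" for x
  proof -
    have "0 \<le> (\<Sum>i\<in>I. \<bar>x i\<bar>)" by (simp add: sum_nonneg)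
    then have "c * 1 \<le> c * exp (\<Sum>i\<in>I. \<bar>x i\<bar>)" using c by (intro mult_left_mono) auto
    then show ?thesis using bound[of x] exp_ge_add_one_self[of "\<Sum>i\<in>I. \<bar>x i\<bar>"]
      unfolding mult_1_left mult_1_right distrib_right by linarith
  qed
  then show "exp_growth (softmax I b)" unfolding exp_growth_def using m r c
    by (intro conjI allI exI[of _ "c + 1"] exI[of _ 1]) auto
  have "\<bar>exp (l * softmax I b x)\<bar> \<le> exp (\<bar>l\<bar> * c) * exp (\<bar>l\<bar> * (\<Sum>i\<in>I. \<bar>x i\<bar>))" for x
  proof -
    have "l * softmax I b x \<le> \<bar>l\<bar> * \<bar>softmax I b x\<bar>" by (metis abs_ge_self abs_mult)
    also have "\<dots> \<le> \<bar>l\<bar> * (c + (\<Sum>i\<in>I. \<bar>x i\<bar>))" using bound by (intro mult_left_mono) auto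
    finally show ?thesis by (simp add: mult_exp_exp distrib_left)
  qed
  then show "exp_growth (\<lambda>x. exp (l * softmax I b x))" unfolding exp_growth_def using m r
    by (intro conjI allI exI[of _ "exp (\<bar>l\<bar> * c)"] exI[of _ "\<bar>l\<bar>"]) auto
  assume i: "i \<in> I"
  have "(\<lambda>x. softmax_weight I b x i) \<in> borel_measurable (PiM I (\<lambda>_. borel))"
    unfolding softmax_weight_def using i by measurable
  moreover have "softmax_weight I b (restrict x I) i = softmax_weight I b x i" for x
    unfolding softmax_weight_def using i by (simp cong: sum.cong)
  moreover have "\<bar>softmax_weight I b x i\<bar> \<le> 1 * exp (0 * (\<Sum>i\<in>I. \<bar>x i\<bar>))" for x
    using softmax_weight_nonneg[OF finI neI b, of x i] softmax_weight_le_1[OF finI neI b i, of x] by simp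
  ultimately show "exp_growth (\<lambda>x. softmax_weight I b x i)" unfolding exp_growth_def
    by (intro conjI allI exI[of _ 1] exI[of _ 0]) auto
qed

text \<open>\<open>H\<close> is the softmax averaged over the copies not yet revealed. The pointwise
  increment bounds are uniform in the base point, so they survive averaging, with averaged Gibbs
  weights as the linear part.\<close>

lemma smoothed_softmax_increment:
  fixes q b :: real
  assumes b: "0 < b"
  defines "H \<equiv> \<lambda>x. \<integral>\<omega>. softmax I b (\<lambda>i. x i + q * X i \<omega>) \<partial>M"
  defines "w \<equiv> \<lambda>x i. \<integral>\<omega>. softmax_weight I b (\<lambda>i. x i + q * X i \<omega>) i \<partial>M"
  shows "\<bar>H (\<lambda>i. x i + y i) - H x\<bar> \<le> (\<Sum>i\<in>I. \<bar>y i\<bar>)"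
    "\<bar>H (\<lambda>i. x i + y i) - H x - (\<Sum>i\<in>I. w x i * y i)\<bar> \<le> 4 * b * (\<Sum>i\<in>I. \<bar>y i\<bar>)\<^sup>2"
    "0 \<le> w x i" "(\<Sum>i\<in>I. w x i) = 1"
proof -
  note smw = softmax_exp_growth(3)[OF b]
  have iw: "integrable M (\<lambda>\<omega>. softmax_weight I b (\<lambda>i. x i + q * X i \<omega>) i)" if "i \<in> I" for i
    using exp_growth_integrable[OF exp_growth_shift[OF smw[OF that], of x], of q] .
  have iH: "integrable M (\<lambda>\<omega>. softmax I b (\<lambda>i. x i + q * X i \<omega>))" for x
    using exp_growth_integrable[OF exp_growth_shift[OF softmax_exp_growth(1)[OF b], of x], of q] .
  define D where "D \<omega> = softmax I b (\<lambda>i. (x i + q * X i \<omega>) + y i) - softmax I b (\<lambda>i. x i + q * X i \<omega>)" for \<omega>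
  have sw: "softmax I b (\<lambda>i. (x i + y i) + q * X i \<omega>) = softmax I b (\<lambda>i. (x i + q * X i \<omega>) + y i)" for \<omega>
    by (simp add: add_ac)
  have iD: "integrable M D" unfolding D_def
    using iH[of x] iH[of "\<lambda>i. x i + y i"] unfolding sw by simp
  have HD: "H (\<lambda>i. x i + y i) - H x = expectation D"
    unfolding H_def D_def sw[symmetric] using iH[of x] iH[of "\<lambda>i. x i + y i"] by simp
  have "\<bar>expectation D\<bar> \<le> expectation (\<lambda>\<omega>. \<bar>D \<omega>\<bar>)" by (rule integral_abs_bound)
  also have "\<dots> \<le> expectation (\<lambda>_. \<Sum>i\<in>I. \<bar>y i\<bar>)"
    using iD softmax_lipschitz[OF finI neI b] unfolding D_def by (intro integral_mono) auto
  finally show "\<bar>H (\<lambda>i. x i + y i) - H x\<bar> \<le> (\<Sum>i\<in>I. \<bar>y i\<bar>)" unfolding HD by (simp add: prob_space)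
  let ?W = "\<lambda>\<omega>. \<Sum>i\<in>I. softmax_weight I b (\<lambda>i. x i + q * X i \<omega>) i * y i"
  have iW: "integrable M ?W" using iw by (intro Bochner_Integration.integrable_sum integrable_mult_left) auto
  have Ww: "expectation ?W = (\<Sum>i\<in>I. w x i * y i)"
    unfolding w_def using iw by (subst Bochner_Integration.integral_sum) auto
  have "\<bar>expectation (\<lambda>\<omega>. D \<omega> - ?W \<omega>)\<bar> \<le> expectation (\<lambda>\<omega>. \<bar>D \<omega> - ?W \<omega>\<bar>)" by (rule integral_abs_bound)
  also have "\<dots> \<le> expectation (\<lambda>_. 4 * b * (\<Sum>i\<in>I. \<bar>y i\<bar>)\<^sup>2)"
  proof (rule integral_mono)
    fix \<omega>
    show "\<bar>D \<omega> - ?W \<omega>\<bar> \<le> 4 * b * (\<Sum>i\<in>I. \<bar>y i\<bar>)\<^sup>2"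
      using softmax_add_ge[OF finI neI b, of "\<lambda>i. x i + q * X i \<omega>" y] softmax_add_le[OF finI neI b, of "\<lambda>i. x i + q * X i \<omega>" y]
      unfolding D_def by linarith
  qed (use iD iW in auto)
  finally show "\<bar>H (\<lambda>i. x i + y i) - H x - (\<Sum>i\<in>I. w x i * y i)\<bar> \<le> 4 * b * (\<Sum>i\<in>I. \<bar>y i\<bar>)\<^sup>2"
    unfolding HD using iD iW Ww by (simp add: prob_space)
  show "0 \<le> w x i" unfolding w_def using softmax_weight_nonneg[OF finI neI b] by (intro integral_nonneg_AE) auto
  have "(\<Sum>i\<in>I. w x i) = (\<integral>\<omega>. (\<Sum>i\<in>I. softmax_weight I b (\<lambda>i. x i + q * X i \<omega>) i) \<partial>M)"
    unfolding w_def using iw by (subst Bochner_Integration.integral_sum) auto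
  then show "(\<Sum>i\<in>I. w x i) = 1" by (simp add: softmax_weight_sum[OF finI neI b] prob_space)
qed

lemma softmax_mgf:
  assumes b: "0 < b"
  shows "expectation (\<lambda>\<omega>. exp (l * softmax I b (\<lambda>i. X i \<omega>))) \<le>
    exp (l * expectation (\<lambda>\<omega>. softmax I b (\<lambda>i. X i \<omega>)) + l\<^sup>2 * s\<^sup>2 / 2)"
proof -
  let ?F = "softmax I b"
  obtain K where K: "\<And>r D w. 0 \<le> r \<Longrightarrow> r \<le> 1 \<Longrightarrow> D \<in> borel_measurable M \<Longrightarrow> (\<And>\<omega>. \<bar>D \<omega>\<bar> \<le> r * S \<omega>) \<Longrightarrow>
     (\<And>i. i \<in> I \<Longrightarrow> 0 \<le> w i) \<Longrightarrow> (\<Sum>i\<in>I. w i) = 1 \<Longrightarrow> (\<And>\<omega>. \<bar>D \<omega> - r * (\<Sum>i\<in>I. w i * X i \<omega>)\<bar> \<le> 4 * b * r\<^sup>2 * (S \<omega>)\<^sup>2) \<Longrightarrow>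
     expectation (\<lambda>\<omega>. exp (l * D \<omega>)) \<le> exp (l * expectation D) * exp (l\<^sup>2 * s\<^sup>2 / 2 * r\<^sup>2 + K * r ^ 3)"
  proof -
    have "0 \<le> 4 * b" using b by simp
    from one_step_mgf[OF this, of l] show ?thesis by (elim exE) (rule that, blast)
  qed
  \<comment> \<open>Induction over the number \<open>k\<close> of copies not yet revealed out of
    \<open>n\<close>; the base point \<open>x\<close>, which collects those already revealed, must
    stay arbitrary.\<close>
  have step: "expectation (\<lambda>\<omega>. exp (l * ?F (\<lambda>i. x i + sqrt (real k / real n) * X i \<omega>))) \<le>
     exp (l\<^sup>2 * s\<^sup>2 / 2 * (sqrt (1 / real n))\<^sup>2 + K * (sqrt (1 / real n)) ^ 3) ^ k * exp (l * expectation (\<lambda>\<omega>. ?F (\<lambda>i. x i + sqrt (real k / real n) * X i \<omega>)))"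
    if n: "n > 0" for n k :: nat and x
  proof (induction k arbitrary: x)
    case 0
    then show ?case by (simp add: prob_space)
  next
    case (Suc k)
    define r where "r = sqrt (1 / real n)"
    define q where "q = exp (l\<^sup>2 * s\<^sup>2 / 2 * r\<^sup>2 + K * r ^ 3)"
    have r: "0 \<le> r" "r \<le> 1" unfolding r_def using n by auto
    \<comment> \<open>The conditional mean when \<open>k\<close> copies are still to come; revealing
      one copy changes it by \<open>D\<close>.\<close>
    define H where "H y = expectation (\<lambda>\<omega>. ?F (\<lambda>i. y i + sqrt (real k / real n) * X i \<omega>))" for y
    have ab: "real k / real n + 1 / real n = real (Suc k) / real n" by (simp add: add_divide_distrib)
    have nn: "0 \<le> real k / real n" "0 \<le> 1 / real n" by simp_all
    note sgF = semigroup[OF exp_growth_shift[OF softmax_exp_growth(1)[OF b], of x] nn, unfolded ab r_def[symmetric]]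
    note sgE = semigroup[OF exp_growth_shift[OF softmax_exp_growth(2)[OF b, of l], of x] nn, unfolded ab r_def[symmetric]]
    have reassoc: "(\<lambda>i. x i + (c i + d i)) = (\<lambda>i. (x i + d i) + c i)" for c d :: "'i \<Rightarrow> real"
      by (auto simp: add_ac)
    have HF: "expectation (\<lambda>\<omega>'. ?F (\<lambda>i. x i + (sqrt (real k / real n) * X i \<omega>' + r * X i \<omega>))) = H (\<lambda>i. x i + r * X i \<omega>)" for \<omega>
      unfolding H_def reassoc ..
    have iH: "integrable M (\<lambda>\<omega>. H (\<lambda>i. x i + r * X i \<omega>))" using sgF(1) unfolding HF .
    have eH: "expectation (\<lambda>\<omega>. H (\<lambda>i. x i + r * X i \<omega>)) = expectation (\<lambda>\<omega>. ?F (\<lambda>i. x i + sqrt (real (Suc k) / real n) * X i \<omega>))"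
      using sgF(2) unfolding HF .
    define D where "D \<omega> = H (\<lambda>i. x i + r * X i \<omega>) - H x" for \<omega>
    have iD: "integrable M D" unfolding D_def using iH by simp
    have Dm[measurable]: "D \<in> borel_measurable M" using iD by simp
    note inc = smoothed_softmax_increment[OF b, where q="sqrt (real k / real n)", folded H_def]
    have sumS: "(\<Sum>i\<in>I. \<bar>r * X i \<omega>\<bar>) = r * S \<omega>" for \<omega>
      unfolding S_def using r by (simp add: abs_mult sum_distrib_left)
    define w where "w i = expectation (\<lambda>\<omega>. softmax_weight I b (\<lambda>i. x i + sqrt (real k / real n) * X i \<omega>) i)" for i
    have D1: "\<bar>D \<omega>\<bar> \<le> r * S \<omega>" for \<omega>
      using inc(1)[of x "\<lambda>i. r * X i \<omega>"] unfolding D_def sumS .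
    have D2: "\<bar>D \<omega> - r * (\<Sum>i\<in>I. w i * X i \<omega>)\<bar> \<le> 4 * b * r\<^sup>2 * (S \<omega>)\<^sup>2" for \<omega>
      using inc(2)[of x "\<lambda>i. r * X i \<omega>"] unfolding D_def sumS w_def
      by (simp add: sum_distrib_left power_mult_distrib mult_ac)
    have iexpD: "integrable M (\<lambda>\<omega>. exp (l * D \<omega>))"
    proof (rule integrable_of_exp_bound[where C=1 and l="\<bar>l\<bar>"])
      fix \<omega>
      have "l * D \<omega> \<le> \<bar>l\<bar> * \<bar>D \<omega>\<bar>" by (metis abs_ge_self abs_mult)
      also have "\<dots> \<le> \<bar>l\<bar> * S \<omega>"
        using D1[of \<omega>] r mult_right_mono[of r 1 "S \<omega>"] by (intro mult_left_mono) auto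
      finally show "\<bar>exp (l * D \<omega>)\<bar> \<le> 1 * exp (\<bar>l\<bar> * S \<omega>)" by simp
    qed simp
    have expD: "exp (l * H (\<lambda>i. x i + r * X i \<omega>)) = exp (l * H x) * exp (l * D \<omega>)" for \<omega>
      unfolding D_def by (simp add: mult_exp_exp algebra_simps)
    have "expectation (\<lambda>\<omega>. exp (l * ?F (\<lambda>i. x i + sqrt (real (Suc k) / real n) * X i \<omega>)))
       = (\<integral>\<omega>. (\<integral>\<omega>'. exp (l * ?F (\<lambda>i. (x i + r * X i \<omega>) + sqrt (real k / real n) * X i \<omega>')) \<partial>M) \<partial>M)"
      using sgE(2) unfolding reassoc by simp
    \<comment> \<open>The induction hypothesis acts on the inner integral, with the revealed copy
      moved into the base point.\<close>
    also have "\<dots> \<le> (\<integral>\<omega>. q ^ k * exp (l * H (\<lambda>i. x i + r * X i \<omega>)) \<partial>M)"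
    proof (rule integral_mono)
      show "integrable M (\<lambda>\<omega>. \<integral>\<omega>'. exp (l * ?F (\<lambda>i. (x i + r * X i \<omega>) + sqrt (real k / real n) * X i \<omega>')) \<partial>M)"
        using sgE(1) unfolding reassoc .
      show "integrable M (\<lambda>\<omega>. q ^ k * exp (l * H (\<lambda>i. x i + r * X i \<omega>)))"
        unfolding expD using iexpD by simp
      show "(\<integral>\<omega>'. exp (l * ?F (\<lambda>i. (x i + r * X i \<omega>) + sqrt (real k / real n) * X i \<omega>')) \<partial>M) \<le> q ^ k * exp (l * H (\<lambda>i. x i + r * X i \<omega>))" for \<omega>
        unfolding H_def q_def r_def by (rule Suc.IH)
    qed
    also have "\<dots> = q ^ k * (exp (l * H x) * expectation (\<lambda>\<omega>. exp (l * D \<omega>)))"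
      unfolding expD by simp
    also have "\<dots> \<le> q ^ k * (exp (l * H x) * (exp (l * expectation D) * q))"
      unfolding q_def using inc(3,4)[of x] D1 D2 r
      by (intro mult_left_mono K[of _ _ w]) (auto simp: w_def)
    also have "expectation D = expectation (\<lambda>\<omega>. H (\<lambda>i. x i + r * X i \<omega>)) - H x"
      unfolding D_def using iH by (simp add: prob_space)
    \<comment> \<open>The factors involving \<open>H x\<close> cancel: this is the telescoping of
      the conditional means.\<close>
    also have "q ^ k * (exp (l * H x) * (exp (l * (e - H x)) * q)) = q ^ Suc k * exp (l * e)" for e
      by (simp add: right_diff_distrib exp_diff)
    finally show ?case unfolding eH q_def[symmetric] r_def[symmetric] .
  qed
  define A where "A = expectation (\<lambda>\<omega>. exp (l * ?F (\<lambda>i. X i \<omega>)))"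
  define E where "E = exp (l * expectation (\<lambda>\<omega>. ?F (\<lambda>i. X i \<omega>)))"
  have fin: "A \<le> exp (l\<^sup>2 * s\<^sup>2 / 2 + K * sqrt (1 / real n)) * E" if n: "n > 0" for n :: nat
  proof -
    define r where "r = sqrt (1 / real n)"
    \<comment> \<open>\<open>n\<close> errors of size \<open>r^3\<close> add up to \<open>r\<close>,
      which vanishes as \<open>n\<close> grows.\<close>
    have r: "real n * r\<^sup>2 = 1" "real n * r ^ 3 = r"
      unfolding r_def using n by (auto simp: power3_eq_cube power2_eq_square)
    have "real n * (l\<^sup>2 * s\<^sup>2 / 2 * r\<^sup>2 + K * r ^ 3) = l\<^sup>2 * s\<^sup>2 / 2 * (real n * r\<^sup>2) + K * (real n * r ^ 3)"
      by (simp add: algebra_simps)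
    also have "\<dots> = l\<^sup>2 * s\<^sup>2 / 2 + K * r" unfolding r by simp
    finally show ?thesis
      using step[OF n, of "\<lambda>_. 0" n] n unfolding A_def E_def r_def[symmetric]
      by (simp add: exp_of_nat_mult[symmetric])
  qed
  have "A \<le> exp (l\<^sup>2 * s\<^sup>2 / 2) * E"
  proof (rule tendsto_lowerbound)
    have "(\<lambda>n. exp (l\<^sup>2 * s\<^sup>2 / 2 + K * sqrt (1 / real n)) * E) \<longlonglongrightarrow> exp (l\<^sup>2 * s\<^sup>2 / 2 + K * sqrt 0) * E"
      by (intro tendsto_intros lim_1_over_n)
    then show "(\<lambda>n. exp (l\<^sup>2 * s\<^sup>2 / 2 + K * sqrt (1 / real n)) * E) \<longlonglongrightarrow> exp (l\<^sup>2 * s\<^sup>2 / 2) * E" by simp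
    show "\<forall>\<^sub>F n in sequentially. A \<le> exp (l\<^sup>2 * s\<^sup>2 / 2 + K * sqrt (1 / real n)) * E"
      using eventually_gt_at_top[of 0] by eventually_elim (rule fin)
  qed simp
  then show ?thesis unfolding A_def E_def by (simp add: exp_add mult.commute)
qed

end

section \<open>From the softmax to the maximum and its two deviation bounds\<close>

context gaussian_vector
begin

definition Mx :: "'a \<Rightarrow> real" where "Mx \<omega> = Max ((\<lambda>i. X i \<omega>) ` I)"

lemma Mx_meas[measurable]: "Mx \<in> borel_measurable M"
  unfolding Mx_def using finI by measurable

lemma Mx_ge: "i \<in> I \<Longrightarrow> X i \<omega> \<le> Mx \<omega>"
  unfolding Mx_def using finI by auto

lemma Mx_in: "\<exists>i\<in>I. Mx \<omega> = X i \<omega>"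
proof -
  have "Mx \<omega> \<in> (\<lambda>i. X i \<omega>) ` I" unfolding Mx_def using finI neI by (intro Max_in) auto
  then show ?thesis by auto
qed

lemma Mx_bound: "\<bar>Mx \<omega>\<bar> \<le> S \<omega>"
proof -
  obtain i where "i \<in> I" "Mx \<omega> = X i \<omega>" using Mx_in by blast
  moreover have "\<bar>X i \<omega>\<bar> \<le> S \<omega>" if "i \<in> I" for i unfolding S_def using finI that by (intro member_le_sum) auto
  ultimately show ?thesis by auto
qed

lemma Mx_integrable: "integrable M Mx"
proof (rule integrable_of_exp_bound[where C=1 and l=1])
  show "\<bar>Mx \<omega>\<bar> \<le> 1 * exp (1 * S \<omega>)" for \<omega>
    using Mx_bound[of \<omega>] S_le_exp(1)[of \<omega>] by simp
qed simp

lemma Mx_exp_integrable: "integrable M (\<lambda>\<omega>. exp (l * Mx \<omega>))"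
proof (rule integrable_of_exp_bound[where C=1 and l="\<bar>l\<bar>"])
  fix \<omega>
  have "l * Mx \<omega> \<le> \<bar>l\<bar> * \<bar>Mx \<omega>\<bar>" by (metis abs_ge_self abs_mult)
  also have "\<dots> \<le> \<bar>l\<bar> * S \<omega>" by (intro mult_left_mono Mx_bound) auto
  finally show "\<bar>exp (l * Mx \<omega>)\<bar> \<le> 1 * exp (\<bar>l\<bar> * S \<omega>)" by simp
qed simp

text \<open>The softmax bound carries over with an error of order \<open>ln (card I) / b\<close>,
  and \<open>b\<close> tends to infinity. Negative \<open>l\<close> is included because the lower
  deviation bound is what controls the mean later.\<close>

theorem max_mgf: "expectation (\<lambda>\<omega>. exp (l * Mx \<omega>)) \<le> exp (l * expectation Mx + l\<^sup>2 * s\<^sup>2 / 2)"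
proof (rule tendsto_lowerbound)
  let ?B = "\<lambda>b. exp (l * expectation Mx + l\<^sup>2 * s\<^sup>2 / 2 + \<bar>l\<bar> * (ln (card I) / b))"
  have "((\<lambda>b. ln (card I) / b) \<longlongrightarrow> 0) at_top" by real_asymp
  then have "(?B \<longlongrightarrow> exp (l * expectation Mx + l\<^sup>2 * s\<^sup>2 / 2 + \<bar>l\<bar> * 0)) at_top"
    by (intro tendsto_intros)
  then show "(?B \<longlongrightarrow> exp (l * expectation Mx + l\<^sup>2 * s\<^sup>2 / 2)) at_top" by simp
  show "\<forall>\<^sub>F b in at_top. expectation (\<lambda>\<omega>. exp (l * Mx \<omega>)) \<le> ?B b"
    using eventually_gt_at_top[of 0]
  proof eventually_elim
    fix b :: real assume b: "0 < b"
    let ?F = "\<lambda>\<omega>. softmax I b (\<lambda>i. X i \<omega>)"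
    define c where "c = ln (card I) / b"
    have c0: "0 \<le> c" unfolding c_def using b finI neI by (simp add: Suc_leI card_gt_0_iff)
    have lo: "Mx \<omega> \<le> ?F \<omega>" for \<omega> using Mx_in[of \<omega>] softmax_ge[OF finI neI b, of _ "\<lambda>i. X i \<omega>"] by force
    have hi: "?F \<omega> \<le> Mx \<omega> + c" for \<omega> unfolding c_def by (rule softmax_le[OF finI neI b Mx_ge])
    have iF: "integrable M ?F" "integrable M (\<lambda>\<omega>. exp (l * ?F \<omega>))" for l
      using exp_growth_integrable[OF softmax_exp_growth(1)[OF b], of 1] exp_growth_integrable[OF softmax_exp_growth(2)[OF b], of l 1] by auto
    have e: "expectation Mx \<le> expectation ?F" "expectation ?F \<le> expectation Mx + c"
    proof -
      show "expectation Mx \<le> expectation ?F" using lo Mx_integrable iF by (intro integral_mono) auto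
      have "expectation ?F \<le> expectation (\<lambda>\<omega>. Mx \<omega> + c)" using hi Mx_integrable iF by (intro integral_mono) auto
      then show "expectation ?F \<le> expectation Mx + c" using Mx_integrable by (simp add: prob_space)
    qed
    have "expectation (\<lambda>\<omega>. exp (l * Mx \<omega>)) \<le> exp (l * expectation Mx + l\<^sup>2 * s\<^sup>2 / 2 + \<bar>l\<bar> * c)" (is "?E \<le> ?C")
    proof (cases "0 \<le> l")
      case True
      have "?E \<le> expectation (\<lambda>\<omega>. exp (l * ?F \<omega>))"
        using lo True by (intro integral_mono Mx_exp_integrable iF) (auto intro: mult_left_mono)
      also have "\<dots> \<le> exp (l * expectation ?F + l\<^sup>2 * s\<^sup>2 / 2)" by (rule softmax_mgf[OF b])
      also have "\<dots> \<le> ?C"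
        using mult_left_mono[OF e(2) True] True by (simp add: algebra_simps)
      finally show "?E \<le> ?C" .
    next
      case False
      then have l: "l \<le> 0" by simp
      have "?E \<le> expectation (\<lambda>\<omega>. exp (\<bar>l\<bar> * c) * exp (l * ?F \<omega>))"
      proof (intro integral_mono Mx_exp_integrable integrable_mult_right iF)
        fix \<omega>
        have "l * (Mx \<omega> + c) \<le> l * ?F \<omega>" using hi l by (intro mult_left_mono_neg) auto
        then show "exp (l * Mx \<omega>) \<le> exp (\<bar>l\<bar> * c) * exp (l * ?F \<omega>)"
          using l by (simp add: mult_exp_exp algebra_simps)
      qed
      also have "\<dots> = exp (\<bar>l\<bar> * c) * expectation (\<lambda>\<omega>. exp (l * ?F \<omega>))" by simp
      also have "\<dots> \<le> exp (\<bar>l\<bar> * c) * exp (l * expectation ?F + l\<^sup>2 * s\<^sup>2 / 2)"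
        using softmax_mgf[OF b, of l] by (intro mult_left_mono) auto
      also have "\<dots> \<le> ?C"
        using mult_left_mono_neg[OF e(1) l] by (simp add: mult_exp_exp)
      finally show "?E \<le> ?C" .
    qed
    then show "?E \<le> ?B b" unfolding c_def .
  qed
qed simp

text \<open>Markov's inequality for both tails at once: it is applied with \<open>l\<close> and
  \<open>v\<close> nonnegative for the upper tail and both nonpositive for the lower.\<close>

lemma max_chernoff:
  assumes A: "A \<in> events" "\<And>\<omega>. \<omega> \<in> A \<Longrightarrow> l * (expectation Mx + v) \<le> l * Mx \<omega>"
  shows "prob A \<le> exp (l\<^sup>2 * s\<^sup>2 / 2 - l * v)"
proof -
  have "prob A = expectation (indicator A)" using A by simp
  also have "\<dots> \<le> expectation (\<lambda>\<omega>. exp (- l * (expectation Mx + v)) * exp (l * Mx \<omega>))"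
  proof (rule integral_mono)
    show "integrable M (\<lambda>\<omega>. exp (- l * (expectation Mx + v)) * exp (l * Mx \<omega>))" using Mx_exp_integrable by simp
    show "indicator A \<omega> \<le> exp (- l * (expectation Mx + v)) * exp (l * Mx \<omega>)" for \<omega>
      using A(2)[of \<omega>] unfolding mult_exp_exp by (auto simp: indicator_def)
  qed (use A in \<open>auto simp: emeasure_eq_measure\<close>)
  also have "\<dots> = exp (- l * (expectation Mx + v)) * expectation (\<lambda>\<omega>. exp (l * Mx \<omega>))" by simp
  also have "\<dots> \<le> exp (- l * (expectation Mx + v)) * exp (l * expectation Mx + l\<^sup>2 * s\<^sup>2 / 2)"
    using max_mgf by (intro mult_left_mono) auto
  finally show ?thesis by (simp add: mult_exp_exp algebra_simps)
qed

lemma max_tail: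
  assumes s: "0 < s" and v: "0 \<le> v"
  shows "prob {\<omega> \<in> space M. expectation Mx + v < Mx \<omega>} \<le> exp (- v\<^sup>2 / (2 * s\<^sup>2))"
    "prob {\<omega> \<in> space M. Mx \<omega> \<le> expectation Mx - v} \<le> exp (- v\<^sup>2 / (2 * s\<^sup>2))"
proof -
  \<comment> \<open>The exponent \<open>l^2 * s^2 / 2 - l * v\<close> is least at
    \<open>l = v / s^2\<close>.\<close>
  have e: "(v / s\<^sup>2)\<^sup>2 * s\<^sup>2 / 2 - v / s\<^sup>2 * v = - v\<^sup>2 / (2 * s\<^sup>2)"
    using s by (simp add: field_simps power2_eq_square)
  have "prob {\<omega> \<in> space M. expectation Mx + v < Mx \<omega>} \<le> exp ((v / s\<^sup>2)\<^sup>2 * s\<^sup>2 / 2 - v / s\<^sup>2 * v)"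
    by (rule max_chernoff, measurable) (use v in \<open>auto intro!: mult_left_mono divide_right_mono\<close>)
  then show "prob {\<omega> \<in> space M. expectation Mx + v < Mx \<omega>} \<le> exp (- v\<^sup>2 / (2 * s\<^sup>2))" unfolding e .
  have "prob {\<omega> \<in> space M. Mx \<omega> \<le> expectation Mx - v} \<le> exp ((- (v / s\<^sup>2))\<^sup>2 * s\<^sup>2 / 2 - (- (v / s\<^sup>2)) * (- v))"
    by (rule max_chernoff, measurable) (use v in \<open>auto intro!: mult_left_mono divide_right_mono\<close>)
  then show "prob {\<omega> \<in> space M. Mx \<omega> \<le> expectation Mx - v} \<le> exp (- v\<^sup>2 / (2 * s\<^sup>2))" using e by simp
qed

end

text \<open>One \<open>m\<close> serves every \<open>J\<close> and \<open>s\<close>: it bounds the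
  mean of the maximum over any finite set of rational times, and that bound uses only the variance
  bound 1.\<close>

theorem Borell_TIS:
  fixes X :: "real \<Rightarrow> 'a \<Rightarrow> real"
  assumes gp: "centered_gaussian_process M X"
    and bdd: "AE \<omega> in M. bounded ((\<lambda>t. X t \<omega>) ` {0..})"
    and le1: "\<And>t. 0 \<le> t \<Longrightarrow> sdev M X t \<le> 1"
  shows "\<exists>m\<ge>0. \<forall>J s u. J \<subseteq> \<rat> \<inter> {0..} \<and> 0 < s \<and> (\<forall>t\<in>J. sdev M X t \<le> s) \<and> m \<le> u \<longrightarrow>
    measure M {\<omega> \<in> space M. \<exists>t\<in>J. u < X t \<omega>} \<le> exp (- (u - m)\<^sup>2 / (2 * s\<^sup>2))"
proof -
  interpret prob_space M using gp by (simp add: centered_gaussian_process_def)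
  have [measurable]: "X t \<in> borel_measurable M" if "0 \<le> t" for t
    using gp that by (simp add: centered_gaussian_process_def)
  let ?Q = "\<rat> \<inter> {0..} :: real set"
  have cQ: "countable ?Q" by (simp add: countable_rat)
  define E where "E N = {\<omega> \<in> space M. \<forall>t\<in>?Q. X t \<omega> \<le> real N}" for N :: nat
  have Em: "E N \<in> events" for N
    unfolding E_def using cQ by (intro sets.sets_Collect_countable_All') auto
  have "(\<lambda>N. prob (E N)) \<longlonglongrightarrow> prob (\<Union>N. E N)"
    using Em by (intro finite_Lim_measure_incseq) (auto simp: incseq_def E_def intro: order_trans)
  moreover have "prob (\<Union>N. E N) = 1"
  proof (rule prob_eq_1[THEN iffD2])
    show "(\<Union>N. E N) \<in> events" using Em by auto
    show "AE \<omega> in M. \<omega> \<in> (\<Union>N. E N)"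
      using bdd AE_space
    proof eventually_elim
      case (elim \<omega>)
      then obtain B where B: "\<And>t. 0 \<le> t \<Longrightarrow> \<bar>X t \<omega>\<bar> \<le> B" by (auto simp: bounded_iff)
      obtain N where "B \<le> real N" using real_arch_simple by blast
      then have "\<omega> \<in> E N" unfolding E_def using B elim by (force intro: order_trans abs_ge_self)
      then show ?case by auto
    qed
  qed
  ultimately have "\<forall>\<^sub>F N in sequentially. prob (E N) > 1/2"
    by (intro order_tendstoD(1)[where y="1::real"]) auto
  then obtain N where N: "prob (E N) > 1/2" by (meson eventually_happens trivial_limit_sequentially)
  \<comment> \<open>If the mean exceeded \<open>N + 2\<close>, the event \<open>E N\<close> would
    lie at least 2 below the mean and have probability at most
    \<open>exp (-2) < 1/2\<close>.\<close>
  define m where "m = real N + 2"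
  have fin: "prob {\<omega> \<in> space M. \<exists>t\<in>J. u < X t \<omega>} \<le> exp (- (u - m)\<^sup>2 / (2 * s\<^sup>2))"
    if J: "finite J" "J \<subseteq> ?Q" and s: "0 < s" "\<And>t. t \<in> J \<Longrightarrow> sdev M X t \<le> s" and u: "m \<le> u" for J s u
  proof (cases "J = {}")
    case True
    then show ?thesis by simp
  next
    case False
    have var: "(\<integral>\<omega>. (X t \<omega>)\<^sup>2 \<partial>M) = (sdev M X t)\<^sup>2" if "t \<in> J" for t
      using sdev_eq[OF gp, of t] that J by auto
    have sd0: "0 \<le> sdev M X t" for t unfolding sdev_def by simp
    have loc: "gaussian_vector M J X s" if "0 < s" "\<And>t. t \<in> J \<Longrightarrow> sdev M X t \<le> s" for s
      using J False that centered_gaussian_process_sum[OF gp J(1)] sd0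
      by unfold_locales (auto simp: var intro: power_mono)
    \<comment> \<open>\<open>Mx\<close> does not depend on the variance bound: its mean is
      controlled with the bound 1, uniformly, and its tail with the given \<open>s\<close>.\<close>
    interpret G1: gaussian_vector M J X 1 by (rule loc) (use J le1 in auto)
    interpret G: gaussian_vector M J X s by (rule loc) (use s in auto)
    have le: "expectation G1.Mx \<le> m"
    proof (rule ccontr)
      assume "\<not> expectation G1.Mx \<le> m"
      then have gt: "m < expectation G1.Mx" by simp
      have "prob (E N) \<le> prob {\<omega> \<in> space M. G1.Mx \<omega> \<le> expectation G1.Mx - 2}"
      proof (rule finite_measure_mono)
        show "E N \<subseteq> {\<omega> \<in> space M. G1.Mx \<omega> \<le> expectation G1.Mx - 2}"
        proof
          fix \<omega> assume w: "\<omega> \<in> E N"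
          obtain t where "t \<in> J" "G1.Mx \<omega> = X t \<omega>" using G1.Mx_in by blast
          then have "G1.Mx \<omega> \<le> real N" using w J unfolding E_def by auto
          then show "\<omega> \<in> {\<omega> \<in> space M. G1.Mx \<omega> \<le> expectation G1.Mx - 2}"
            using w gt unfolding m_def E_def by auto
        qed
      qed measurable
      also have "\<dots> \<le> exp (- 2\<^sup>2 / (2 * 1\<^sup>2))" by (rule G1.max_tail(2)) auto
      also have "\<dots> = inverse (exp 2)" by (simp add: exp_minus)
      also have "\<dots> \<le> 1/2" using exp_ge_add_one_self[of "2::real"] by (simp add: field_simps)
      finally show False using N by simp
    qed
    have "prob {\<omega> \<in> space M. \<exists>t\<in>J. u < X t \<omega>} \<le> prob {\<omega> \<in> space M. expectation G.Mx + (u - m) < G.Mx \<omega>}"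
    proof (rule finite_measure_mono)
      show "{\<omega> \<in> space M. \<exists>t\<in>J. u < X t \<omega>} \<subseteq> {\<omega> \<in> space M. expectation G.Mx + (u - m) < G.Mx \<omega>}"
      proof safe
        fix \<omega> t assume "t \<in> J" "u < X t \<omega>"
        then show "expectation G.Mx + (u - m) < G.Mx \<omega>" using G.Mx_ge[of t \<omega>] le by linarith
      qed
    qed measurable
    also have "\<dots> \<le> exp (- (u - m)\<^sup>2 / (2 * s\<^sup>2))" by (rule G.max_tail(1)) (use s u in auto)
    finally show ?thesis .
  qed
  show ?thesis
  proof (intro exI[of _ m] conjI allI impI, goal_cases)
    case 1
    then show ?case unfolding m_def by simp
  next
    case (2 J s u)
    then have J: "J \<subseteq> ?Q" and s: "0 < s" "\<And>t. t \<in> J \<Longrightarrow> sdev M X t \<le> s" and u: "m \<le> u" by auto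
    have cJ: "countable J" using J cQ countable_subset by blast
    \<comment> \<open>Finite exhaustion of \<open>J\<close>; the intersection discards the arbitrary
      value of \<open>from_nat_into\<close> when \<open>J\<close> is empty.\<close>
    define J' where "J' n = (from_nat_into J ` {..<n}) \<inter> J" for n :: nat
    define A where "A n = {\<omega> \<in> space M. \<exists>t\<in>J' n. u < X t \<omega>}" for n
    have Am: "A n \<in> events" for n
      unfolding A_def using J by (intro sets.sets_Collect_finite_Ex) (auto simp: J'_def)
    have U: "{\<omega> \<in> space M. \<exists>t\<in>J. u < X t \<omega>} = (\<Union>n. A n)"
    proof -
      have "\<exists>n. t \<in> J' n" if "t \<in> J" for t
        unfolding J'_def using that from_nat_into_to_nat_on[OF cJ that]
        by (intro exI[of _ "Suc (to_nat_on J t)"]) (auto intro!: image_eqI[of _ _ "to_nat_on J t"])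
      then show ?thesis unfolding A_def by (auto simp: J'_def) blast+
    qed
    have "(\<lambda>n. prob (A n)) \<longlonglongrightarrow> prob (\<Union>n. A n)"
      using Am by (intro finite_Lim_measure_incseq) (force simp: incseq_def A_def J'_def)+
    then show ?case unfolding U
    proof (rule tendsto_upperbound)
      show "\<forall>\<^sub>F n in sequentially. prob (A n) \<le> exp (- (u - m)\<^sup>2 / (2 * s\<^sup>2))"
        unfolding A_def using J s u by (intro always_eventually allI fin) (auto simp: J'_def)
    qed simp
  qed
qed

section \<open>Suprema over a random horizon\<close>

text \<open>The witness is taken to the left of \<open>t\<close>, so that it does not leave the
  horizon \<open>[0, s]\<close>; at \<open>t = 0\<close> there is nothing to the left, but 0 is
  rational.\<close>

lemma continuous_path_rational_witness:
  fixes x :: "real \<Rightarrow> real"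
  assumes c: "continuous_on {0..} x" and t: "0 \<le> t" "t \<le> s" "u < x t"
  shows "\<exists>q\<in>\<rat> \<inter> {0..}. q \<le> s \<and> u < x q"
proof (cases "t = 0")
  case True
  then show ?thesis using t by (intro bexI[of _ 0]) auto
next
  case False
  then have t0: "0 < t" using t by simp
  obtain d where d: "d > 0" "\<And>t'. t' \<in> {0..} \<Longrightarrow> dist t' t < d \<Longrightarrow> dist (x t') (x t) < x t - u"
    using c t unfolding continuous_on_iff by (metis atLeast_iff diff_gt_0_iff_gt)
  obtain q where q: "q \<in> \<rat>" "max 0 (t - d) < q" "q < t"
    using Rats_dense_in_real[of "max 0 (t - d)" t] t0 d by auto
  have "dist (x q) (x t) < x t - u" by (rule d(2)) (use q in \<open>auto simp: dist_real_def\<close>)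
  then have "u < x q" by (auto simp: dist_real_def)
  then show ?thesis using q t by (intro bexI[of _ q]) auto
qed

locale gaussian_random_horizon = prob_space M for M :: "'a measure" +
  fixes X :: "real \<Rightarrow> 'a \<Rightarrow> real" and T :: "'a \<Rightarrow> real"
  assumes gp: "centered_gaussian_process M X"
    and paths: "AE \<omega> in M. continuous_on {0..} (\<lambda>t. X t \<omega>) \<and> bounded ((\<lambda>t. X t \<omega>) ` {0..})"
    and le1: "\<And>t. 0 \<le> t \<Longrightarrow> sdev M X t \<le> 1"
    and Tm[measurable]: "T \<in> borel_measurable M" and T0: "\<And>\<omega>. \<omega> \<in> space M \<Longrightarrow> 0 \<le> T \<omega>"
    and indep: "indep_set {T -` B \<inter> space M | B. B \<in> sets borel}
                  (sigma_sets (space M) {X t -` B \<inter> space M | t B. t \<ge> 0 \<and> B \<in> sets borel})"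
begin

lemma Xm[measurable]: "0 \<le> t \<Longrightarrow> X t \<in> borel_measurable M"
  using gp by (simp add: centered_gaussian_process_def)

text \<open>The event is closed, unlike the one in the tail hypothesis, so that the value at 0 is 1
  and the grid cells cover every value of \<open>T\<close>.\<close>

definition tailT :: "real \<Rightarrow> real" where "tailT z = prob {\<omega> \<in> space M. z \<le> T \<omega>}"

definition exceed :: "real set \<Rightarrow> real \<Rightarrow> 'a set" where
  "exceed J u = {\<omega> \<in> space M. \<exists>t\<in>J. u < X t \<omega>}"

lemma exceed_sigma: "J \<subseteq> {0..} \<Longrightarrow> countable J \<Longrightarrow>
  exceed J u \<in> sigma_sets (space M) {X t -` B \<inter> space M | t B. t \<ge> 0 \<and> B \<in> sets borel}"
proof -
  assume J: "J \<subseteq> {0..}" "countable J"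
  let ?G = "{X t -` B \<inter> space M | t B. t \<ge> 0 \<and> B \<in> sets borel}"
  have B: "X t -` {u<..} \<inter> space M \<in> sigma_sets (space M) ?G" if "t \<in> J" for t
  proof (rule sigma_sets.Basic)
    have "0 \<le> t" "{u<..} \<in> sets borel" using that J(1) by auto
    then show "X t -` {u<..} \<inter> space M \<in> ?G" by blast
  qed
  have "exceed J u = \<Union>((\<lambda>t. X t -` {u<..} \<inter> space M) ` J)" unfolding exceed_def by auto
  also have "\<dots> \<in> sigma_sets (space M) ?G"
    by (rule sigma_sets_UNION) (use B J(2) in \<open>auto simp only: countable_image image_iff\<close>)
  finally show ?thesis .
qed

lemma exceed_events: "J \<subseteq> {0..} \<Longrightarrow> countable J \<Longrightarrow> exceed J u \<in> events"
  unfolding exceed_def by (intro sets.sets_Collect_countable_Ex') auto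

lemma prob_tail_exceed:
  assumes "J \<subseteq> {0..}" "countable J"
  shows "prob ({\<omega> \<in> space M. z \<le> T \<omega>} \<inter> exceed J u) = tailT z * prob (exceed J u)"
  unfolding tailT_def
proof (rule indep_setD[OF indep _ exceed_sigma[OF assms]])
  show "{\<omega> \<in> space M. z \<le> T \<omega>} \<in> {T -` B \<inter> space M | B. B \<in> sets borel}"
    by (rule CollectI, rule exI[of _ "{z..}"]) auto
qed

text \<open>A countable and hence measurable version of the event in \<open>psiT\<close>, with the
  horizon condition cleared of its denominator.\<close>

definition overshoot :: "real \<Rightarrow> real \<Rightarrow> 'a set" where
  "overshoot v u = {\<omega> \<in> space M. \<exists>q\<in>\<rat> \<inter> {0..}. q * v \<le> T \<omega> \<and> u < X q \<omega>}"

lemma overshoot_events[measurable]: "overshoot v u \<in> events"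
  unfolding overshoot_def by (intro sets.sets_Collect_countable_Ex') (auto simp: countable_rat)

text \<open>Off the null set of irregular paths the supremum exceeds \<open>u\<close> exactly when
  some rational time within the horizon does; completion takes care of the rest.\<close>

lemma psiT_eq:
  assumes u: "u > 0"
  shows "psiT M X T \<gamma> u = prob (overshoot (u powr \<gamma>) u)"
proof -
  define v where "v = u powr \<gamma>"
  have v: "v > 0" unfolding v_def using u by simp
  define A where "A = {\<omega> \<in> space M. (SUP t\<in>{0..T \<omega> / v}. X t \<omega>) > u}"
  have "AE \<omega> in M. \<omega> \<in> A \<longleftrightarrow> \<omega> \<in> overshoot v u"
    using paths AE_space
  proof eventually_elim
    case (elim \<omega>)
    then have c: "continuous_on {0..} (\<lambda>t. X t \<omega>)" and b: "bounded ((\<lambda>t. X t \<omega>) ` {0..})" and w: "\<omega> \<in> space M" by auto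
    have T: "0 \<le> T \<omega> / v" using T0[OF w] v by simp
    have "bdd_above ((\<lambda>t. X t \<omega>) ` {0..T \<omega> / v})"
      using bounded_imp_bdd_above[OF b] by (rule bdd_above_mono) auto
    then have "(SUP t\<in>{0..T \<omega> / v}. X t \<omega>) > u \<longleftrightarrow> (\<exists>t\<in>{0..T \<omega> / v}. u < X t \<omega>)"
      using T by (intro less_cSUP_iff) auto
    also have "\<dots> \<longleftrightarrow> (\<exists>q\<in>\<rat> \<inter> {0..}. q \<le> T \<omega> / v \<and> u < X q \<omega>)"
      using continuous_path_rational_witness[OF c] by fastforce
    also have "\<dots> \<longleftrightarrow> (\<exists>q\<in>\<rat> \<inter> {0..}. q * v \<le> T \<omega> \<and> u < X q \<omega>)"
      using v by (simp add: pos_le_divide_eq)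
    finally show ?case unfolding A_def overshoot_def using w by simp
  qed
  then obtain N where N: "N \<in> null_sets M" "{\<omega> \<in> space M. \<not> (\<omega> \<in> A \<longleftrightarrow> \<omega> \<in> overshoot v u)} \<subseteq> N"
    by (auto simp: eventually_ae_filter)
  have sub: "A \<subseteq> space M" "overshoot v u \<subseteq> space M" unfolding A_def overshoot_def by auto
  \<comment> \<open>Outside \<open>N\<close> the event coincides with a measurable set, and its part
    inside \<open>N\<close> is a subset of a null set.\<close>
  have AN: "A = (overshoot v u - N) \<union> (A \<inter> N)" using N(2) sub by auto
  have Am: "A \<in> sets (completion M)"
    by (rule sets_completionI[OF AN _ N(1)]) (use N(1) in auto)
  have "emeasure (completion M) A = emeasure (completion M) (overshoot v u)"
  proof (rule emeasure_eq_AE[OF _ Am])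
    show "AE x in completion M. x \<in> A \<longleftrightarrow> x \<in> overshoot v u"
      using \<open>AE \<omega> in M. \<omega> \<in> A \<longleftrightarrow> \<omega> \<in> overshoot v u\<close> by (rule AE_completion)
  qed simp
  then have "measure (completion M) A = prob (overshoot v u)"
    unfolding measure_def by simp
  then show ?thesis unfolding psiT_def A_def v_def .
qed

lemma psiT_lower:
  assumes u: "u > 0" and t: "0 \<le> t" and pos: "0 < sdev M X t"
  shows "tailT (t * u powr \<gamma>) * exp (- 2 - (u + 1)\<^sup>2 / (2 * (sdev M X t)\<^sup>2)) \<le> psiT M X T \<gamma> u"
proof -
  define v where "v = u powr \<gamma>"
  have v: "v > 0" unfolding v_def using u by simp
  have "exp (- 2 - (u + 1)\<^sup>2 / (2 * (sdev M X t)\<^sup>2)) \<le> normal_density 0 (sdev M X t) (u + 1)"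
  proof -
    \<comment> \<open>The normalising constant is at most \<open>sqrt 9 = 3 <= exp 2\<close>, which
      is the origin of the \<open>- 2\<close> in the exponent.\<close>
    have "2 * pi * (sdev M X t)\<^sup>2 \<le> 9 * 1"
      using pi_less_4 le1[OF t] pos by (intro mult_mono power_le_one) auto
    then have "sqrt (2 * pi * (sdev M X t)\<^sup>2) \<le> 3" by (intro real_le_lsqrt) auto
    also have "3 \<le> exp (2::real)" using exp_ge_add_one_self[of "2::real"] by simp
    finally have "inverse (exp 2) \<le> inverse (sqrt (2 * pi * (sdev M X t)\<^sup>2))"
      using pos by (intro le_imp_inverse_le) auto
    then have "exp (-2) * exp (- (u + 1)\<^sup>2 / (2 * (sdev M X t)\<^sup>2)) \<le> 1 / sqrt (2 * pi * (sdev M X t)\<^sup>2) * exp (- (u + 1)\<^sup>2 / (2 * (sdev M X t)\<^sup>2))"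
      by (intro mult_right_mono) (auto simp: exp_minus inverse_eq_divide)
    then show ?thesis unfolding normal_density_def by (simp add: mult_exp_exp)
  qed
  also have "\<dots> \<le> prob {\<omega> \<in> space M. X t \<omega> > u}"
    by (rule centered_normal_tail_ge[OF centered_gaussian_process_single[OF gp t]])
      (use sdev_eq[OF gp t] pos u in auto)
  also have "{\<omega> \<in> space M. X t \<omega> > u} = exceed {t} u" unfolding exceed_def by auto
  finally have "tailT (t * v) * exp (- 2 - (u + 1)\<^sup>2 / (2 * (sdev M X t)\<^sup>2)) \<le> tailT (t * v) * prob (exceed {t} u)"
    by (intro mult_left_mono) (auto simp: tailT_def)
  also have "\<dots> = prob ({\<omega> \<in> space M. t * v \<le> T \<omega>} \<inter> exceed {t} u)"
    using t by (subst prob_tail_exceed) auto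
  \<comment> \<open>The time \<open>t\<close> need not be rational; continuity supplies a rational
    one that is no later.\<close>
  also have "\<dots> \<le> prob (overshoot v u)"
  proof (rule finite_measure_mono_AE)
    show "AE \<omega> in M. \<omega> \<in> {\<omega> \<in> space M. t * v \<le> T \<omega>} \<inter> exceed {t} u \<longrightarrow> \<omega> \<in> overshoot v u"
      using paths
    proof eventually_elim
      case (elim \<omega>)
      show ?case
      proof
        assume w: "\<omega> \<in> {\<omega> \<in> space M. t * v \<le> T \<omega>} \<inter> exceed {t} u"
        then have "\<exists>q\<in>\<rat> \<inter> {0..}. q \<le> t \<and> u < X q \<omega>"
          using elim t by (intro continuous_path_rational_witness[where t=t]) (auto simp: exceed_def)
        then obtain q where q: "q \<in> \<rat> \<inter> {0..}" "q \<le> t" "u < X q \<omega>" by blast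
        have "q * v \<le> t * v" using q v by simp
        then show "\<omega> \<in> overshoot v u" unfolding overshoot_def using w q by (auto intro!: bexI[of _ q])
      qed
    qed
  qed simp
  finally show ?thesis unfolding psiT_eq[OF u] v_def .
qed

text \<open>Each cell combines the horizon at its left end with the standard deviation up to its
  right end; beyond the last point only the global bound 1 is used. Since \<open>m\<close> precedes
  the grid, the grid may depend on \<open>u\<close>.\<close>

lemma psiT_upper:
  "\<exists>m\<ge>0. \<forall>u \<gamma> n s c. u > 0 \<and> m \<le> u \<and> s 0 = 0 \<and> (\<forall>k<n. 0 < c k \<and> (\<forall>t. 0 \<le> t \<and> t \<le> s (Suc k) \<longrightarrow> sdev M X t \<le> c k)) \<longrightarrow>
    psiT M X T \<gamma> u \<le> (\<Sum>k<n. tailT (s k * u powr \<gamma>) * exp (- (u - m)\<^sup>2 / (2 * (c k)\<^sup>2))) + tailT (s n * u powr \<gamma>) * exp (- (u - m)\<^sup>2 / 2)"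
proof -
  have "AE \<omega> in M. bounded ((\<lambda>t. X t \<omega>) ` {0..})" using paths by eventually_elim auto
  from Borell_TIS[OF gp this le1] obtain m where m: "m \<ge> 0"
    and B: "\<And>J s u. J \<subseteq> \<rat> \<inter> {0..} \<Longrightarrow> 0 < s \<Longrightarrow> (\<forall>t\<in>J. sdev M X t \<le> s) \<Longrightarrow> m \<le> u \<Longrightarrow>
      prob (exceed J u) \<le> exp (- (u - m)\<^sup>2 / (2 * s\<^sup>2))"
    unfolding exceed_def by auto
  show ?thesis
  proof (intro exI[of _ m] conjI allI impI m, elim conjE)
    fix u \<gamma> :: real and n :: nat and s c :: "nat \<Rightarrow> real"
    assume u: "u > 0" "m \<le> u" and s0: "s 0 = 0"
      and c: "\<forall>k<n. 0 < c k \<and> (\<forall>t. 0 \<le> t \<and> t \<le> s (Suc k) \<longrightarrow> sdev M X t \<le> c k)"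
    define v where "v = u powr \<gamma>"
    have v: "v > 0" unfolding v_def using u by simp
    define J where "J k = {q \<in> \<rat> \<inter> {0..}. q \<le> s (Suc k)}" for k
    let ?Q = "\<rat> \<inter> {0..} :: real set"
    define A where "A k = {\<omega> \<in> space M. s k * v \<le> T \<omega>}" for k
    have cJ: "countable (J k)" "J k \<subseteq> {0..}" "countable ?Q" "?Q \<subseteq> {0..}" for k
      unfolding J_def by (auto intro: countable_subset[OF _ countable_rat])
    have Am: "A k \<in> events" for k unfolding A_def by measurable
    note ev = exceed_events[OF cJ(2,1)] exceed_events[OF cJ(4,3)]
    have "overshoot v u \<subseteq> (\<Union>k<n. A k \<inter> exceed (J k) u) \<union> (A n \<inter> exceed ?Q u)"
    proof
      fix \<omega> assume "\<omega> \<in> overshoot v u"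
      then obtain q where w: "\<omega> \<in> space M" and q: "q \<in> ?Q" "q * v \<le> T \<omega>" "u < X q \<omega>" unfolding overshoot_def by auto
      show "\<omega> \<in> (\<Union>k<n. A k \<inter> exceed (J k) u) \<union> (A n \<inter> exceed ?Q u)"
      proof (cases "s n * v \<le> T \<omega>")
        case True
        then have "\<omega> \<in> A n \<inter> exceed ?Q u" using w q unfolding A_def exceed_def by blast
        then show ?thesis by blast
      next
        case False
        \<comment> \<open>The first grid point beyond \<open>T / v\<close>; its predecessor indexes
          the cell. The sequence \<open>s\<close> is not assumed monotone, and minimality is what
          places \<open>T / v\<close> at or above the predecessor.\<close>
        define j where "j = (LEAST j. T \<omega> < s j * v)"
        have j: "T \<omega> < s j * v" unfolding j_def by (rule LeastI[of _ n]) (use False in simp)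
        have jn: "j \<le> n" unfolding j_def by (rule Least_le) (use False in simp)
        have "j \<noteq> 0" using j s0 T0[OF w] by (cases "j = 0") auto
        then obtain k where k: "j = Suc k" by (cases j) auto
        have "k < j" using k by simp
        then have "\<not> T \<omega> < s k * v" unfolding j_def by (rule not_less_Least)
        then have "\<omega> \<in> A k" unfolding A_def using w by auto
        moreover have "q * v < s (Suc k) * v" using q(2) j unfolding k by linarith
        then have "q \<in> J k" unfolding J_def using q v by (simp add: mult_less_cancel_right)
        then have "\<omega> \<in> exceed (J k) u" unfolding exceed_def using w q by blast
        ultimately show ?thesis using \<open>k < j\<close> jn by (meson IntI UN_I UnI1 lessThan_iff order_less_le_trans)
      qed
    qed
    then have "prob (overshoot v u) \<le> prob ((\<Union>k<n. A k \<inter> exceed (J k) u) \<union> (A n \<inter> exceed ?Q u))"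
      using Am ev by (intro finite_measure_mono) auto
    also have "\<dots> \<le> prob (\<Union>k<n. A k \<inter> exceed (J k) u) + prob (A n \<inter> exceed ?Q u)"
      using Am ev by (intro measure_Un_le) auto
    also have "prob (\<Union>k<n. A k \<inter> exceed (J k) u) \<le> (\<Sum>k<n. prob (A k \<inter> exceed (J k) u))"
      using Am ev by (intro measure_UNION_le) auto
    also have "\<dots> = (\<Sum>k<n. tailT (s k * v) * prob (exceed (J k) u))"
      unfolding A_def using prob_tail_exceed[OF cJ(2,1)] by simp
    also have "\<dots> \<le> (\<Sum>k<n. tailT (s k * v) * exp (- (u - m)\<^sup>2 / (2 * (c k)\<^sup>2)))"
      using c u by (intro sum_mono mult_left_mono B) (auto simp: J_def tailT_def)
    also have "prob (A n \<inter> exceed ?Q u) = tailT (s n * v) * prob (exceed ?Q u)"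
      unfolding A_def by (rule prob_tail_exceed[OF cJ(4,3)])
    also have "\<dots> \<le> tailT (s n * v) * exp (- (u - m)\<^sup>2 / (2 * 1\<^sup>2))"
      using u le1 by (intro mult_left_mono B) (auto simp: tailT_def)
    finally show "psiT M X T \<gamma> u \<le> (\<Sum>k<n. tailT (s k * u powr \<gamma>) * exp (- (u - m)\<^sup>2 / (2 * (c k)\<^sup>2))) + tailT (s n * u powr \<gamma>) * exp (- (u - m)\<^sup>2 / 2)"
      unfolding psiT_eq[OF u(1)] v_def by simp
  qed
qed

end

section \<open>Logarithmic asymptotics\<close>

text \<open>The lower bound also makes \<open>\<psi>\<close> eventually positive, so that
  \<open>ln\<close> has its usual meaning.\<close>

lemma log_ratio_tendsto:
  fixes w \<psi> :: "real \<Rightarrow> real"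
  assumes lo: "\<And>e. e > 0 \<Longrightarrow> \<forall>\<^sub>F u in at_top. exp (- (c + e) * w u) \<le> \<psi> u"
    and up: "\<And>e. e > 0 \<Longrightarrow> \<forall>\<^sub>F u in at_top. \<psi> u \<le> exp (- (c - e) * w u)"
    and w: "\<forall>\<^sub>F u in at_top. 0 < w u"
  shows "((\<lambda>u. ln (\<psi> u) / w u) \<longlongrightarrow> - c) at_top"
proof (rule tendstoI)
  fix e :: real assume e: "0 < e"
  then have e2: "e / 2 > 0" by simp
  show "\<forall>\<^sub>F u in at_top. dist (ln (\<psi> u) / w u) (- c) < e"
    using lo[OF e2] up[OF e2] w
  proof eventually_elim
    case (elim u)
    have pos: "0 < \<psi> u" using elim(1) by (meson exp_gt_zero order_less_le_trans)
    have "ln (\<psi> u) \<ge> - (c + e/2) * w u" using elim(1) pos by (metis ln_exp ln_le_cancel_iff exp_gt_zero)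
    then have 1: "- (c + e/2) \<le> ln (\<psi> u) / w u" using elim(3) by (simp add: pos_le_divide_eq)
    have "ln (\<psi> u) \<le> - (c - e/2) * w u" using elim(2) pos by (metis ln_exp ln_le_cancel_iff exp_gt_zero)
    then have "ln (\<psi> u) / w u \<le> - (c - e/2)" using elim(3) by (simp add: pos_divide_le_eq)
    with 1 show ?case using e by (simp add: dist_real_def abs_less_iff)
  qed
qed

text \<open>Finitely many terms cost only the factor \<open>Suc n\<close>, which is eventually below
  \<open>exp (e * w u)\<close>.\<close>

lemma sum_exp_decay:
  fixes w :: "real \<Rightarrow> real" and f :: "nat \<Rightarrow> real \<Rightarrow> real"
  assumes w: "filterlim w at_top at_top" and e: "0 < e"
    and f: "\<And>k. k \<le> n \<Longrightarrow> \<forall>\<^sub>F u in at_top. f k u \<le> exp (- c * w u)"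
  shows "\<forall>\<^sub>F u in at_top. (\<Sum>k\<le>n. f k u) \<le> exp (- (c - e) * w u)"
proof -
  have "\<forall>\<^sub>F u in at_top. \<forall>k\<in>{..n}. f k u \<le> exp (- c * w u)"
    using f by (intro eventually_ball_finite) auto
  moreover have "\<forall>\<^sub>F u in at_top. ln (real (Suc n)) / e \<le> w u"
    using w by (simp add: filterlim_at_top)
  ultimately show ?thesis
  proof eventually_elim
    case (elim u)
    have "(\<Sum>k\<le>n. f k u) \<le> real (Suc n) * exp (- c * w u)"
      using elim(1) sum_bounded_above[of "{..n}" "\<lambda>k. f k u" "exp (- c * w u)"] by simp
    also have "real (Suc n) \<le> exp (e * w u)"
    proof -
      have "ln (real (Suc n)) \<le> e * w u" using elim(2) e by (simp add: field_simps)
      then show ?thesis by (metis exp_le_cancel_iff exp_ln of_nat_0_less_iff zero_less_Suc)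
    qed
    then have "real (Suc n) * exp (- c * w u) \<le> exp (e * w u) * exp (- c * w u)" by (intro mult_right_mono) auto
    finally show ?case by (simp add: mult_exp_exp algebra_simps)
  qed
qed

text \<open>The upper bound pairs the horizon at a left end with the deviation at a right end;
  uniform continuity makes the resulting loss at most \<open>e\<close> in every cell.\<close>

lemma powr_grid:
  fixes K p L e :: real
  assumes K: "0 \<le> K" and p: "0 < p" and e: "0 < e"
  shows "\<exists>n>0. \<forall>k<n. L * (K * real (Suc k) / real n) powr p \<le> L * (K * real k / real n) powr p + e"
proof -
  have "continuous_on {0..K} (\<lambda>x. L * x powr p)"
    using p by (intro continuous_intros continuous_on_powr') auto
  then have "uniformly_continuous_on {0..K} (\<lambda>x. L * x powr p)"
    by (rule compact_uniformly_continuous) simp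
  then obtain d where d: "d > 0" "\<And>x y. x \<in> {0..K} \<Longrightarrow> y \<in> {0..K} \<Longrightarrow> dist y x < d \<Longrightarrow> dist (L * y powr p) (L * x powr p) < e"
    unfolding uniformly_continuous_on_def using e by metis
  obtain n :: nat where n: "K / d < real n" using reals_Archimedean2 by blast
  then have n0: "n > 0" using K d by (cases n) (auto simp: divide_less_0_iff)
  have "K / real n < d" using n n0 d by (simp add: field_simps)
  show ?thesis
  proof (intro exI[of _ n] conjI allI impI n0)
    fix k assume k: "k < n"
    have r: "K * real (Suc k) / real n \<in> {0..K}" "K * real k / real n \<in> {0..K}"
      using K k n0 by (auto simp: pos_divide_le_eq intro!: mult_left_mono simp del: of_nat_Suc)
    have "dist (K * real (Suc k) / real n) (K * real k / real n) < d"
      using \<open>K / real n < d\<close> K by (simp add: dist_real_def diff_divide_distrib[symmetric] algebra_simps)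
    from d(2)[OF r(2,1) this] show "L * (K * real (Suc k) / real n) powr p \<le> L * (K * real k / real n) powr p + e"
      by (simp add: dist_real_def)
  qed
qed

section \<open>Exponential bounds for a horizon with Weibull-type tail\<close>

locale gaussian_weibull_horizon = gaussian_random_horizon M X T
  for M :: "'a measure" and X :: "real \<Rightarrow> 'a \<Rightarrow> real" and T :: "'a \<Rightarrow> real" +
  fixes L p :: real
  assumes L: "L > 0" and p: "p > 0"
    and tail: "((\<lambda>u. ln (prob {\<omega> \<in> space M. T \<omega> > u}) / u powr p) \<longlongrightarrow> - L) at_top"
begin

lemma tailT_antimono: "y \<le> z \<Longrightarrow> tailT z \<le> tailT y"
  unfolding tailT_def by (rule finite_measure_mono) auto

lemma tailT_0: "tailT 0 = 1"
proof -
  have "{\<omega> \<in> space M. 0 \<le> T \<omega>} = space M" using T0 by auto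
  then show ?thesis unfolding tailT_def by (simp add: prob_space)
qed

lemma tailT_le_1: "tailT z \<le> 1" unfolding tailT_def by simp

lemma tailT_nonneg: "0 \<le> tailT z" unfolding tailT_def by simp

lemma tailT_upper:
  assumes x: "0 \<le> x" and e: "0 < e"
  shows "\<forall>\<^sub>F v in at_top. tailT (x * v) \<le> exp (- (L * x powr p - e) * v powr p)"
proof (cases "x = 0")
  case True
  \<comment> \<open>At \<open>x = 0\<close> the tail hypothesis is silent, but the claimed bound is
    at least 1.\<close>
  have "tailT 0 \<le> exp (e * v powr p)" for v
    using tailT_le_1[of 0] e by (simp add: order_trans[of _ 1])
  then show ?thesis using True by simp
next
  case False
  then have x0: "0 < x" using x by simp
  define L' where "L' = L - e / (2 * x powr p)"
  have xp: "0 < x powr p" using x0 by simp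
  have L'x: "L' * x powr p = L * x powr p - e / 2" unfolding L'_def using xp by (simp add: field_simps)
  have L'L: "- L < - L'" unfolding L'_def using e xp by simp
  \<comment> \<open>Passing from the closed event at \<open>x * v\<close> to the strict one at the
    smaller level \<open>r * x * v\<close> costs a factor \<open>r powr p\<close>, so
    \<open>r\<close> is taken close to 1.\<close>
  have "((\<lambda>r::real. L' * (r * x) powr p) \<longlongrightarrow> L' * (1 * x) powr p) (at_left 1)"
    using x0 by (intro tendsto_intros) auto
  then have "\<forall>\<^sub>F r in at_left 1. L * x powr p - e < L' * (r * x) powr p"
    by (rule order_tendstoD(1)) (use L'x e in simp)
  moreover have "\<forall>\<^sub>F r in at_left 1. 0 < r \<and> r < (1::real)"
    unfolding eventually_at_left_field by (intro exI[of _ 0]) auto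
  ultimately have "\<forall>\<^sub>F r in at_left 1. L * x powr p - e < L' * (r * x) powr p \<and> 0 < r \<and> r < 1"
    by (rule eventually_conj)
  then obtain r where r: "L * x powr p - e < L' * (r * x) powr p" "0 < r" "r < 1"
    by (metis (mono_tags, lifting) eventually_happens trivial_limit_at_left_real)
  have "\<forall>\<^sub>F z in at_top. ln (prob {\<omega> \<in> space M. T \<omega> > z}) / z powr p < - L'"
    by (rule order_tendstoD(2)[OF tail L'L])
  then have "\<forall>\<^sub>F z in at_top. prob {\<omega> \<in> space M. T \<omega> > z} \<le> exp (- L' * z powr p)"
    using eventually_gt_at_top[of 0]
  proof eventually_elim
    case (elim z)
    show ?case
    \<comment> \<open>When the probability is zero, \<open>ln 0 = 0\<close> carries no information,
      and the bound is trivial.\<close>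
    proof (cases "prob {\<omega> \<in> space M. T \<omega> > z} = 0")
      case True
      then show ?thesis by simp
    next
      case False
      then have pos: "0 < prob {\<omega> \<in> space M. T \<omega> > z}" by (simp add: zero_less_measure_iff)
      have "ln (prob {\<omega> \<in> space M. T \<omega> > z}) < - L' * z powr p"
        using elim by (simp add: pos_divide_less_eq)
      then have "exp (ln (prob {\<omega> \<in> space M. T \<omega> > z})) \<le> exp (- L' * z powr p)" by simp
      then show ?thesis using pos by simp
    qed
  qed
  moreover have "filterlim (\<lambda>v. r * x * v) at_top at_top"
    using r x0 by (intro filterlim_tendsto_pos_mult_at_top[OF tendsto_const]) (auto simp: filterlim_ident)
  ultimately have "\<forall>\<^sub>F v in at_top. prob {\<omega> \<in> space M. T \<omega> > r * x * v} \<le> exp (- L' * (r * x * v) powr p)"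
    by (rule eventually_compose_filterlim)
  then show ?thesis using eventually_gt_at_top[of 0]
  proof eventually_elim
    case (elim v)
    have "r * x * v < x * v" using r x0 elim by simp
    then have "tailT (x * v) \<le> prob {\<omega> \<in> space M. T \<omega> > r * x * v}"
      unfolding tailT_def by (intro finite_measure_mono) auto
    also have "\<dots> \<le> exp (- L' * (r * x * v) powr p)" by (rule elim(1))
    also have "\<dots> = exp (- (L' * (r * x) powr p) * v powr p)"
      using r x0 elim by (simp add: powr_mult)
    also have "\<dots> \<le> exp (- (L * x powr p - e) * v powr p)"
    proof -
      have "(L * x powr p - e) * v powr p \<le> (L' * (r * x) powr p) * v powr p"
        using r(1) by (intro mult_right_mono) auto
      then show ?thesis by (simp only: exp_le_cancel_iff mult_minus_left neg_le_iff_le)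
    qed
    finally show ?case .
  qed
qed

lemma tailT_lower:
  assumes x: "0 \<le> x" and e: "0 < e"
  shows "\<forall>\<^sub>F v in at_top. exp (- (L * x powr p + e) * v powr p) \<le> tailT (x * v)"
proof (cases "x = 0")
  case True
  then show ?thesis using e p by (simp add: tailT_0)
next
  case False
  then have x0: "0 < x" using x by simp
  have xp: "0 < x powr p" using x0 by simp
  have "\<forall>\<^sub>F z in at_top. - (L + e / x powr p) < ln (prob {\<omega> \<in> space M. T \<omega> > z}) / z powr p"
    by (rule order_tendstoD(1)[OF tail]) (use e xp in simp)
  \<comment> \<open>Since \<open>ln 0 = 0\<close>, an eventually negative ratio rules out zero
    probabilities.\<close>
  moreover have "\<forall>\<^sub>F z in at_top. ln (prob {\<omega> \<in> space M. T \<omega> > z}) / z powr p < 0"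
    by (rule order_tendstoD(2)[OF tail]) (use L in simp)
  ultimately have "\<forall>\<^sub>F z in at_top. exp (- (L + e / x powr p) * z powr p) \<le> prob {\<omega> \<in> space M. T \<omega> > z}"
    using eventually_gt_at_top[of 0]
  proof eventually_elim
    case (elim z)
    have "prob {\<omega> \<in> space M. T \<omega> > z} \<noteq> 0" using elim(2) by auto
    then have pos: "0 < prob {\<omega> \<in> space M. T \<omega> > z}" by (simp add: zero_less_measure_iff)
    have "- (L + e / x powr p) * z powr p < ln (prob {\<omega> \<in> space M. T \<omega> > z})"
      using elim(1,3) by (simp add: pos_less_divide_eq)
    then have "exp (- (L + e / x powr p) * z powr p) \<le> exp (ln (prob {\<omega> \<in> space M. T \<omega> > z}))" by simp
    then show ?case using pos by simp
  qed
  moreover have "filterlim (\<lambda>v. x * v) at_top at_top"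
    using x0 by (intro filterlim_tendsto_pos_mult_at_top[OF tendsto_const]) (auto simp: filterlim_ident)
  ultimately have "\<forall>\<^sub>F v in at_top. exp (- (L + e / x powr p) * (x * v) powr p) \<le> prob {\<omega> \<in> space M. T \<omega> > x * v}"
    by (rule eventually_compose_filterlim)
  then show ?thesis using eventually_gt_at_top[of 0]
  proof eventually_elim
    case (elim v)
    have "(L + e / x powr p) * (x * v) powr p = (L * x powr p + e) * v powr p"
      using x0 elim by (simp add: powr_mult field_simps)
    then have "exp (- (L * x powr p + e) * v powr p) \<le> prob {\<omega> \<in> space M. T \<omega> > x * v}"
      using elim(1) by (simp only: mult_minus_left)
    also have "\<dots> \<le> tailT (x * v)" unfolding tailT_def by (intro finite_measure_mono) auto
    finally show ?case .
  qed
qed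

text \<open>Eventual positivity extends to all arguments by antitonicity.\<close>

lemma tailT_pos: "0 < tailT z"
proof -
  have "\<forall>\<^sub>F v in at_top. exp (- (L * 1 powr p + 1) * v powr p) \<le> tailT (1 * v)"
    by (rule tailT_lower) auto
  then have "\<forall>\<^sub>F v in at_top. exp (- (L * 1 powr p + 1) * v powr p) \<le> tailT (1 * v) \<and> z \<le> v"
    using eventually_ge_at_top[of z] by (rule eventually_conj)
  from eventually_happens'[OF trivial_limit_at_top_linorder this]
  obtain v where "exp (- (L * 1 powr p + 1) * v powr p) \<le> tailT (1 * v)" "z \<le> v"
    by auto
  then have "exp (- (L * 1 powr p + 1) * v powr p) \<le> tailT z" using tailT_antimono[of z v] by simp
  then show ?thesis by (meson exp_gt_zero order_less_le_trans)
qed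

abbreviation "\<sigma> \<equiv> sdev M X"

text \<open>The time \<open>t\<close> is quantified inside the eventuality, so it may vary with
  \<open>u\<close>; the additive constants are absorbed into \<open>\<delta>\<close>.\<close>

lemma psiT_lower_eventually:
  assumes d: "0 < \<delta>"
  shows "\<forall>\<^sub>F u in at_top. \<forall>t. 0 \<le> t \<and> 0 < \<sigma> t \<longrightarrow>
    tailT (t * u powr \<gamma>) * exp (- ((1 + \<delta>) * u\<^sup>2 / (2 * (\<sigma> t)\<^sup>2))) \<le> psiT M X T \<gamma> u"
proof -
  \<comment> \<open>The 4 bounds \<open>4 * (\<sigma> t)^2\<close>, the constant 2 brought over the
    denominator \<open>2 * (\<sigma> t)^2\<close>.\<close>
  have "\<forall>\<^sub>F u in at_top. 4 + (u + 1)\<^sup>2 \<le> (1 + \<delta>) * u\<^sup>2" using d by real_asymp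
  then show ?thesis using eventually_gt_at_top[of 0]
  proof eventually_elim
    case (elim u)
    show ?case
    proof (intro allI impI, elim conjE)
      fix t assume t: "0 \<le> t" "0 < \<sigma> t"
      have s1: "(\<sigma> t)\<^sup>2 \<le> 1" using le1[OF t(1)] t(2) by (intro power_le_one) auto
      have "2 + (u + 1)\<^sup>2 / (2 * (\<sigma> t)\<^sup>2) = (4 * (\<sigma> t)\<^sup>2 + (u + 1)\<^sup>2) / (2 * (\<sigma> t)\<^sup>2)"
        using t by (simp add: field_simps)
      also have "\<dots> \<le> ((1 + \<delta>) * u\<^sup>2) / (2 * (\<sigma> t)\<^sup>2)"
        using elim(1) s1 by (intro divide_right_mono) auto
      finally have "exp (- ((1 + \<delta>) * u\<^sup>2 / (2 * (\<sigma> t)\<^sup>2))) \<le> exp (- 2 - (u + 1)\<^sup>2 / (2 * (\<sigma> t)\<^sup>2))" by simp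
      then have "tailT (t * u powr \<gamma>) * exp (- ((1 + \<delta>) * u\<^sup>2 / (2 * (\<sigma> t)\<^sup>2))) \<le> tailT (t * u powr \<gamma>) * exp (- 2 - (u + 1)\<^sup>2 / (2 * (\<sigma> t)\<^sup>2))"
        by (intro mult_left_mono tailT_nonneg)
      also have "\<dots> \<le> psiT M X T \<gamma> u" by (rule psiT_lower[OF elim(2) t])
      finally show "tailT (t * u powr \<gamma>) * exp (- ((1 + \<delta>) * u\<^sup>2 / (2 * (\<sigma> t)\<^sup>2))) \<le> psiT M X T \<gamma> u" .
    qed
  qed
qed

text \<open>The grid and the bounds \<open>c\<close> sit inside the eventuality, so they may vary
  with \<open>u\<close>.\<close>

lemma psiT_upper_eventually:
  assumes d: "0 < \<delta>"
  shows "\<forall>\<^sub>F u in at_top. \<forall>n s c. s 0 = 0 \<and> (\<forall>k<n. 0 < c k \<and> (\<forall>t. 0 \<le> t \<and> t \<le> s (Suc k) \<longrightarrow> \<sigma> t \<le> c k)) \<longrightarrow>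
    psiT M X T \<gamma> u \<le> (\<Sum>k<n. tailT (s k * u powr \<gamma>) * exp (- ((1 - \<delta>) * u\<^sup>2 / (2 * (c k)\<^sup>2)))) + tailT (s n * u powr \<gamma>) * exp (- ((1 - \<delta>) * u\<^sup>2 / 2))"
proof -
  obtain m where m: "m \<ge> 0" and B: "\<And>u \<gamma> n s c. u > 0 \<Longrightarrow> m \<le> u \<Longrightarrow> s 0 = 0 \<Longrightarrow> (\<forall>k<n. 0 < c k \<and> (\<forall>t. 0 \<le> t \<and> t \<le> s (Suc k) \<longrightarrow> \<sigma> t \<le> c k)) \<Longrightarrow>
    psiT M X T \<gamma> u \<le> (\<Sum>k<n. tailT (s k * u powr \<gamma>) * exp (- (u - m)\<^sup>2 / (2 * (c k)\<^sup>2))) + tailT (s n * u powr \<gamma>) * exp (- (u - m)\<^sup>2 / 2)"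
    using psiT_upper by blast
  have "\<forall>\<^sub>F u in at_top. (1 - \<delta>) * u\<^sup>2 \<le> (u - m)\<^sup>2" using d by real_asymp
  then show ?thesis using eventually_gt_at_top[of 0] eventually_ge_at_top[of m]
  proof eventually_elim
    case (elim u)
    have e: "exp (- (u - m)\<^sup>2 / (2 * b\<^sup>2)) \<le> exp (- ((1 - \<delta>) * u\<^sup>2 / (2 * b\<^sup>2)))" for b :: real
      using elim(1) by (simp add: divide_right_mono)
    show ?case
    proof (intro allI impI, elim conjE)
      fix n :: nat and s c :: "nat \<Rightarrow> real"
      assume h: "s 0 = 0" "\<forall>k<n. 0 < c k \<and> (\<forall>t. 0 \<le> t \<and> t \<le> s (Suc k) \<longrightarrow> \<sigma> t \<le> c k)"
      have "psiT M X T \<gamma> u \<le> (\<Sum>k<n. tailT (s k * u powr \<gamma>) * exp (- (u - m)\<^sup>2 / (2 * (c k)\<^sup>2))) + tailT (s n * u powr \<gamma>) * exp (- (u - m)\<^sup>2 / 2)"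
        by (rule B[OF elim(2,3) h])
      also have "\<dots> \<le> (\<Sum>k<n. tailT (s k * u powr \<gamma>) * exp (- ((1 - \<delta>) * u\<^sup>2 / (2 * (c k)\<^sup>2)))) + tailT (s n * u powr \<gamma>) * exp (- ((1 - \<delta>) * u\<^sup>2 / 2))"
        using e e[of 1] by (intro add_mono sum_mono mult_left_mono tailT_nonneg) auto
      finally show "psiT M X T \<gamma> u \<le> \<dots>" .
    qed
  qed
qed

lemma psiT_square_lower:
  assumes t: "0 \<le> t" "0 < \<sigma> t" and e: "0 < e"
    and q: "\<And>e. 0 < e \<Longrightarrow> \<forall>\<^sub>F u in at_top. exp (- (\<kappa> + e) * u\<^sup>2) \<le> tailT (t * u powr \<gamma>)"
  shows "\<forall>\<^sub>F u in at_top. exp (- (1 / (2 * (\<sigma> t)\<^sup>2) + \<kappa> + e) * u\<^sup>2) \<le> psiT M X T \<gamma> u"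
proof -
  \<comment> \<open>Makes the excess \<open>\<delta> * u^2 / (2 * (\<sigma> t)^2)\<close> exactly
    \<open>e / 2 * u^2\<close>; the other half of \<open>e\<close> pays for the tail of
    \<open>T\<close>.\<close>
  define \<delta> where "\<delta> = e * (\<sigma> t)\<^sup>2"
  have d: "0 < \<delta>" unfolding \<delta>_def using e t by simp
  have e2: "0 < e / 2" using e by simp
  show ?thesis using psiT_lower_eventually[OF d, of \<gamma>] q[OF e2]
  proof eventually_elim
    case (elim u)
    have "(1 + \<delta>) * u\<^sup>2 / (2 * (\<sigma> t)\<^sup>2) = (1 / (2 * (\<sigma> t)\<^sup>2) + e / 2) * u\<^sup>2"
      unfolding \<delta>_def using t by (simp add: field_simps)
    then have "exp (- (1 / (2 * (\<sigma> t)\<^sup>2) + \<kappa> + e) * u\<^sup>2) = exp (- (\<kappa> + e / 2) * u\<^sup>2) * exp (- ((1 + \<delta>) * u\<^sup>2 / (2 * (\<sigma> t)\<^sup>2)))"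
      by (simp add: mult_exp_exp algebra_simps)
    also have "\<dots> \<le> tailT (t * u powr \<gamma>) * exp (- ((1 + \<delta>) * u\<^sup>2 / (2 * (\<sigma> t)\<^sup>2)))"
      using elim(2) by (intro mult_right_mono) auto
    also have "\<dots> \<le> psiT M X T \<gamma> u" using elim(1) t by blast
    finally show ?case .
  qed
qed

text \<open>For a fixed grid: \<open>\<kappa> k\<close> is the horizon cost of reaching
  \<open>s k\<close>, and \<open>C\<close> is a common lower bound for the total cost over the
  cells.\<close>

lemma psiT_square_upper:
  fixes s c \<kappa> :: "nat \<Rightarrow> real"
  assumes s0: "s 0 = 0" and c: "\<And>k. k < n \<Longrightarrow> 0 < c k" "\<And>k t. k < n \<Longrightarrow> 0 \<le> t \<Longrightarrow> t \<le> s (Suc k) \<Longrightarrow> \<sigma> t \<le> c k"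
    and q: "\<And>k e. k \<le> n \<Longrightarrow> 0 < e \<Longrightarrow> \<forall>\<^sub>F u in at_top. tailT (s k * u powr \<gamma>) \<le> exp (- (\<kappa> k - e) * u\<^sup>2)"
    and C: "\<And>k. k < n \<Longrightarrow> C \<le> 1 / (2 * (c k)\<^sup>2) + \<kappa> k" "C \<le> 1 / 2 + \<kappa> n"
    and e: "0 < e"
  shows "\<forall>\<^sub>F u in at_top. psiT M X T \<gamma> u \<le> exp (- (C - e) * u\<^sup>2)"
proof -
  \<comment> \<open>The last term has the rate 1/2 of the global bound, so that all
    \<open>n + 1\<close> terms take one form.\<close>
  define b where "b k = (if k < n then 1 / (2 * (c k)\<^sup>2) else 1 / 2)" for k
  have b0: "0 \<le> b k" for k unfolding b_def by simp
  have Cb: "C \<le> b k + \<kappa> k" if "k \<le> n" for k using C that unfolding b_def by (cases "k = n") auto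
  define B where "B = 1 + (\<Sum>k\<le>n. b k)"
  have B: "b k \<le> B" if "k \<le> n" for k
    unfolding B_def using member_le_sum[of k "{..n}" b] that b0 by fastforce
  have B1: "1 \<le> B" unfolding B_def using b0 by (simp add: sum_nonneg)
  \<comment> \<open>Of the loss \<open>e\<close>, a quarter goes to the factor
    \<open>1 - \<delta>\<close>, a quarter to the tails of \<open>T\<close> and a half to the number
    of terms.\<close>
  define \<delta> where "\<delta> = e / (4 * B)"
  have d: "0 < \<delta>" unfolding \<delta>_def using e B1 by simp
  have db: "\<delta> * b k \<le> e / 4" if "k \<le> n" for k
  proof -
    have "\<delta> * b k \<le> \<delta> * B" using B[OF that] d by (intro mult_left_mono) auto
    also have "\<dots> = e / 4" unfolding \<delta>_def using B1 by simp
    finally show ?thesis .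
  qed
  have e4: "0 < e / 4" using e by simp
  have sum: "\<forall>\<^sub>F u in at_top. (\<Sum>k\<le>n. tailT (s k * u powr \<gamma>) * exp (- ((1 - \<delta>) * b k * u\<^sup>2))) \<le> exp (- ((C - e / 2) - e / 2) * u\<^sup>2)"
  proof (rule sum_exp_decay)
    show "filterlim (\<lambda>u::real. u\<^sup>2) at_top at_top" by real_asymp
    show "0 < e / 2" using e by simp
    fix k assume k: "k \<le> n"
    show "\<forall>\<^sub>F u in at_top. tailT (s k * u powr \<gamma>) * exp (- ((1 - \<delta>) * b k * u\<^sup>2)) \<le> exp (- (C - e / 2) * u\<^sup>2)"
      using q[OF k e4]
    proof eventually_elim
      case (elim u)
      have "tailT (s k * u powr \<gamma>) * exp (- ((1 - \<delta>) * b k * u\<^sup>2)) \<le> exp (- (\<kappa> k - e / 4) * u\<^sup>2) * exp (- ((1 - \<delta>) * b k * u\<^sup>2))"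
        using elim by (intro mult_right_mono) auto
      also have "\<dots> = exp (- (\<kappa> k - e / 4 + (1 - \<delta>) * b k) * u\<^sup>2)"
        unfolding mult_exp_exp by (simp add: algebra_simps)
      also have "\<dots> \<le> exp (- (C - e / 2) * u\<^sup>2)"
      proof -
        have "C - e / 2 \<le> \<kappa> k - e / 4 + (1 - \<delta>) * b k"
          using Cb[OF k] db[OF k] unfolding left_diff_distrib by linarith
        then have "(C - e / 2) * u\<^sup>2 \<le> (\<kappa> k - e / 4 + (1 - \<delta>) * b k) * u\<^sup>2" by (intro mult_right_mono) auto
        then show ?thesis by (simp only: exp_le_cancel_iff mult_minus_left neg_le_iff_le)
      qed
      finally show ?case .
    qed
  qed
  show ?thesis using psiT_upper_eventually[OF d, of \<gamma>] sum
  proof eventually_elim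
    case (elim u)
    have "psiT M X T \<gamma> u \<le> (\<Sum>k<n. tailT (s k * u powr \<gamma>) * exp (- ((1 - \<delta>) * u\<^sup>2 / (2 * (c k)\<^sup>2)))) + tailT (s n * u powr \<gamma>) * exp (- ((1 - \<delta>) * u\<^sup>2 / 2))"
      using elim(1) s0 c by blast
    also have "\<dots> = (\<Sum>k<n. tailT (s k * u powr \<gamma>) * exp (- ((1 - \<delta>) * b k * u\<^sup>2))) + tailT (s n * u powr \<gamma>) * exp (- ((1 - \<delta>) * b n * u\<^sup>2))"
      unfolding b_def by (simp add: mult_ac)
    also have "\<dots> = (\<Sum>k\<le>n. tailT (s k * u powr \<gamma>) * exp (- ((1 - \<delta>) * b k * u\<^sup>2)))"
      by (simp add: lessThan_Suc_atMost[symmetric])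
    finally show ?case using elim(2) by simp
  qed
qed

end

section \<open>The running maximum of the standard deviation and the minimiser
  \<open>A0\<close>\<close>

context
  fixes \<sigma> :: "real \<Rightarrow> real" and t0 :: real
  assumes cont: "continuous_on {0..t0} \<sigma>"
begin

lemma sigma_hat_attained:
  assumes "0 \<le> s" "s \<le> t0"
  shows "\<exists>t\<in>{0..s}. sigma_hat \<sigma> s = \<sigma> t \<and> (\<forall>t'\<in>{0..s}. \<sigma> t' \<le> \<sigma> t)"
proof -
  have "continuous_on {0..s} \<sigma>" using cont assms by (auto intro: continuous_on_subset)
  then obtain t where t: "t \<in> {0..s}" "\<And>t'. t' \<in> {0..s} \<Longrightarrow> \<sigma> t' \<le> \<sigma> t"
    using continuous_attains_sup[of "{0..s}" \<sigma>] assms by auto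
  have "sigma_hat \<sigma> s = \<sigma> t" unfolding sigma_hat_def
    using t by (intro cSup_eq_maximum) auto
  then show ?thesis using t by blast
qed

lemma sigma_hat_ge: "0 \<le> t \<Longrightarrow> t \<le> s \<Longrightarrow> s \<le> t0 \<Longrightarrow> \<sigma> t \<le> sigma_hat \<sigma> s"
  using sigma_hat_attained[of s] by fastforce

lemma sigma_hat_mono: "0 \<le> s \<Longrightarrow> s \<le> t \<Longrightarrow> t \<le> t0 \<Longrightarrow> sigma_hat \<sigma> s \<le> sigma_hat \<sigma> t"
  using sigma_hat_attained[of s] sigma_hat_ge[of _ t] by fastforce

text \<open>If the running maximum grows between \<open>s\<close> and \<open>t\<close>, the new
  maximiser lies in that interval and is controlled by the modulus of continuity of
  \<open>\<sigma>\<close>.\<close>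

lemma sigma_hat_continuous: "continuous_on {0..t0} (sigma_hat \<sigma>)"
  unfolding continuous_on_iff
proof (intro ballI allI impI)
  fix x e :: real assume x: "x \<in> {0..t0}" and e: "0 < e"
  have "uniformly_continuous_on {0..t0} \<sigma>" using cont by (rule compact_uniformly_continuous) simp
  then obtain d where d: "d > 0" "\<And>y z. y \<in> {0..t0} \<Longrightarrow> z \<in> {0..t0} \<Longrightarrow> dist z y < d \<Longrightarrow> dist (\<sigma> z) (\<sigma> y) < e"
    unfolding uniformly_continuous_on_def using e by metis
  have key: "dist (sigma_hat \<sigma> t) (sigma_hat \<sigma> s) < e" if st: "0 \<le> s" "s \<le> t" "t \<le> t0" "t - s < d" for s t
  proof -
    obtain t' where t': "t' \<in> {0..t}" "sigma_hat \<sigma> t = \<sigma> t'" using sigma_hat_attained[of t] st by auto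
    have "\<sigma> t' < sigma_hat \<sigma> s + e"
    proof (cases "t' \<le> s")
      case True
      then show ?thesis using sigma_hat_ge[of t' s] t' st e by auto
    next
      case False
      have "dist (\<sigma> t') (\<sigma> s) < e" by (rule d(2)) (use False t' st in \<open>auto simp: dist_real_def\<close>)
      then show ?thesis using sigma_hat_ge[of s s] st by (auto simp: dist_real_def)
    qed
    then show ?thesis using sigma_hat_mono[OF st(1-3)] t' by (simp add: dist_real_def)
  qed
  show "\<exists>d>0. \<forall>x'\<in>{0..t0}. dist x' x < d \<longrightarrow> dist (sigma_hat \<sigma> x') (sigma_hat \<sigma> x) < e"
  proof (intro exI[of _ d] conjI ballI impI d(1))
    fix y assume y: "y \<in> {0..t0}" "dist y x < d"
    show "dist (sigma_hat \<sigma> y) (sigma_hat \<sigma> x) < e"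
    proof (cases "x \<le> y")
      case True
      then show ?thesis using key[of x y] x y by (auto simp: dist_real_def)
    next
      case False
      then show ?thesis using key[of y x] x y by (auto simp: dist_real_def dist_commute)
    qed
  qed
qed

text \<open>The infimum of the minimisers must itself be a minimiser, so the set of minimisers has
  to be nonempty and closed. Where \<open>sigma_hat\<close> vanishes, \<open>f\<close> uses
  \<open>1 / 0 = 0\<close> while \<open>sigma_tilde\<close> is infinite, so such points are kept
  away.\<close>

lemma A0_minimizer:
  fixes L \<gamma> :: real
  assumes t0: "0 \<le> t0" and nn: "\<And>t. 0 \<le> t \<Longrightarrow> t \<le> t0 \<Longrightarrow> 0 \<le> \<sigma> t" and pos: "0 < \<sigma> t0"
    and g: "0 < \<gamma>" and L: "0 < L"
  defines "f \<equiv> \<lambda>t. 1 / (2 * (sigma_hat \<sigma> t)\<^sup>2) + L * t powr (2 / \<gamma>)"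
  shows "A0 \<sigma> L \<gamma> t0 \<in> {0..t0}" "sigma_hat \<sigma> (A0 \<sigma> L \<gamma> t0) \<noteq> 0"
    "\<And>t. 0 \<le> t \<Longrightarrow> t \<le> t0 \<Longrightarrow> sigma_hat \<sigma> t \<noteq> 0 \<Longrightarrow> f (A0 \<sigma> L \<gamma> t0) \<le> f t"
proof -
  let ?h = "sigma_hat \<sigma>" and ?A = "A0 \<sigma> L \<gamma> t0"
  have h0: "0 \<le> ?h t" if "0 \<le> t" "t \<le> t0" for t using sigma_hat_ge[of t t] nn[of t] that by linarith
  define m where "m = f t0"
  have ht0: "0 < ?h t0" using sigma_hat_ge[of t0 t0] t0 pos by simp
  have m: "0 < m" unfolding m_def f_def using ht0 L by (intro add_pos_nonneg) auto
  \<comment> \<open>\<open>c\<close> solves \<open>1 / (2 * c^2) = f t0\<close>: points where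
    \<open>sigma_hat\<close> is positive but below \<open>c\<close> are worse than
    \<open>t0\<close>, and where it is at least \<open>c\<close> the function \<open>f\<close> is
    continuous.\<close>
  define c where "c = 1 / sqrt (2 * m)"
  have c: "0 < c" unfolding c_def using m by simp
  have c2: "c\<^sup>2 = 1 / (2 * m)" unfolding c_def using m by (simp add: power_divide)
  have small: "m < f t" if "0 < ?h t" "?h t < c" for t
  proof -
    have "(?h t)\<^sup>2 < c\<^sup>2" using that by (intro power_strict_mono) auto
    then have "2 * (?h t)\<^sup>2 < 1 / m" unfolding c2 by simp
    then have "m < 1 / (2 * (?h t)\<^sup>2)" using that m by (simp add: field_simps)
    moreover have "0 \<le> L * t powr (2 / \<gamma>)" using L by simp
    ultimately show ?thesis unfolding f_def by linarith
  qed
  define S where "S = {0..t0} \<inter> ?h -` {c..}"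
  have "closed S" unfolding S_def by (rule continuous_closed_preimage[OF sigma_hat_continuous]) auto
  then have S: "compact S" unfolding compact_eq_bounded_closed
    by (auto simp: S_def intro: bounded_subset[of "{0..t0}"])
  have t0S: "t0 \<in> S" using small[of t0] ht0 t0 unfolding S_def m_def by (auto simp: not_less[symmetric])
  have hc: "continuous_on S ?h"
    using sigma_hat_continuous by (rule continuous_on_subset) (auto simp: S_def)
  have fc: "continuous_on S f" unfolding f_def
    using g c by (intro continuous_on_add continuous_on_divide continuous_on_mult continuous_on_const
      continuous_on_power continuous_on_powr' continuous_on_id hc) (auto simp: S_def)
  obtain a where a: "a \<in> S" "\<And>t. t \<in> S \<Longrightarrow> f a \<le> f t"
    using continuous_attains_inf[OF S _ fc] t0S by auto
  have ale: "f a \<le> f t" if t: "0 \<le> t" "t \<le> t0" "?h t \<noteq> 0" for t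
  proof (cases "t \<in> S")
    case False
    then have "m < f t" using small[of t] h0[of t] t unfolding S_def by auto
    then show ?thesis using a(2)[OF t0S] unfolding m_def by simp
  qed (use a in auto)
  have ah: "?h a \<noteq> 0" "0 \<le> a" "a \<le> t0" using a(1) c unfolding S_def by auto
  have st: "sigma_tilde \<sigma> L \<gamma> t = (if ?h t = 0 then \<infinity> else ereal (f t))" for t
    unfolding sigma_tilde_def f_def ..
  have inf: "(INF t\<in>{0..t0}. sigma_tilde \<sigma> L \<gamma> t) = ereal (f a)"
  proof (rule antisym)
    show "(INF t\<in>{0..t0}. sigma_tilde \<sigma> L \<gamma> t) \<le> ereal (f a)"
      using ah st[of a] by (intro INF_lower2[of a]) auto
    show "ereal (f a) \<le> (INF t\<in>{0..t0}. sigma_tilde \<sigma> L \<gamma> t)"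
      using ale st by (intro INF_greatest) auto
  qed
  define Z where "Z = {A \<in> {0..t0}. sigma_tilde \<sigma> L \<gamma> A = (INF t\<in>{0..t0}. sigma_tilde \<sigma> L \<gamma> t)}"
  \<comment> \<open>The minimisers form a level set of a continuous function on the compact set
    \<open>S\<close>, hence a closed set.\<close>
  have Z: "Z = S \<inter> f -` {f a}"
  proof
    show "Z \<subseteq> S \<inter> f -` {f a}"
    proof
      fix t assume "t \<in> Z"
      then have t: "t \<in> {0..t0}" "?h t \<noteq> 0" "f t = f a" unfolding Z_def inf st by (auto split: if_splits)
      have "f a \<le> m" using a(2)[OF t0S] unfolding m_def .
      then have "\<not> ?h t < c" using small[of t] h0[of t] t by auto
      then show "t \<in> S \<inter> f -` {f a}" using t unfolding S_def by auto
    qed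
    show "S \<inter> f -` {f a} \<subseteq> Z" unfolding Z_def inf using st c by (auto simp: S_def)
  qed
  have "closed Z" unfolding Z using S compact_imp_closed fc by (intro continuous_closed_preimage) auto
  moreover have "a \<in> Z" unfolding Z using a by simp
  moreover have "bdd_below Z" unfolding Z_def by (rule bdd_belowI[of _ 0]) auto
  ultimately have "Inf Z \<in> Z" using closed_contains_Inf by blast
  then have A: "?A \<in> Z" unfolding A0_def Z_def .
  then show "?A \<in> {0..t0}" "?h ?A \<noteq> 0" using c unfolding Z S_def by auto
  have "f ?A = f a" using A unfolding Z by simp
  then show "f ?A \<le> f t" if "0 \<le> t" "t \<le> t0" "?h t \<noteq> 0" for t using ale[OF that] by simp
qed

end

section \<open>The four asymptotic regimes\<close>

context gaussian_weibull_horizon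
begin

lemma tailT_powr_upper:
  assumes "0 < \<gamma>" "0 \<le> x" "0 < e"
  shows "\<forall>\<^sub>F u in at_top. tailT (x * u powr \<gamma>) \<le> exp (- (L * x powr p - e) * u powr (\<gamma> * p))"
proof -
  have "filterlim (\<lambda>u. u powr \<gamma>) at_top at_top" using assms(1) by real_asymp
  from eventually_compose_filterlim[OF tailT_upper[OF assms(2,3)] this] show ?thesis
    by (simp add: powr_powr)
qed

lemma tailT_powr_lower:
  assumes "0 < \<gamma>" "0 \<le> x" "0 < e"
  shows "\<forall>\<^sub>F u in at_top. exp (- (L * x powr p + e) * u powr (\<gamma> * p)) \<le> tailT (x * u powr \<gamma>)"
proof -
  have "filterlim (\<lambda>u. u powr \<gamma>) at_top at_top" using assms(1) by real_asymp
  from eventually_compose_filterlim[OF tailT_lower[OF assms(2,3)] this] show ?thesis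
    by (simp add: powr_powr)
qed

lemma square_pos: "\<forall>\<^sub>F u in at_top. 0 < (u::real)\<^sup>2"
  by real_asymp

text \<open>The horizon cost is negligible against \<open>u^2\<close>: reaching \<open>t0\<close> is
  free at this scale, and the global bound on the supremum is already sharp.\<close>

lemma psiT_limit_short_horizon:
  assumes g: "0 \<le> \<gamma>" "\<gamma> * p < 2" and t0: "0 \<le> t0" "\<sigma> t0 = 1"
  shows "((\<lambda>u. ln (psiT M X T \<gamma> u) / u\<^sup>2) \<longlongrightarrow> - (1/2)) at_top"
proof (rule log_ratio_tendsto[OF _ _ square_pos])
  fix e :: real assume e: "0 < e"
  have q: "\<forall>\<^sub>F u in at_top. exp (- (0 + e) * u\<^sup>2) \<le> tailT (t0 * u powr \<gamma>)" if e: "0 < e" for e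
  \<comment> \<open>For \<open>\<gamma> = 0\<close> time is not rescaled and the cost is the
    positive constant \<open>tailT t0\<close>.\<close>
  proof (cases "\<gamma> = 0")
    case True
    have "((\<lambda>u::real. exp (- e * u\<^sup>2)) \<longlongrightarrow> 0) at_top" using e by real_asymp
    then have "\<forall>\<^sub>F u in at_top. exp (- e * u\<^sup>2) < tailT t0" by (rule order_tendstoD(2)) (rule tailT_pos)
    then show ?thesis using eventually_gt_at_top[of 0] by eventually_elim (use True in simp)
  next
    case False
    then have g0: "0 < \<gamma>" using g by simp
    define b where "b = L * t0 powr p + 1"
    define q where "q = \<gamma> * p"
    have "0 < b" unfolding b_def using L by (intro add_nonneg_pos) auto
    moreover have "q < 2" unfolding q_def by fact
    ultimately have "\<forall>\<^sub>F u in at_top. b * u powr q \<le> e * u\<^sup>2" using e by real_asymp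
    moreover have "\<forall>\<^sub>F u in at_top. exp (- b * u powr q) \<le> tailT (t0 * u powr \<gamma>)"
      unfolding b_def q_def by (rule tailT_powr_lower[OF g0 t0(1)]) simp
    ultimately show ?thesis
      by eventually_elim (erule order_trans[rotated], simp)
  qed
  show "\<forall>\<^sub>F u in at_top. exp (- (1/2 + e) * u\<^sup>2) \<le> psiT M X T \<gamma> u"
    using psiT_square_lower[of t0 e 0 \<gamma>] t0 e q by simp
  show "\<forall>\<^sub>F u in at_top. psiT M X T \<gamma> u \<le> exp (- (1/2 - e) * u\<^sup>2)"
  \<comment> \<open>No cells: only the term for the whole half-line remains.\<close>
  proof (rule psiT_square_upper[where n=0 and s="\<lambda>_. 0" and c="\<lambda>_. 1" and \<kappa>="\<lambda>_. 0"])
    show "\<forall>\<^sub>F u in at_top. tailT (0 * u powr \<gamma>) \<le> exp (- (0 - e) * u\<^sup>2)" if "0 < e" for e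
      using that by (simp add: tailT_0)
  qed (use e in auto)
qed

text \<open>Both costs are of order \<open>u^2\<close>. The lower bound uses a maximiser
  \<open>t <= A\<close> of \<open>\<sigma>\<close> on \<open>[0, A]\<close>, whose horizon cost is
  at most that of \<open>A\<close>; the upper bound uses an equidistant grid on
  \<open>[0, t0]\<close>.\<close>

lemma psiT_limit_critical:
  assumes g: "0 < \<gamma>" "\<gamma> * p = 2" and t0: "0 \<le> t0" and cont: "continuous_on {0..t0} \<sigma>" and one: "\<sigma> t0 = 1"
    and A: "0 \<le> A" "A \<le> t0" "sigma_hat \<sigma> A \<noteq> 0"
    and m: "m = 1 / (2 * (sigma_hat \<sigma> A)\<^sup>2) + L * A powr p"
    and min: "\<And>t. 0 \<le> t \<Longrightarrow> t \<le> t0 \<Longrightarrow> sigma_hat \<sigma> t \<noteq> 0 \<Longrightarrow> m \<le> 1 / (2 * (sigma_hat \<sigma> t)\<^sup>2) + L * t powr p"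
  shows "((\<lambda>u. ln (psiT M X T \<gamma> u) / u\<^sup>2) \<longlongrightarrow> - m) at_top"
proof (rule log_ratio_tendsto[OF _ _ square_pos])
  fix e :: real assume e: "0 < e"
  let ?h = "sigma_hat \<sigma>"
  have nn: "0 \<le> \<sigma> t" for t unfolding sdev_def by simp
  have h0: "0 \<le> ?h t" if "0 \<le> t" "t \<le> t0" for t using sigma_hat_ge[OF cont, of t t] nn[of t] that by linarith
  have m0: "0 < m" unfolding m using A(3) L by (intro add_pos_nonneg) auto
  obtain t where t: "t \<in> {0..A}" "?h A = \<sigma> t" using sigma_hat_attained[OF cont A(1,2)] by auto
  have st: "0 < \<sigma> t" using A(3) t nn[of t] by simp
  have sq: "\<forall>\<^sub>F u in at_top. u powr (\<gamma> * p) = u\<^sup>2"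
    using eventually_gt_at_top[of 0] by eventually_elim (simp add: g)
  have "\<forall>\<^sub>F u in at_top. exp (- (1 / (2 * (\<sigma> t)\<^sup>2) + L * t powr p + e) * u\<^sup>2) \<le> psiT M X T \<gamma> u"
  proof (rule psiT_square_lower[OF _ st e])
    show "0 \<le> t" using t by simp
    show "\<forall>\<^sub>F u in at_top. exp (- (L * t powr p + e) * u\<^sup>2) \<le> tailT (t * u powr \<gamma>)" if "0 < e" for e
      using tailT_powr_lower[OF g(1) \<open>0 \<le> t\<close> that] sq by eventually_elim simp
  qed
  then show "\<forall>\<^sub>F u in at_top. exp (- (m + e) * u\<^sup>2) \<le> psiT M X T \<gamma> u"
  proof eventually_elim
    case (elim u)
    have "t powr p \<le> A powr p" using t p by (intro powr_mono2) auto
    then have "1 / (2 * (\<sigma> t)\<^sup>2) + L * t powr p + e \<le> m + e" unfolding m t(2) using L by simp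
    then have "(1 / (2 * (\<sigma> t)\<^sup>2) + L * t powr p + e) * u\<^sup>2 \<le> (m + e) * u\<^sup>2" by (intro mult_right_mono) auto
    then have "exp (- (m + e) * u\<^sup>2) \<le> exp (- (1 / (2 * (\<sigma> t)\<^sup>2) + L * t powr p + e) * u\<^sup>2)"
      by (simp only: exp_le_cancel_iff mult_minus_left neg_le_iff_le)
    then show ?case using elim by (rule order_trans)
  qed
  have e2: "0 < e / 2" using e by simp
  obtain n where n: "n > 0" "\<And>k. k < n \<Longrightarrow> L * (t0 * real (Suc k) / real n) powr p \<le> L * (t0 * real k / real n) powr p + e / 2"
    using powr_grid[OF t0 p e2, of L] by blast
  define s where "s k = t0 * real k / real n" for k
  have s: "0 \<le> s k" "k \<le> n \<Longrightarrow> s k \<le> t0" "s n = t0" "s 0 = 0" for k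
    unfolding s_def using n t0 by (auto simp: pos_divide_le_eq mult_left_mono)
  \<comment> \<open>Where \<open>sigma_hat\<close> vanishes any positive bound is valid; this one
    gives the rate \<open>1 / (2 * c^2) = m\<close>.\<close>
  define c where "c k = (if ?h (s (Suc k)) = 0 then 1 / sqrt (2 * m) else ?h (s (Suc k)))" for k
  have "\<forall>\<^sub>F u in at_top. psiT M X T \<gamma> u \<le> exp (- ((m - e / 2) - e / 2) * u\<^sup>2)"
  proof (rule psiT_square_upper[where n=n and s=s and c=c and \<kappa>="\<lambda>k. L * s k powr p", OF s(4) _ _ _ _ _ e2])
    show "0 < c k" if "k < n" for k
      unfolding c_def using h0[of "s (Suc k)"] s that m0 by (auto simp: less_le)
    show "\<sigma> t \<le> c k" if "k < n" "0 \<le> t" "t \<le> s (Suc k)" for k t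
      unfolding c_def using sigma_hat_ge[OF cont, of t "s (Suc k)"] s(2)[of "Suc k"] that m0 by (auto intro: order_trans)
    show "\<forall>\<^sub>F u in at_top. tailT (s k * u powr \<gamma>) \<le> exp (- (L * s k powr p - e) * u\<^sup>2)" if "0 < e" for k e
      using tailT_powr_upper[OF g(1) s(1) that] sq by eventually_elim simp
    show "m - e / 2 \<le> 1 / (2 * (c k)\<^sup>2) + L * s k powr p" if k: "k < n" for k
    proof (cases "?h (s (Suc k)) = 0")
      case True
      have "1 / (2 * (c k)\<^sup>2) = m" unfolding c_def using True m0 by (simp add: power_divide)
      moreover have "0 \<le> L * s k powr p" using L by simp
      ultimately show ?thesis using e by linarith
    next
      case False
      have "m \<le> 1 / (2 * (c k)\<^sup>2) + L * s (Suc k) powr p"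
        unfolding c_def using min[OF s(1) _ False] s(2)[of "Suc k"] k False by simp
      also have "L * s (Suc k) powr p \<le> L * s k powr p + e / 2" unfolding s_def by (rule n(2)[OF k])
      finally show ?thesis by simp
    qed
    \<comment> \<open>The running maximum has reached 1 at \<open>t0\<close>, so the last rate
      \<open>1/2 + L * t0 powr p\<close> is the exponent at \<open>t0\<close> itself.\<close>
    have h1: "?h t0 = 1"
    proof (rule antisym)
      obtain t' where "t' \<in> {0..t0}" "?h t0 = \<sigma> t'" using sigma_hat_attained[OF cont t0] by auto
      then show "?h t0 \<le> 1" using le1 by simp
      show "1 \<le> ?h t0" using sigma_hat_ge[OF cont, of t0 t0] t0 one by simp
    qed
    show "m - e / 2 \<le> 1 / 2 + L * s n powr p"
      using min[of t0] t0 h1 s(3) e by simp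
  qed
  then show "\<forall>\<^sub>F u in at_top. psiT M X T \<gamma> u \<le> exp (- (m - e) * u\<^sup>2)" by simp
qed

text \<open>Any fixed positive time costs more than every multiple of \<open>u^2\<close> to reach,
  so only times near 0 matter, where the deviation is at most slightly above
  \<open>\<sigma> 0\<close>.\<close>

lemma psiT_limit_long_horizon:
  assumes g: "0 \<le> \<gamma>" "2 < \<gamma> * p" and pos: "0 < \<sigma> 0"
    and cont: "\<And>e. 0 < e \<Longrightarrow> \<exists>d>0. \<forall>t. 0 \<le> t \<and> t \<le> d \<longrightarrow> \<sigma> t \<le> \<sigma> 0 + e"
  shows "((\<lambda>u. ln (psiT M X T \<gamma> u) / u\<^sup>2) \<longlongrightarrow> - (1 / (2 * (\<sigma> 0)\<^sup>2))) at_top"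
proof (rule log_ratio_tendsto[OF _ _ square_pos])
  fix e :: real assume e: "0 < e"
  have g0: "0 < \<gamma>" using g by (cases "\<gamma> = 0") auto
  show "\<forall>\<^sub>F u in at_top. exp (- (1 / (2 * (\<sigma> 0)\<^sup>2) + e) * u\<^sup>2) \<le> psiT M X T \<gamma> u"
    using psiT_square_lower[of 0 e 0 \<gamma>] pos e by (simp add: tailT_0)
  let ?c0 = "1 / (2 * (\<sigma> 0)\<^sup>2)"
  have "((\<lambda>c. 1 / (2 * c\<^sup>2)) \<longlongrightarrow> ?c0) (at_right (\<sigma> 0))"
    using pos by (intro tendsto_intros) auto
  then have "\<forall>\<^sub>F c in at_right (\<sigma> 0). ?c0 - e / 2 < 1 / (2 * c\<^sup>2)" by (rule order_tendstoD(1)) (use e in simp)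
  moreover have "\<forall>\<^sub>F c in at_right (\<sigma> 0). \<sigma> 0 < c" by (simp add: eventually_at_right_less)
  ultimately have "\<forall>\<^sub>F c in at_right (\<sigma> 0). ?c0 - e / 2 < 1 / (2 * c\<^sup>2) \<and> \<sigma> 0 < c" by (rule eventually_conj)
  from eventually_happens'[OF trivial_limit_at_right_real this]
  obtain c where c: "?c0 - e / 2 < 1 / (2 * c\<^sup>2)" "\<sigma> 0 < c" by auto
  obtain d where d: "0 < d" "\<And>t. 0 \<le> t \<Longrightarrow> t \<le> d \<Longrightarrow> \<sigma> t \<le> c" using cont[of "c - \<sigma> 0"] c(2) by auto
  have Cc: "1 / (2 * c\<^sup>2) \<le> ?c0"
    using c(2) pos by (intro divide_left_mono mult_left_mono power_mono mult_pos_pos) auto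
  have e2: "0 < e / 2" using e by simp
  have "\<forall>\<^sub>F u in at_top. psiT M X T \<gamma> u \<le> exp (- (1 / (2 * c\<^sup>2) - e / 2) * u\<^sup>2)"
  \<comment> \<open>One cell \<open>[0, d]\<close> and the rest. For the rest every rate is
    admissible; \<open>?c0\<close> suffices since it is at least
    \<open>1 / (2 * c^2)\<close>.\<close>
  proof (rule psiT_square_upper[where n=1 and s="\<lambda>k. if k = 0 then 0 else d" and c="\<lambda>_. c" and \<kappa>="\<lambda>k. if k = 0 then 0 else ?c0", OF _ _ _ _ _ _ e2])
    fix k :: nat and e :: real assume e: "0 < e"
    show "\<forall>\<^sub>F u in at_top. tailT ((if k = 0 then 0 else d) * u powr \<gamma>) \<le> exp (- ((if k = 0 then 0 else ?c0) - e) * u\<^sup>2)"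
    proof (cases "k = 0")
      case True
      then show ?thesis using e by (simp add: tailT_0)
    next
      case False
      \<comment> \<open>Half of \<open>L * d powr p\<close>, so that the tail exponent net of its
        error is again \<open>b > 0\<close>.\<close>
      define b where "b = L * d powr p / 2"
      define q where "q = \<gamma> * p"
      define C where "C = ?c0 - e"
      have b: "0 < b" unfolding b_def using L d by simp
      have "2 < q" unfolding q_def by fact
      then have "\<forall>\<^sub>F u in at_top. (\<bar>C\<bar> + 1) * u\<^sup>2 \<le> b * u powr q" using b by real_asymp
      moreover have "\<forall>\<^sub>F u in at_top. tailT (d * u powr \<gamma>) \<le> exp (- (L * d powr p - b) * u powr q)"
        unfolding q_def using d b by (intro tailT_powr_upper[OF g0]) auto
      ultimately have "\<forall>\<^sub>F u in at_top. tailT (d * u powr \<gamma>) \<le> exp (- C * u\<^sup>2)"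
      proof eventually_elim
        case (elim u)
        have "C * u\<^sup>2 \<le> (\<bar>C\<bar> + 1) * u\<^sup>2" by (intro mult_right_mono) auto
        then have "exp (- b * u powr q) \<le> exp (- C * u\<^sup>2)" using elim(1) by simp
        moreover have "L * d powr p - b = b" unfolding b_def by simp
        with elim(2) have "tailT (d * u powr \<gamma>) \<le> exp (- b * u powr q)" by simp
        ultimately show ?case by (rule order_trans[rotated])
      qed
      then show ?thesis using False unfolding C_def by simp
    qed
  qed (use c d pos Cc in auto)
  then show "\<forall>\<^sub>F u in at_top. psiT M X T \<gamma> u \<le> exp (- (?c0 - e) * u\<^sup>2)"
  proof eventually_elim
    case (elim u)
    have "(?c0 - e) * u\<^sup>2 \<le> (1 / (2 * c\<^sup>2) - e / 2) * u\<^sup>2" using c(1) by (intro mult_right_mono) auto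
    then have "exp (- (1 / (2 * c\<^sup>2) - e / 2) * u\<^sup>2) \<le> exp (- (?c0 - e) * u\<^sup>2)"
      by (simp only: exp_le_cancel_iff mult_minus_left neg_le_iff_le)
    with elim show ?case by (rule order_trans)
  qed
qed

text \<open>The exponent \<open>1 / (2 D\<^sup>2 x\<^bsup>2\<eta>\<^esup>) + L x\<^bsup>p\<^esup>\<close> is minimal where both terms are in the ratio \<open>p : 2\<eta>\<close>;
  there, writing \<open>x = x\<^sub>0 e\<^bsup>\<tau>\<^esup>\<close>, the bound \<open>1 + y \<le> e\<^bsup>y\<^esup>\<close> applied to both terms has no linear part in \<open>\<tau>\<close>.\<close>
lemma power_exponent_min:
  fixes D \<eta> :: real
  assumes D: "0 < D" and \<eta>: "0 < \<eta>"
  defines "x0 \<equiv> (\<eta> / (D\<^sup>2 * L * p)) powr (1 / (2 * \<eta> + p))"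
  defines "f \<equiv> \<lambda>x. 1 / (2 * D\<^sup>2 * x powr (2 * \<eta>)) + L * x powr p"
  shows "0 < x0"
    and "f x0 = 1/2 * D powr (- (2 * p / (2 * \<eta> + p))) * (L * p / \<eta>) powr (2 * \<eta> / (2 * \<eta> + p))
                 + L powr (2 * \<eta> / (2 * \<eta> + p)) * (\<eta> / (p * D\<^sup>2)) powr (p / (2 * \<eta> + p))" (is "_ = ?A + ?B")
    and "\<And>x. 0 < x \<Longrightarrow> f x0 \<le> f x"
proof -
  have E: "0 < 2 * \<eta> + p" using \<eta> p by simp
  show x0: "0 < x0" unfolding x0_def using D \<eta> L p by simp
  \<comment> \<open>In logarithmic coordinates the two closed forms reduce to identities linear in
    \<open>a\<close>, \<open>h\<close>, \<open>l\<close> and \<open>q\<close>.\<close>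
  define a h l q where "a = ln D" and "h = ln \<eta>" and "l = ln L" and "q = ln p"
  have ex: "D = exp a" "\<eta> = exp h" "L = exp l" "p = exp q"
    unfolding a_def h_def l_def q_def using D \<eta> L p by auto
  have r1: "\<eta> / (D\<^sup>2 * L * p) = exp (h - 2 * a - l - q)" "L * p / \<eta> = exp (l + q - h)" "\<eta> / (p * D\<^sup>2) = exp (h - q - 2 * a)"
    "D\<^sup>2 = exp (2 * a)"
    unfolding ex by (simp_all add: exp_add exp_diff exp_double)
  have lx: "x0 = exp ((h - 2 * a - l - q) / (2 * \<eta> + p))"
    unfolding x0_def r1(1) by (simp add: exp_powr_real)
  \<comment> \<open>Used with \<open>e = 2 * \<eta> + p\<close>, so that
    \<open>p = e - 2 * \<eta>\<close>, and with \<open>y\<close> the numerator of the exponent in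
    \<open>lx\<close>.\<close>
  have gen1: "- 2 * a - y / e * (2 * \<eta>) = a * (- (2 * (e - 2 * \<eta>) / e)) + (- y - 2 * a) * (2 * \<eta> / e)"
    and gen2: "l + y / e * (e - 2 * \<eta>) = l * (2 * \<eta> / e) + (y + l) * ((e - 2 * \<eta>) / e)" if "e \<noteq> 0" for e y
    using that by (simp_all add: field_simps)
  have t1: "1 / (2 * D\<^sup>2 * x0 powr (2 * \<eta>)) = ?A"
  proof -
    have "1 / (2 * D\<^sup>2 * x0 powr (2 * \<eta>)) = 1/2 * exp (- 2 * a - (h - 2 * a - l - q) / (2 * \<eta> + p) * (2 * \<eta>))"
      unfolding lx r1(4) exp_powr_real by (simp add: exp_diff exp_minus field_simps)
    also have "- 2 * a - (h - 2 * a - l - q) / (2 * \<eta> + p) * (2 * \<eta>) = a * (- (2 * p / (2 * \<eta> + p))) + (l + q - h) * (2 * \<eta> / (2 * \<eta> + p))"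
      using gen1[of "2 * \<eta> + p" "h - 2 * a - l - q"] E by (simp add: algebra_simps)
    also have "exp \<dots> = D powr (- (2 * p / (2 * \<eta> + p))) * (L * p / \<eta>) powr (2 * \<eta> / (2 * \<eta> + p))"
      unfolding r1(2) ex(1) exp_powr_real by (simp only: exp_add)
    finally show ?thesis by simp
  qed
  have t2: "L * x0 powr p = ?B"
  proof -
    have "L * x0 powr p = exp (l + (h - 2 * a - l - q) / (2 * \<eta> + p) * p)"
      unfolding lx exp_powr_real using ex(3) by (simp add: exp_add)
    also have "l + (h - 2 * a - l - q) / (2 * \<eta> + p) * p = l * (2 * \<eta> / (2 * \<eta> + p)) + (h - q - 2 * a) * (p / (2 * \<eta> + p))"
      using gen2[of "2 * \<eta> + p" "h - 2 * a - l - q"] E by (simp add: algebra_simps)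
    also have "exp \<dots> = ?B"
      unfolding r1(3) ex(3) exp_powr_real by (simp only: exp_add)
    finally show ?thesis .
  qed
  show "f x0 = ?A + ?B"
    unfolding f_def t1 t2 ..
  define P R where "P = 1 / (2 * D\<^sup>2 * x0 powr (2 * \<eta>))" and "R = L * x0 powr p"
  have PR: "0 < P" "0 < R" unfolding P_def R_def using D L x0 by simp_all
  have "x0 powr (2 * \<eta> + p) = \<eta> / (D\<^sup>2 * L * p)"
    unfolding x0_def powr_powr using E D \<eta> L p by simp
  then have "x0 powr (2 * \<eta>) * x0 powr p * (D\<^sup>2 * L * p) = \<eta>"
    using D L p by (simp add: powr_add field_simps)
  then have stat: "p * R = 2 * \<eta> * P"
    unfolding P_def R_def using D x0 by (simp add: field_simps)
  fix x :: real assume x: "0 < x"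
  define \<tau> where "\<tau> = ln (x / x0)"
  have xe: "x = x0 * exp \<tau>" unfolding \<tau>_def using x x0 by simp
  have "f x = P * exp (- (2 * \<eta> * \<tau>)) + R * exp (p * \<tau>)"
    unfolding f_def P_def R_def xe using x0 by (simp add: powr_mult exp_powr_real exp_minus field_simps)
  also have "\<dots> \<ge> P * (1 + - (2 * \<eta> * \<tau>)) + R * (1 + p * \<tau>)"
    using PR by (intro add_mono mult_left_mono exp_ge_add_one_self) auto
  also have "P * (1 + - (2 * \<eta> * \<tau>)) + R * (1 + p * \<tau>) = P + R + \<tau> * (p * R - 2 * \<eta> * P)" by (simp add: algebra_simps)
  also have "\<dots> = f x0" using stat unfolding f_def P_def[symmetric] R_def[symmetric] by simp
  finally show "f x0 \<le> f x" .
qed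

text \<open>The relevant times are \<open>x * u powr (- \<theta>)\<close> with \<open>x\<close>
  fixed, so the grid moves with \<open>u\<close>. The value at 0 is prescribed because the limit
  from the right does not determine it, while every cell bound covers the time 0.\<close>

lemma psiT_limit_power_sdev:
  assumes g: "0 \<le> \<gamma>" "2 < \<gamma> * p" and D: "0 < D" and \<eta>: "0 < \<eta>"
    and lim: "((\<lambda>t. \<sigma> t / (D * t powr \<eta>)) \<longlongrightarrow> 1) (at_right 0)" and zero: "\<sigma> 0 = 0"
  shows "((\<lambda>u. ln (psiT M X T \<gamma> u) / u powr (2 * p * (\<eta> * \<gamma> + 1) / (2 * \<eta> + p)))
          \<longlongrightarrow> - (1/2 * D powr (- (2 * p / (2 * \<eta> + p))) * (L * p / \<eta>) powr (2 * \<eta> / (2 * \<eta> + p))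
                 + L powr (2 * \<eta> / (2 * \<eta> + p)) * (\<eta> / (p * D\<^sup>2)) powr (p / (2 * \<eta> + p)))) at_top"
proof -
  \<comment> \<open>Balances the Gaussian exponent \<open>2 + 2 * \<eta> * \<theta>\<close> with the
    horizon exponent \<open>(\<gamma> - \<theta>) * p\<close>; both then equal
    \<open>\<kappa>\<close>.\<close>
  define \<theta> where "\<theta> = (\<gamma> * p - 2) / (2 * \<eta> + p)"
  define \<kappa> where "\<kappa> = 2 * p * (\<eta> * \<gamma> + 1) / (2 * \<eta> + p)"
  have E: "0 < 2 * \<eta> + p" using \<eta> p by simp
  have th: "0 < \<theta>" unfolding \<theta>_def using g E by simp
  have k1: "\<kappa> = 2 + 2 * \<eta> * \<theta>" unfolding \<kappa>_def \<theta>_def using E by (simp add: field_simps)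
  have k2: "\<kappa> = (\<gamma> - \<theta>) * p" unfolding \<kappa>_def \<theta>_def using E by (simp add: field_simps)
  have k0: "0 < \<kappa>" unfolding k1 using \<eta> th by (simp add: add_pos_nonneg)
  have gt: "0 < \<gamma> - \<theta>" using k0 p unfolding k2 by (simp add: zero_less_mult_iff)
  define P where "P x = 1 / (2 * D\<^sup>2 * x powr (2 * \<eta>))" for x
  define x0 where "x0 = (\<eta> / (D\<^sup>2 * L * p)) powr (1 / (2 * \<eta> + p))"
  note min = power_exponent_min[OF D \<eta>, folded x0_def P_def]
  define A1 where "A1 = P x0 + L * x0 powr p"
  have x0: "0 < x0" by (rule min(1))
  have A1min: "A1 \<le> P x + L * x powr p" if "0 < x" for x unfolding A1_def by (rule min(3)[OF that])
  have P0: "0 < P x" if "0 < x" for x unfolding P_def using D that by simp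
  have A1pos: "0 < A1" unfolding A1_def using P0[OF x0] L by (simp add: add_pos_nonneg)
  have wtop: "filterlim (\<lambda>u. u powr \<kappa>) at_top at_top" using k0 by real_asymp
  have scale0: "((\<lambda>u. x * u powr (- \<theta>)) \<longlongrightarrow> 0) at_top" for x :: real using th by real_asymp
  have scale: "x * u powr (- \<theta>) * u powr \<gamma> = x * u powr (\<gamma> - \<theta>)" for x u :: real
    by (simp add: mult.assoc powr_add[symmetric])
  \<comment> \<open>\<open>b\<close> is \<open>1 - \<delta>\<close> in the lower and
    \<open>1 + \<delta>\<close> in the upper bound: the relative error of the power law for
    \<open>\<sigma>\<close>.\<close>
  have expo: "u\<^sup>2 / (2 * (b * (D * (x * u powr (- \<theta>)) powr \<eta>))\<^sup>2) = P x / b\<^sup>2 * u powr \<kappa>"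
    if "0 < u" "0 < x" "0 < b" for u x b :: real
  proof -
    have 1: "((x * u powr (- \<theta>)) powr \<eta>)\<^sup>2 = x powr (2 * \<eta>) * u powr (- (2 * \<eta> * \<theta>))"
      using that by (simp add: powr_mult powr_powr powr_power algebra_simps)
    have 2: "u powr \<kappa> = u\<^sup>2 * u powr (2 * \<eta> * \<theta>)" unfolding k1 powr_add using that by simp
    show ?thesis unfolding power_mult_distrib 1 2 P_def using that D
      by (simp add: powr_minus field_simps)
  qed
  have near: "\<exists>d>0. \<forall>t. 0 < t \<and> t < d \<longrightarrow> (1 - \<delta>) * (D * t powr \<eta>) \<le> \<sigma> t \<and> \<sigma> t \<le> (1 + \<delta>) * (D * t powr \<eta>)"
    if \<delta>: "0 < \<delta>" for \<delta>
  proof -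
    have "\<forall>\<^sub>F t in at_right 0. 1 - \<delta> < \<sigma> t / (D * t powr \<eta>)" "\<forall>\<^sub>F t in at_right 0. \<sigma> t / (D * t powr \<eta>) < 1 + \<delta>"
      using order_tendstoD[OF lim] \<delta> by auto
    then have "\<forall>\<^sub>F t in at_right 0. 1 - \<delta> < \<sigma> t / (D * t powr \<eta>) \<and> \<sigma> t / (D * t powr \<eta>) < 1 + \<delta>"
      by (rule eventually_conj)
    then obtain d where d: "0 < d" "\<And>t. 0 < t \<Longrightarrow> t < d \<Longrightarrow> 1 - \<delta> < \<sigma> t / (D * t powr \<eta>) \<and> \<sigma> t / (D * t powr \<eta>) < 1 + \<delta>"
      unfolding eventually_at_right_field by auto
    show ?thesis
    proof (intro exI[of _ d] conjI allI impI d(1), goal_cases)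
      case (1 t)
      then have "0 < D * t powr \<eta>" using D by simp
      then show ?case using d(2)[of t] 1 by (simp add: pos_less_divide_eq)
    next
      case (2 t)
      then have "0 < D * t powr \<eta>" using D by simp
      then show ?case using d(2)[of t] 2 by (simp add: pos_divide_less_eq)
    qed
  qed
  have lower: "\<forall>\<^sub>F u in at_top. exp (- (A1 + e) * u powr \<kappa>) \<le> psiT M X T \<gamma> u" if e: "0 < e" for e
  proof -
    have "((\<lambda>\<delta>::real. (1 + \<delta>) * (P x0 / (1 - \<delta>)\<^sup>2)) \<longlongrightarrow> (1 + 0) * (P x0 / (1 - 0)\<^sup>2)) (at_right 0)"
      by (intro tendsto_intros) auto
    then have "\<forall>\<^sub>F \<delta> in at_right 0. (1 + \<delta>) * (P x0 / (1 - \<delta>)\<^sup>2) < P x0 + e / 2"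
      by (rule order_tendstoD(2)) (use e in simp)
    moreover have "\<forall>\<^sub>F \<delta> in at_right 0. 0 < \<delta> \<and> \<delta> < (1::real)"
      unfolding eventually_at_right_field by (intro exI[of _ 1]) auto
    ultimately have "\<forall>\<^sub>F \<delta> in at_right 0. (1 + \<delta>) * (P x0 / (1 - \<delta>)\<^sup>2) < P x0 + e / 2 \<and> 0 < \<delta> \<and> \<delta> < 1"
      by (rule eventually_conj)
    from eventually_happens'[OF trivial_limit_at_right_real this]
    obtain \<delta> where \<delta>: "(1 + \<delta>) * (P x0 / (1 - \<delta>)\<^sup>2) < P x0 + e / 2" "0 < \<delta>" "\<delta> < 1" by auto
    obtain d where d: "0 < d" "\<And>t. 0 < t \<Longrightarrow> t < d \<Longrightarrow> (1 - \<delta>) * (D * t powr \<eta>) \<le> \<sigma> t" using near[OF \<delta>(2)] by blast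
    have "\<forall>\<^sub>F u in at_top. x0 * u powr (- \<theta>) < d" by (rule order_tendstoD(2)[OF scale0 d(1)])
    moreover have "\<forall>\<^sub>F u in at_top. exp (- (L * x0 powr p + e / 2) * u powr \<kappa>) \<le> tailT (x0 * u powr (\<gamma> - \<theta>))"
      unfolding k2 using x0 e by (intro tailT_powr_lower[OF gt]) auto
    ultimately show ?thesis using psiT_lower_eventually[OF \<delta>(2), of \<gamma>] eventually_gt_at_top[of 0]
    proof eventually_elim
      case (elim u)
      define t where "t = x0 * u powr (- \<theta>)"
      have t: "0 < t" "t < d" unfolding t_def using elim x0 by auto
      have s: "(1 - \<delta>) * (D * t powr \<eta>) \<le> \<sigma> t" by (rule d(2)[OF t])
      have s': "0 < (1 - \<delta>) * (D * t powr \<eta>)" using \<delta> D t by simp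
      have "(1 + \<delta>) * u\<^sup>2 / (2 * (\<sigma> t)\<^sup>2) \<le> (1 + \<delta>) * u\<^sup>2 / (2 * ((1 - \<delta>) * (D * t powr \<eta>))\<^sup>2)"
        using s s' \<delta> D by (intro divide_left_mono mult_left_mono power_mono mult_pos_pos mult_nonneg_nonneg) auto
      also have "\<dots> = (1 + \<delta>) * (P x0 / (1 - \<delta>)\<^sup>2 * u powr \<kappa>)"
        unfolding t_def using expo[of u x0 "1 - \<delta>"] elim x0 \<delta> by (simp add: times_divide_eq_right[symmetric] del: times_divide_eq_right)
      also have "\<dots> \<le> (P x0 + e / 2) * u powr \<kappa>"
        unfolding mult.assoc[symmetric] using \<delta>(1) by (intro mult_right_mono) auto
      finally have 1: "exp (- ((P x0 + e / 2) * u powr \<kappa>)) \<le> exp (- ((1 + \<delta>) * u\<^sup>2 / (2 * (\<sigma> t)\<^sup>2)))" by simp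
      have "exp (- (A1 + e) * u powr \<kappa>) = exp (- (L * x0 powr p + e / 2) * u powr \<kappa>) * exp (- ((P x0 + e / 2) * u powr \<kappa>))"
        unfolding A1_def mult_exp_exp by (simp add: algebra_simps)
      also have "\<dots> \<le> tailT (t * u powr \<gamma>) * exp (- ((1 + \<delta>) * u\<^sup>2 / (2 * (\<sigma> t)\<^sup>2)))"
        using elim(2) 1 unfolding t_def scale by (intro mult_mono) (auto simp: tailT_nonneg)
      also have "\<dots> \<le> psiT M X T \<gamma> u" using elim(3) t s s' by (meson less_imp_le order_less_le_trans)
      finally show ?case .
    qed
  qed
  have upper: "\<forall>\<^sub>F u in at_top. psiT M X T \<gamma> u \<le> exp (- (A1 - e) * u powr \<kappa>)" if e: "0 < e" for e
  proof -
    \<comment> \<open>Reaching \<open>K * u powr (- \<theta>)\<close> alone costs \<open>A1\<close>,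
      so the last term needs no Gaussian factor; hence \<open>b n = 0\<close> below.\<close>
    define K where "K = (A1 / L) powr (1 / p)"
    have K: "0 < K" unfolding K_def using A1pos L by simp
    have KL: "L * K powr p = A1" unfolding K_def using A1pos L p by (simp add: powr_powr)
    have e4: "0 < e / 4" using e by simp
    obtain n where n: "n > 0" "\<And>k. k < n \<Longrightarrow> L * (K * real (Suc k) / real n) powr p \<le> L * (K * real k / real n) powr p + e / 4"
      using powr_grid[OF less_imp_le[OF K] p e4, of L] by blast
    define x where "x k = K * real k / real n" for k
    have xpos: "0 < x (Suc k)" for k unfolding x_def using K n by simp
    have x: "0 \<le> x k" "k \<le> n \<Longrightarrow> x k \<le> K" "x n = K" "x 0 = 0" for k
      unfolding x_def using n K by (auto simp: pos_divide_le_eq mult_left_mono)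
    have "((\<lambda>\<delta>::real. (1 - \<delta>) / (1 + \<delta>)\<^sup>2 * (A1 - e / 4)) \<longlongrightarrow> (1 - 0) / (1 + 0)\<^sup>2 * (A1 - e / 4)) (at_right 0)"
      by (intro tendsto_intros) auto
    then have "\<forall>\<^sub>F \<delta> in at_right 0. A1 - e / 2 < (1 - \<delta>) / (1 + \<delta>)\<^sup>2 * (A1 - e / 4)"
      by (rule order_tendstoD(1)) (use e in simp)
    moreover have "\<forall>\<^sub>F \<delta> in at_right 0. 0 < \<delta> \<and> \<delta> < (1::real)"
      unfolding eventually_at_right_field by (intro exI[of _ 1]) auto
    ultimately have "\<forall>\<^sub>F \<delta> in at_right 0. A1 - e / 2 < (1 - \<delta>) / (1 + \<delta>)\<^sup>2 * (A1 - e / 4) \<and> 0 < \<delta> \<and> \<delta> < 1"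
      by (rule eventually_conj)
    from eventually_happens'[OF trivial_limit_at_right_real this]
    obtain \<delta> where \<delta>: "A1 - e / 2 < (1 - \<delta>) / (1 + \<delta>)\<^sup>2 * (A1 - e / 4)" "0 < \<delta>" "\<delta> < 1" by auto
    \<comment> \<open>The combined loss in the Gaussian rate: \<open>1 - \<delta>\<close> from the
      shift of \<open>u\<close> by a constant, \<open>(1 + \<delta>)^2\<close> from the power
      law.\<close>
    define \<rho> where "\<rho> = (1 - \<delta>) / (1 + \<delta>)\<^sup>2"
    have \<rho>: "0 \<le> \<rho>" "\<rho> \<le> 1" unfolding \<rho>_def using \<delta> by (auto simp: divide_le_eq power2_eq_square algebra_simps intro: add_nonneg_nonneg)
    define b where "b k = (if k < n then \<rho> * P (x (Suc k)) else 0)" for k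
    \<comment> \<open>The grid loses \<open>e / 4\<close> and \<open>\<rho>\<close> another
      \<open>e / 4\<close>; the remaining half of \<open>e\<close> is spent on the tails of
      \<open>T\<close> and on the number of terms.\<close>
    have rate: "A1 - e / 2 \<le> L * x k powr p + b k" if k: "k \<le> n" for k
    proof (cases "k < n")
      case True
      have "A1 - e / 4 \<le> P (x (Suc k)) + L * x k powr p"
        using A1min[OF xpos, of k] n(2)[OF True] unfolding x_def by simp
      then have "\<rho> * (A1 - e / 4) \<le> \<rho> * (P (x (Suc k)) + L * x k powr p)" using \<rho> by (intro mult_left_mono)
      also have "\<dots> \<le> \<rho> * P (x (Suc k)) + L * x k powr p"
      proof -
        have "\<rho> * (L * x k powr p) \<le> L * x k powr p" using \<rho> L by (intro mult_left_le_one_le) auto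
        then show ?thesis unfolding distrib_left by linarith
      qed
      finally show ?thesis using \<delta>(1) True unfolding \<rho>_def[symmetric] b_def by simp
    next
      case False
      then have "k = n" using k by simp
      then show ?thesis using x(3) KL e unfolding b_def by simp
    qed
    obtain d where d: "0 < d" "\<And>t. 0 < t \<Longrightarrow> t < d \<Longrightarrow> \<sigma> t \<le> (1 + \<delta>) * (D * t powr \<eta>)" using near[OF \<delta>(2)] by blast
    have small: "\<forall>\<^sub>F u in at_top. K * u powr (- \<theta>) < d" by (rule order_tendstoD(2)[OF scale0 d(1)])
    have sum: "\<forall>\<^sub>F u in at_top. (\<Sum>k\<le>n. tailT (x k * u powr (\<gamma> - \<theta>)) * exp (- (b k * u powr \<kappa>))) \<le> exp (- ((A1 - e * 3 / 4) - e / 4) * u powr \<kappa>)"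
    proof (rule sum_exp_decay[OF wtop e4])
      fix k assume k: "k \<le> n"
      have "\<forall>\<^sub>F u in at_top. tailT (x k * u powr (\<gamma> - \<theta>)) \<le> exp (- (L * x k powr p - e / 4) * u powr \<kappa>)"
        unfolding k2 using x e4 by (intro tailT_powr_upper[OF gt]) auto
      then show "\<forall>\<^sub>F u in at_top. tailT (x k * u powr (\<gamma> - \<theta>)) * exp (- (b k * u powr \<kappa>)) \<le> exp (- (A1 - e * 3 / 4) * u powr \<kappa>)"
      proof eventually_elim
        case (elim u)
        have "tailT (x k * u powr (\<gamma> - \<theta>)) * exp (- (b k * u powr \<kappa>)) \<le> exp (- (L * x k powr p - e / 4) * u powr \<kappa>) * exp (- (b k * u powr \<kappa>))"
          using elim by (intro mult_right_mono) auto
        also have "\<dots> = exp (- (L * x k powr p - e / 4 + b k) * u powr \<kappa>)"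
          unfolding mult_exp_exp by (simp add: algebra_simps)
        also have "\<dots> \<le> exp (- (A1 - e * 3 / 4) * u powr \<kappa>)"
        proof -
          have "(A1 - e * 3 / 4) * u powr \<kappa> \<le> (L * x k powr p - e / 4 + b k) * u powr \<kappa>"
            using rate[OF k] by (intro mult_right_mono) auto
          then show ?thesis by (simp only: exp_le_cancel_iff mult_minus_left neg_le_iff_le)
        qed
        finally show ?case .
      qed
    qed
    show ?thesis using psiT_upper_eventually[OF \<delta>(2), of \<gamma>] sum small eventually_gt_at_top[of 0]
    proof eventually_elim
      case (elim u)
      \<comment> \<open>The grid shrinks with \<open>u\<close>; once its last point is below
        \<open>d\<close>, the power law for \<open>\<sigma>\<close> is available at all positive
        times up to it.\<close>
      define s where "s k = x k * u powr (- \<theta>)" for k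
      define c where "c k = (1 + \<delta>) * (D * (s (Suc k)) powr \<eta>)" for k
      have spos: "0 < s (Suc k)" for k unfolding s_def using xpos elim(4) by simp
      have cpos: "0 < c k" for k unfolding c_def using \<delta> D spos[of k] by simp
      have sc: "\<sigma> t \<le> c k" if "k < n" "0 \<le> t" "t \<le> s (Suc k)" for k t
      proof (cases "t = 0")
        case True
        then show ?thesis using zero cpos[of k] by simp
      next
        case False
        then have t: "0 < t" using that by simp
        have "s (Suc k) \<le> K * u powr (- \<theta>)" unfolding s_def using x(2)[of "Suc k"] that by (intro mult_right_mono) auto
        then have "t < d" using that elim(3) by simp
        then have "\<sigma> t \<le> (1 + \<delta>) * (D * t powr \<eta>)" by (rule d(2)[OF t])
        also have "\<dots> \<le> c k" unfolding c_def using that t \<delta> D \<eta> by (intro mult_left_mono powr_mono2) auto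
        finally show ?thesis .
      qed
      have "s 0 = 0" unfolding s_def using x by simp
      then have "psiT M X T \<gamma> u \<le> (\<Sum>k<n. tailT (s k * u powr \<gamma>) * exp (- ((1 - \<delta>) * u\<^sup>2 / (2 * (c k)\<^sup>2)))) + tailT (s n * u powr \<gamma>) * exp (- ((1 - \<delta>) * u\<^sup>2 / 2))"
        using elim(1) cpos sc by blast
      also have "\<dots> \<le> (\<Sum>k<n. tailT (x k * u powr (\<gamma> - \<theta>)) * exp (- (b k * u powr \<kappa>))) + tailT (x n * u powr (\<gamma> - \<theta>)) * exp (- (b n * u powr \<kappa>))"
      proof (intro add_mono sum_mono)
        fix k assume "k \<in> {..<n}"
        then have k: "k < n" by simp
        have "(1 - \<delta>) * u\<^sup>2 / (2 * (c k)\<^sup>2) = (1 - \<delta>) * (u\<^sup>2 / (2 * (c k)\<^sup>2))" by simp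
        also have "\<dots> = b k * u powr \<kappa>"
          unfolding c_def s_def b_def \<rho>_def using expo[OF elim(4) xpos, of "1 + \<delta>" k] \<delta> k by simp
        finally show "tailT (s k * u powr \<gamma>) * exp (- ((1 - \<delta>) * u\<^sup>2 / (2 * (c k)\<^sup>2))) \<le> tailT (x k * u powr (\<gamma> - \<theta>)) * exp (- (b k * u powr \<kappa>))"
          unfolding s_def scale by simp
      next
        have "exp (- ((1 - \<delta>) * u\<^sup>2 / 2)) \<le> 1" using \<delta> by simp
        then show "tailT (s n * u powr \<gamma>) * exp (- ((1 - \<delta>) * u\<^sup>2 / 2)) \<le> tailT (x n * u powr (\<gamma> - \<theta>)) * exp (- (b n * u powr \<kappa>))"
          unfolding s_def scale b_def using tailT_nonneg by (simp add: mult_left_le)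
      qed
      also have "\<dots> = (\<Sum>k\<le>n. tailT (x k * u powr (\<gamma> - \<theta>)) * exp (- (b k * u powr \<kappa>)))"
        by (simp add: lessThan_Suc_atMost[symmetric])
      finally show ?case using elim(2) by simp
    qed
  qed
  have "\<forall>\<^sub>F u in at_top. 0 < u powr \<kappa>"
    using eventually_gt_at_top[of 0] by eventually_elim simp
  from log_ratio_tendsto[OF lower upper this]
  show ?thesis unfolding A1_def min(2) \<kappa>_def .
qed

end

theorem theorem3p3:
  fixes M :: "'a measure" and X :: "real \<Rightarrow> 'a \<Rightarrow> real" and T :: "'a \<Rightarrow> real"
    and t0 a \<beta> d \<alpha> G H r L p \<gamma> :: real
  defines "\<sigma> \<equiv> sdev M X"
  assumes gp: "centered_gaussian_process M X"
    and paths: "AE \<omega> in M. continuous_on {0..} (\<lambda>t. X t \<omega>) \<and> bounded ((\<lambda>t. X t \<omega>) ` {0..})"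
    and t0: "t0 > 0" "\<sigma> t0 = 1" "\<forall>t\<ge>0. t \<noteq> t0 \<longrightarrow> \<sigma> t < 1"
    and A1: "a > 0" "\<beta> > 0"
      "\<forall>\<epsilon>>0. \<exists>\<delta>>0. \<forall>t\<ge>0. \<bar>t - t0\<bar> < \<delta> \<longrightarrow>
          \<bar>\<sigma> t - (1 - a * \<bar>t - t0\<bar> powr \<beta>)\<bar> \<le> \<epsilon> * \<bar>t - t0\<bar> powr \<beta>"
    and A2: "d > 0" "0 < \<alpha>" "\<alpha> \<le> 2"
      "\<forall>\<epsilon>>0. \<exists>\<delta>>0. \<forall>s\<ge>0. \<forall>t\<ge>0. \<bar>s - t0\<bar> < \<delta> \<and> \<bar>t - t0\<bar> < \<delta> \<longrightarrow>
          \<bar>covar M (\<lambda>\<omega>. X s \<omega> / \<sigma> s) (\<lambda>\<omega>. X t \<omega> / \<sigma> t) - (1 - d * \<bar>t - s\<bar> powr \<alpha>)\<bar>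
            \<le> \<epsilon> * \<bar>t - s\<bar> powr \<alpha>"
    and A3: "G > 0" "H > t0" "0 < r" "r \<le> 2"
      "\<forall>s\<in>{0..H}. \<forall>t\<in>{0..H}. \<bar>s - t\<bar> < 1 \<longrightarrow>
          (\<integral>\<omega>. (X t \<omega> - X s \<omega>)\<^sup>2 \<partial>M) \<le> G * \<bar>t - s\<bar> powr r"
    and A4: "Limsup at_top (\<lambda>t. ereal (\<sigma> t)) < 1"
    and \<gamma>: "\<gamma> \<ge> 0"
    and Tmeas: "T \<in> borel_measurable M" "\<forall>\<omega>\<in>space M. T \<omega> \<ge> 0"
    and indep: "prob_space.indep_set M
                  {T -` B \<inter> space M | B. B \<in> sets borel}
                  (sigma_sets (space M) {X t -` B \<inter> space M | t B. t \<ge> 0 \<and> B \<in> sets borel})"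
    and tail: "L > 0" "p > 0"
      "((\<lambda>u. ln (measure M {\<omega> \<in> space M. T \<omega> > u}) / u powr p) \<longlongrightarrow> - L) at_top"
  shows
    "(\<gamma> * p < 2 \<longrightarrow>
        ((\<lambda>u. ln (psiT M X T \<gamma> u) / u\<^sup>2) \<longlongrightarrow> - 1/2) at_top)
   \<and> (\<gamma> * p = 2 \<and> A0 \<sigma> L \<gamma> t0 > 0 \<and>
        (\<forall>K. compact K \<and> K \<subseteq> {0<..} \<longrightarrow>
          (\<exists>B. \<forall>t\<in>K. \<exists>D'. (sigma_hat \<sigma> has_real_derivative D') (at t) \<and> \<bar>D'\<bar> \<le> B))
      \<longrightarrow> ((\<lambda>u. ereal (ln (psiT M X T \<gamma> u) / u\<^sup>2)) \<longlongrightarrow> - sigma_tilde \<sigma> L \<gamma> (A0 \<sigma> L \<gamma> t0)) at_top)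
   \<and> (\<gamma> * p > 2 \<and> \<sigma> 0 > 0 \<longrightarrow>
        ((\<lambda>u. ln (psiT M X T \<gamma> u) / u\<^sup>2) \<longlongrightarrow> - 1 / (2 * (\<sigma> 0)\<^sup>2)) at_top)
   \<and> (\<forall>D \<eta>. \<gamma> * p > 2 \<and> D > 0 \<and> \<eta> > 0 \<and>
        ((\<lambda>t. \<sigma> t / (D * t powr \<eta>)) \<longlongrightarrow> 1) (at_right 0) \<longrightarrow>
        ((\<lambda>u. ln (psiT M X T \<gamma> u) / u powr (2 * p * (\<eta> * \<gamma> + 1) / (2 * \<eta> + p)))
          \<longlongrightarrow> - (1/2 * D powr (- (2 * p / (2 * \<eta> + p))) * (L * p / \<eta>) powr (2 * \<eta> / (2 * \<eta> + p))
                 + L powr (2 * \<eta> / (2 * \<eta> + p)) * (\<eta> / (p * D\<^sup>2)) powr (p / (2 * \<eta> + p)))) at_top)"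
proof -
  interpret prob_space M using gp by (simp add: centered_gaussian_process_def)
  have nn: "0 \<le> \<sigma> t" for t unfolding \<sigma>_def sdev_def by simp
  have le1: "\<sigma> t \<le> 1" if "0 \<le> t" for t using t0(2,3) that by (cases "t = t0") (auto intro: less_imp_le)
  interpret W: gaussian_weibull_horizon M X T L p
    using gp paths le1 Tmeas indep tail by unfold_locales (auto simp: \<sigma>_def)
  \<comment> \<open>Continuity is inherited from the mean-square bound (A3), which covers
    \<open>[0, t0]\<close> because \<open>H > t0\<close>.\<close>
  have cont: "continuous_on {0..t0} \<sigma>"
    unfolding continuous_on_iff
  proof (intro ballI allI impI)
    fix s e :: real assume s: "s \<in> {0..t0}" and e: "0 < e"
    have "((\<lambda>h. sqrt (G * h powr r)) \<longlongrightarrow> sqrt (G * 0)) (at_right 0)"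
      using A3(1,3) by (intro tendsto_intros) real_asymp
    then have "\<forall>\<^sub>F h in at_right 0. sqrt (G * h powr r) < e"
      by (rule order_tendstoD(2)) (use e in simp)
    then obtain d where d: "0 < d" "\<And>h. 0 < h \<Longrightarrow> h < d \<Longrightarrow> sqrt (G * h powr r) < e"
      unfolding eventually_at_right_field by auto
    show "\<exists>d>0. \<forall>t\<in>{0..t0}. dist t s < d \<longrightarrow> dist (\<sigma> t) (\<sigma> s) < e"
    proof (intro exI[of _ "min d 1"] conjI ballI impI)
      fix t assume t: "t \<in> {0..t0}" "dist t s < min d 1"
      show "dist (\<sigma> t) (\<sigma> s) < e"
      proof (cases "t = s")
        case False
        have "\<bar>\<sigma> t - \<sigma> s\<bar> \<le> sqrt (\<integral>\<omega>. (X t \<omega> - X s \<omega>)\<^sup>2 \<partial>M)"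
          unfolding \<sigma>_def by (rule sdev_diff_le[OF gp]) (use s t in auto)
        also have "\<dots> \<le> sqrt (G * \<bar>t - s\<bar> powr r)"
        proof (rule real_sqrt_le_mono)
          have "s \<in> {0..H}" "t \<in> {0..H}" "\<bar>s - t\<bar> < 1" using s t A3(2) by (auto simp: dist_real_def)
          then show "(\<integral>\<omega>. (X t \<omega> - X s \<omega>)\<^sup>2 \<partial>M) \<le> G * \<bar>t - s\<bar> powr r" using A3(5) by blast
        qed
        also have "\<dots> < e" by (rule d(2)) (use False t in \<open>auto simp: dist_real_def\<close>)
        finally show ?thesis by (simp add: dist_real_def)
      qed (use e in simp)
    qed (use d in auto)
  qed
  have cont0: "\<exists>d>0. \<forall>t. 0 \<le> t \<and> t \<le> d \<longrightarrow> \<bar>\<sigma> t - \<sigma> 0\<bar> \<le> e" if "0 < e" for e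
  proof -
    obtain d where d: "0 < d" "\<And>t. t \<in> {0..t0} \<Longrightarrow> dist t 0 < d \<Longrightarrow> dist (\<sigma> t) (\<sigma> 0) < e"
      using cont \<open>0 < e\<close> t0(1) unfolding continuous_on_iff by (metis atLeastAtMost_iff less_imp_le order_refl)
    show ?thesis
    proof (intro exI[of _ "min t0 (d / 2)"] conjI allI impI)
      fix t assume "0 \<le> t \<and> t \<le> min t0 (d / 2)"
      then show "\<bar>\<sigma> t - \<sigma> 0\<bar> \<le> e" using d(1) d(2)[of t] by (simp add: dist_real_def)
    qed (use d t0 in auto)
  qed
  show ?thesis
  proof (intro conjI impI allI, goal_cases)
    case 1
    then show ?case using W.psiT_limit_short_horizon[OF \<gamma> 1, of t0] t0 unfolding \<sigma>_def by simp
  next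
    case 2
    then have gp2: "\<gamma> * p = 2" by simp
    then have g0: "0 < \<gamma>" using \<gamma> by (cases "\<gamma> = 0") auto
    \<comment> \<open>Identifies the exponent \<open>2 / \<gamma>\<close> in
      \<open>sigma_tilde\<close> with the tail exponent \<open>p\<close>.\<close>
    have pg: "2 / \<gamma> = p" using gp2 g0 by (simp add: field_simps)
    have "0 < \<sigma> t0" using t0 by simp
    note A = A0_minimizer[OF cont less_imp_le[OF t0(1)] nn this g0 tail(1), unfolded pg]
    define m where "m = 1 / (2 * (sigma_hat \<sigma> (A0 \<sigma> L \<gamma> t0))\<^sup>2) + L * A0 \<sigma> L \<gamma> t0 powr p"
    have "((\<lambda>u. ln (psiT M X T \<gamma> u) / u\<^sup>2) \<longlongrightarrow> - m) at_top"
      using W.psiT_limit_critical[OF g0 gp2 less_imp_le[OF t0(1)], of "A0 \<sigma> L \<gamma> t0" m] A cont t0(2)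
      unfolding \<sigma>_def m_def by auto
    then have "((\<lambda>u. ereal (ln (psiT M X T \<gamma> u) / u\<^sup>2)) \<longlongrightarrow> ereal (- m)) at_top" by simp
    moreover have "sigma_tilde \<sigma> L \<gamma> (A0 \<sigma> L \<gamma> t0) = ereal m"
      unfolding sigma_tilde_def m_def pg using A(2) by simp
    ultimately show ?case by simp
  next
    case 3
    have "\<exists>d>0. \<forall>t. 0 \<le> t \<and> t \<le> d \<longrightarrow> \<sigma> t \<le> \<sigma> 0 + e" if "0 < e" for e
      using cont0[OF that] by (force simp: abs_le_iff)
    then show ?case using W.psiT_limit_long_horizon[OF \<gamma>] 3 unfolding \<sigma>_def by simp
  next
    case (4 D \<eta>)
    \<comment> \<open>The power law concerns \<open>t > 0\<close> only; the value at 0 follows from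
      continuity, as \<open>D * t powr \<eta>\<close> tends to 0.\<close>
    have "\<sigma> 0 = 0"
    proof (rule tendsto_unique[OF trivial_limit_at_right_real])
      show "(\<sigma> \<longlongrightarrow> \<sigma> 0) (at_right 0)"
      proof (rule tendstoI)
        fix e :: real assume "0 < e"
        then obtain d where "0 < d" "\<And>t. 0 \<le> t \<Longrightarrow> t \<le> d \<Longrightarrow> \<bar>\<sigma> t - \<sigma> 0\<bar> \<le> e / 2" using cont0[of "e / 2"] by auto
        then show "\<forall>\<^sub>F t in at_right 0. dist (\<sigma> t) (\<sigma> 0) < e"
          unfolding eventually_at_right_field dist_real_def using \<open>0 < e\<close>
          by (intro exI[of _ d]) (auto intro: order_le_less_trans[of _ "e / 2"])
      qed
      have "((\<lambda>t. \<sigma> t / (D * t powr \<eta>) * (D * t powr \<eta>)) \<longlongrightarrow> 1 * (D * 0)) (at_right 0)"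
        using 4 by (intro tendsto_mult) (auto, real_asymp)
      then have "((\<lambda>t. \<sigma> t / (D * t powr \<eta>) * (D * t powr \<eta>)) \<longlongrightarrow> 0) (at_right 0)" by simp
      then show "(\<sigma> \<longlongrightarrow> 0) (at_right 0)"
      proof (rule Lim_transform_eventually)
        show "\<forall>\<^sub>F t in at_right 0. \<sigma> t / (D * t powr \<eta>) * (D * t powr \<eta>) = \<sigma> t"
          using eventually_at_right_less[of 0] by eventually_elim (use 4 in simp)
      qed
    qed
    then show ?case using W.psiT_limit_power_sdev[OF \<gamma>, of D \<eta>] 4 unfolding \<sigma>_def by simp
  qed
qed

end
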